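(* Let $G$ be a ribbon graph. Then $K(G;x,y,a,b)=K(D(G);x,y,a,b)$.
   Context: A ribbon graph $G=(V,E)$ is a surface with boundary, represented as the union of two finite sets of discs, the vertices $V$ and the edges $E$, such that: the vertices and edges intersect in disjoint line segments; each such line segment lies on the boundary of precisely one vertex and precisely one edge; every edge contains exactly two such line segments. For $A\subseteq E$, the following refer to the spanning ribbon subgraph $(V,A)$ of $G$: $k_G(A)$ is its number of connected components, $f_G(A)$ its number of boundary components, $r_G(A)=|V|-k_G(A)$, and $\gamma_G(A)=2k_G(A)-|V|+|A|-f_G(A)$ its Euler genus. $k(G)=k_G(E)$ and $A^c=E-A$. The geometric dual $G^*$ is obtained by capping off each boundary component of $G$ with a disc, taking these discs as the vertices of $G^*$, deleting the vertices of $G$, and keeping the same edges, so $E(G^* )=E(G)$. The delta-matroid $D(G)$ has ground set $E$ and feasible sets the $A\subseteq E$ with $f_G(A)=k(G)$ (the edge sets of spanning quasi-trees). A delta-matroid is $D=(E,\mathcal{F})$ with $E$ a finite set and $\mathcal F$ a non-empty collection of subsets of $E$ (feasible sets) such that for all $X,Y\in\mathcal F$ and $u\in X\bigtriangleup Y$ there is $v\in X\bigtriangleup Y$ (possibly $v=u$) with $X\bigtriangleup\{u,v\}\in\mathcal F$. $D_{\min}$ and $D_{\max}$ are the matroids on $E$ whose bases are the feasible sets of minimum, respectively maximum, cardinality; $r_M$ denotes matroid rank and $r(M)=r_M(E)$. The dual is $D^*=(E,\{E-F\mid F\in\mathcal{F}\})$. The width is $w(D)=r(D_{\max})-r(D_{\min})$.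 Deletion: if $e$ is not in every feasible set, $D\setminus e=(E-e,\{F\in\mathcal{F}\mid e\notin F\})$; if $e$ is in every feasible set, $D\setminus e=(E-e,\{F-e\mid F\in\mathcal{F}\})$. Deleting a set of elements one at a time is independent of the order. $D|A=D\setminus(E-A)$ and $w_D(A)=w(D|A)$. The Krushkal polynomials are $$K(G;x,y,a,b)=\sum_{A\subseteq E}(x-1)^{r_G(E)-r_G(A)}y^{r_{G^*}(E)-r_{G^*}(A^c)}a^{\gamma_G(A)}b^{\gamma_{G^*}(A^c)},$$ $$K(D;x,y,a,b)=\sum_{A\subseteq E}(x-1)^{r_{D_{\min}}(E)-r_{D_{\min}}(A)}y^{r_{(D^* )_{\min}}(E)-r_{(D^* )_{\min}}(A^c)}a^{w_D(A)}b^{w_{D^*}(A^c)}.$$ *)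

theory Defs
  imports "HOL-Analysis.Analysis"
begin

section \<open>Surfaces with boundary, discs and line segments\<close>

text \<open>The complex plane serves as the model of the Euclidean plane.\<close>

definition surface_with_boundary :: "'a topology \<Rightarrow> bool" where
  "surface_with_boundary X \<longleftrightarrow>
     Hausdorff_space X \<and> second_countable X \<and>
     (\<forall>p\<in>topspace X. \<exists>U. openin X U \<and> p \<in> U \<and>
        (subtopology X U homeomorphic_space (euclidean :: complex topology) \<or>
         subtopology X U homeomorphic_space top_of_set {z :: complex. 0 \<le> Im z}))"

text \<open>The boundary in the sense of manifolds: the points without a neighbourhood that is an open
  disc. It is intrinsic to the space and is not the frontier in some ambient space.\<close>

definition surface_boundary :: "'a topology \<Rightarrow> 'a set" where
  "surface_boundary X =
     {p \<in> topspace X. \<not> (\<exists>U. openin X U \<and> p \<in> U \<and>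
        subtopology X U homeomorphic_space (euclidean :: complex topology))}"

definition boundary_components :: "'a topology \<Rightarrow> 'a set set" where
  "boundary_components X = connected_components_of (subtopology X (surface_boundary X))"

definition is_disc :: "'a topology \<Rightarrow> 'a set \<Rightarrow> bool" where
  "is_disc X D \<longleftrightarrow> D \<subseteq> topspace X \<and>
     subtopology X D homeomorphic_space top_of_set (cball (0 :: complex) 1)"

definition is_segment :: "'a topology \<Rightarrow> 'a set \<Rightarrow> bool" where
  "is_segment X s \<longleftrightarrow> s \<subseteq> topspace X \<and>
     subtopology X s homeomorphic_space top_of_set {0..1 :: real}"


section \<open>Ribbon graphs\<close>

text \<open>The two sets of discs are families indexed by labels, so that a ribbon graph and its
  geometric dual, which live on different surfaces, have literally the same edge set.\<close>

record ('a, 'v, 'e) ribbon_graph =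
  surface :: "'a topology"
  verts :: "'v set"
  edges :: "'e set"
  vdisc :: "'v \<Rightarrow> 'a set"
  edisc :: "'e \<Rightarrow> 'a set"

text \<open>Disjoint segments, finitely many of them since each edge contains two, are exactly the
  connected components of their union.\<close>

definition segments :: "('a, 'v, 'e, 'm) ribbon_graph_scheme \<Rightarrow> 'a set set" where
  "segments G = connected_components_of
     (subtopology (surface G) ((\<Union>v\<in>verts G. vdisc G v) \<inter> (\<Union>e\<in>edges G. edisc G e)))"

definition ribbon_graph :: "('a, 'v, 'e, 'm) ribbon_graph_scheme \<Rightarrow> bool" where
  "ribbon_graph G \<longleftrightarrow>
     surface_with_boundary (surface G) \<and>
     finite (verts G) \<and> finite (edges G) \<and>
     topspace (surface G) = (\<Union>v\<in>verts G. vdisc G v) \<union> (\<Union>e\<in>edges G. edisc G e) \<and>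
     (\<forall>v\<in>verts G. is_disc (surface G) (vdisc G v)) \<and>
     (\<forall>e\<in>edges G. is_disc (surface G) (edisc G e)) \<and>
     disjoint_family_on (vdisc G) (verts G) \<and>
     disjoint_family_on (edisc G) (edges G) \<and>
     (\<forall>s\<in>segments G. is_segment (surface G) s \<and>
        (\<exists>!v. v \<in> verts G \<and> s \<subseteq> surface_boundary (subtopology (surface G) (vdisc G v))) \<and>
        (\<exists>!e. e \<in> edges G \<and> s \<subseteq> surface_boundary (subtopology (surface G) (edisc G e)))) \<and>
     (\<forall>e\<in>edges G. card {s \<in> segments G. s \<subseteq> edisc G e} = 2)"

definition spanning_subgraph ::
    "('a, 'v, 'e, 'm) ribbon_graph_scheme \<Rightarrow> 'e set \<Rightarrow> ('a, 'v, 'e, 'm) ribbon_graph_scheme" where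
  "spanning_subgraph G A =
     G\<lparr>surface := subtopology (surface G) ((\<Union>v\<in>verts G. vdisc G v) \<union> (\<Union>e\<in>A. edisc G e)),
       edges := A\<rparr>"

definition rg_k :: "('a, 'v, 'e, 'm) ribbon_graph_scheme \<Rightarrow> 'e set \<Rightarrow> nat" where
  "rg_k G A = card (connected_components_of (surface (spanning_subgraph G A)))"

definition rg_f :: "('a, 'v, 'e, 'm) ribbon_graph_scheme \<Rightarrow> 'e set \<Rightarrow> nat" where
  "rg_f G A = card (boundary_components (surface (spanning_subgraph G A)))"

definition rg_rank :: "('a, 'v, 'e, 'm) ribbon_graph_scheme \<Rightarrow> 'e set \<Rightarrow> int" where
  "rg_rank G A = int (card (verts G)) - int (rg_k G A)"

definition euler_genus :: "('a, 'v, 'e, 'm) ribbon_graph_scheme \<Rightarrow> 'e set \<Rightarrow> int" where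
  "euler_genus G A =
     2 * int (rg_k G A) - int (card (verts G)) + int (card A) - int (rg_f G A)"


section \<open>The geometric dual\<close>

text \<open>One closed unit disc is glued to the surface of G along each boundary component C. Every such
  component is a circle; a homeomorphism from the unit circle onto it is chosen as attaching map.
  The points of the glued space are those of G, tagged Inl, together with the interior points z of
  the disc at C, written Inr (C, z).\<close>

definition attach_map :: "('a, 'v, 'e, 'm) ribbon_graph_scheme \<Rightarrow> 'a set \<Rightarrow> complex \<Rightarrow> 'a" where
  "attach_map G C =
     (SOME g. homeomorphic_map (top_of_set (sphere 0 1)) (subtopology (surface G) C) g)"

definition cap_map ::
    "('a, 'v, 'e, 'm) ribbon_graph_scheme \<Rightarrow> 'a set \<Rightarrow> complex \<Rightarrow> 'a + 'a set \<times> complex" where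
  "cap_map G C z = (if norm z = 1 then Inl (attach_map G C z) else Inr (C, z))"

definition cap :: "('a, 'v, 'e, 'm) ribbon_graph_scheme \<Rightarrow> 'a set \<Rightarrow> ('a + 'a set \<times> complex) set" where
  "cap G C = cap_map G C ` cball 0 1"

text \<open>The gluing (quotient) topology: a set is open iff its preimages in the surface of G and in
  each of the attached discs are open.\<close>

definition capped_open ::
    "('a, 'v, 'e, 'm) ribbon_graph_scheme \<Rightarrow> ('a + 'a set \<times> complex) set \<Rightarrow> bool" where
  "capped_open G U \<longleftrightarrow>
     U \<subseteq> Inl ` topspace (surface G) \<union> (\<Union>C\<in>boundary_components (surface G). cap G C) \<and>
     openin (surface G) {p \<in> topspace (surface G). Inl p \<in> U} \<and>
     (\<forall>C\<in>boundary_components (surface G).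
        openin (top_of_set (cball 0 1)) {z \<in> cball 0 1. cap_map G C z \<in> U})"

lemma istopology_capped_open: "istopology (capped_open G)"
  unfolding istopology_def
proof (intro conjI allI impI)
  fix S T assume S: "capped_open G S" and T: "capped_open G T"
  have eq: "{x \<in> B. h x \<in> S \<inter> T} = {x \<in> B. h x \<in> S} \<inter> {x \<in> B. h x \<in> T}"
    for B :: "'z set" and h by blast
  show "capped_open G (S \<inter> T)"
    using S T unfolding capped_open_def eq by (auto intro: openin_Int)
next
  fix K assume K: "\<forall>S\<in>K. capped_open G S"
  have eq: "{x \<in> B. h x \<in> \<Union>K} = (\<Union>S\<in>K. {x \<in> B. h x \<in> S})"
    for B :: "'z set" and h by blast
  show "capped_open G (\<Union>K)"
    using K unfolding capped_open_def eq
    by (intro conjI ballI openin_Union) (auto simp: Sup_le_iff)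
qed

definition capped_surface ::
    "('a, 'v, 'e, 'm) ribbon_graph_scheme \<Rightarrow> ('a + 'a set \<times> complex) topology" where
  "capped_surface G = topology (capped_open G)"

text \<open>Deleting the vertices of G leaves the union of the caps and the edges of G.\<close>

definition geometric_dual ::
    "('a, 'v, 'e, 'm) ribbon_graph_scheme \<Rightarrow> ('a + 'a set \<times> complex, 'a set, 'e) ribbon_graph" where
  "geometric_dual G =
     \<lparr>surface = subtopology (capped_surface G)
        ((\<Union>C\<in>boundary_components (surface G). cap G C) \<union> (\<Union>e\<in>edges G. Inl ` edisc G e)),
      verts = boundary_components (surface G),
      edges = edges G,
      vdisc = cap G,
      edisc = (\<lambda>e. Inl ` edisc G e)\<rparr>"


section \<open>Delta-matroids\<close>

text \<open>The operations below are total on pairs (ground set, collection of feasible sets); they carry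
  their usual meaning when the pair is a delta-matroid.\<close>

type_synonym 'e set_system = "'e set \<times> 'e set set"

definition delta_matroid :: "'e set_system \<Rightarrow> bool" where
  "delta_matroid D \<longleftrightarrow>
     finite (fst D) \<and> snd D \<noteq> {} \<and> (\<forall>F\<in>snd D. F \<subseteq> fst D) \<and>
     (\<forall>X\<in>snd D. \<forall>Y\<in>snd D. \<forall>u\<in>sym_diff X Y. \<exists>v\<in>sym_diff X Y. sym_diff X {u, v} \<in> snd D)"

text \<open>A matroid is represented by its collection of bases.\<close>

definition min_bases :: "'e set_system \<Rightarrow> 'e set set" where
  "min_bases D = {F \<in> snd D. \<forall>F'\<in>snd D. card F \<le> card F'}"

definition max_bases :: "'e set_system \<Rightarrow> 'e set set" where
  "max_bases D = {F \<in> snd D. \<forall>F'\<in>snd D. card F' \<le> card F}"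

definition matroid_rank :: "'e set set \<Rightarrow> 'e set \<Rightarrow> nat" where
  "matroid_rank \<B> A = Max {card I |I. I \<subseteq> A \<and> (\<exists>B\<in>\<B>. I \<subseteq> B)}"

definition dm_dual :: "'e set_system \<Rightarrow> 'e set_system" where
  "dm_dual D = (fst D, {fst D - F |F. F \<in> snd D})"

definition dm_delete :: "'e \<Rightarrow> 'e set_system \<Rightarrow> 'e set_system" where
  "dm_delete e D =
     (fst D - {e},
      if \<forall>F\<in>snd D. e \<in> F then {F - {e} |F. F \<in> snd D} else {F \<in> snd D. e \<notin> F})"

text \<open>The elements are deleted one at a time, in an arbitrarily chosen order, which is immaterial
  for delta-matroids.\<close>

definition dm_delete_set :: "'e set_system \<Rightarrow> 'e set \<Rightarrow> 'e set_system" where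
  "dm_delete_set D X = fold dm_delete (SOME xs. distinct xs \<and> set xs = X) D"

definition dm_restrict :: "'e set_system \<Rightarrow> 'e set \<Rightarrow> 'e set_system" where
  "dm_restrict D A = dm_delete_set D (fst D - A)"

definition width :: "'e set_system \<Rightarrow> int" where
  "width D = int (matroid_rank (max_bases D) (fst D)) - int (matroid_rank (min_bases D) (fst D))"

definition width_on :: "'e set_system \<Rightarrow> 'e set \<Rightarrow> int" where
  "width_on D A = width (dm_restrict D A)"

definition ribbon_delta_matroid :: "('a, 'v, 'e, 'm) ribbon_graph_scheme \<Rightarrow> 'e set_system" where
  "ribbon_delta_matroid G = (edges G, {A. A \<subseteq> edges G \<and> rg_f G A = rg_k G (edges G)})"


section \<open>The Krushkal polynomials\<close>

text \<open>The polynomials are given by their values at x, y, a, b in an arbitrary commutative ring;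
  taking the ring to be an integer polynomial ring and x, y, a, b to be its indeterminates yields
  the polynomials themselves. All exponents are non-negative, so that nat does not truncate.\<close>

definition krushkal_ribbon ::
    "('a, 'v, 'e, 'm) ribbon_graph_scheme \<Rightarrow> 'r \<Rightarrow> 'r \<Rightarrow> 'r \<Rightarrow> 'r \<Rightarrow> 'r :: comm_ring_1" where
  "krushkal_ribbon G x y a b =
     (\<Sum>A\<in>Pow (edges G).
        (x - 1) ^ nat (rg_rank G (edges G) - rg_rank G A) *
        y ^ nat (rg_rank (geometric_dual G) (edges G)
                 - rg_rank (geometric_dual G) (edges G - A)) *
        a ^ nat (euler_genus G A) *
        b ^ nat (euler_genus (geometric_dual G) (edges G - A)))"

definition krushkal_dm ::
    "'e set_system \<Rightarrow> 'r \<Rightarrow> 'r \<Rightarrow> 'r \<Rightarrow> 'r \<Rightarrow> 'r :: comm_ring_1" where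
  "krushkal_dm D x y a b =
     (\<Sum>A\<in>Pow (fst D).
        (x - 1) ^ nat (int (matroid_rank (min_bases D) (fst D))
                       - int (matroid_rank (min_bases D) A)) *
        y ^ nat (int (matroid_rank (min_bases (dm_dual D)) (fst D))
                 - int (matroid_rank (min_bases (dm_dual D)) (fst D - A))) *
        a ^ nat (width_on D A) *
        b ^ nat (width_on (dm_dual D) (fst D - A)))"

end

theory Submission
  imports Defs
begin

text \<open>Let k(A) and f(A) be the numbers of components and of boundary components of the spanning ribbon
subgraph (V,A). Both sides of the theorem are sums over A, and they agree term by term: the
exponents on the left are expressed by k and f of the ribbon graph and of its dual, and those on
the right are ranks and widths that can be computed from the same two functions.

Only a few properties of k and f matter; they form the locale
\<open>face_component_system\<close>. An edge either joins two components, and then it lowers both counts by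
one, or it leaves k alone and changes f by at most one; k behaves like the component count of a
graph; k \<le> f; and if k(A) < f(A), some edge of A can be removed so that two boundary
components merge. Hence the feasible sets of minimum size are the maximal spanning forests, which
gives the ranks (\<open>matroid_rank_min\<close>). Deleting edges from D(G) gives the delta-matroid of the
smaller ribbon graph (\<open>dm_restrict_dm\<close>), and a feasible set of maximum size in (V,A) is obtained
from A by removing f(A) - k(A) edges, each merging two boundary components, which gives the
widths (\<open>width_on_dm\<close>).

The boundary circles of all vertices and edges form a space in which
every edge is a square: two opposite arcs are its segments and the other two are its free sides. The
boundary of (V,A) arises from the vertex circles by replacing, for each edge in A, the two segments
by the two sides. Such a replacement turns disjoint circles into disjoint circles, and joins two
circles exactly if the segments lie on different ones (\<open>surgery\<close>). This yields all properties of
k and f listed above, and it shows that every boundary component is a circle. The situation is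
symmetric: starting from the boundary of G and exchanging segments and sides gives the system of
the dual graph, in which the boundary of (V*, A) is the boundary of (V, E - A) (\<open>dual_bd\<close>).

The passage from discs to circles is the identification of the
boundary of (V,A) as a surface (\<open>surface_boundary_surf\<close>): free points of a rim are boundary points by
invariance of domain, points in the interior of a segment have a plane neighbourhood made of a collar in the vertex
and a collar in the edge, and the ends of segments are boundary points because the boundary is closed.
This applies to G and to the caps and edges of the capped surface alike, so that both satisfy the
hypotheses of the combinatorial part, and the duality of the squares shows that the boundary components
of (V*, A) and (V, E - A) are equal in number and that G and G* have equally many components. Hence the
dual of D(G) is D(G*).\<close>

section \<open>Delta-matroids from component and boundary counts\<close>

text \<open>The properties of the numbers k of components and f of boundary components of spanning ribbon
subgraphs from which everything about D(G) follows. Condition \<open>k_mono\<close> is the submodularity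
of the graphic rank in local form. An edge that joins two components joins their boundaries as well
(\<open>bridge\<close>), and a connected ribbon graph with several boundary components has an edge separating
two of them (\<open>merge\<close>).\<close>

locale face_component_system =
  fixes E :: "'e set" and f k :: "'e set \<Rightarrow> nat"
  assumes finite_E: "finite E"
    and f_empty: "f {} = k {}"
    and k_step: "\<lbrakk>A \<subseteq> E; e \<in> E - A\<rbrakk> \<Longrightarrow> k (insert e A) = k A \<or> Suc (k (insert e A)) = k A"
    and k_mono: "\<lbrakk>A \<subseteq> A'; A' \<subseteq> E; e \<in> E - A'; k (insert e A) = k A\<rbrakk> \<Longrightarrow> k (insert e A') = k A'"
    and k_le_f: "A \<subseteq> E \<Longrightarrow> k A \<le> f A"
    and f_step: "\<lbrakk>A \<subseteq> E; e \<in> E - A\<rbrakk> \<Longrightarrow> f (insert e A) \<le> Suc (f A) \<and> f A \<le> Suc (f (insert e A))"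
    and bridge: "\<lbrakk>A \<subseteq> E; e \<in> E - A; Suc (k (insert e A)) = k A\<rbrakk> \<Longrightarrow> Suc (f (insert e A)) = f A"
    and merge: "\<lbrakk>A \<subseteq> E; k A < f A\<rbrakk> \<Longrightarrow> \<exists>e\<in>A. Suc (f (A - {e})) = f A"
begin

text \<open>The delta-matroid of the spanning ribbon subgraph with edge set A: its feasible sets are the
spanning quasi-trees.\<close>

definition dm :: "'e set \<Rightarrow> 'e set_system" where
  "dm A = (A, {B. B \<subseteq> A \<and> f B = k A})"

text \<open>The forests: every edge reduces the number of components.\<close>

definition indep :: "'e set \<Rightarrow> bool" where
  "indep I \<longleftrightarrow> I \<subseteq> E \<and> card I + k I = k {}"

lemma finite_sub: "A \<subseteq> E \<Longrightarrow> finite A"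
  using finite_E finite_subset by blast

text \<open>The hypotheses speak of adding one edge; this induction turns them into comparisons of a set with
any larger one.\<close>

lemma grow_induct [consumes 2, case_names base step]:
  assumes "A \<subseteq> A'" "A' \<subseteq> E" and base: "P A"
    and step: "\<And>B e. \<lbrakk>A \<subseteq> B; B \<subseteq> A'; e \<in> A' - B; P B\<rbrakk> \<Longrightarrow> P (insert e B)"
  shows "P A'"
proof -
  have "X \<subseteq> A' \<Longrightarrow> P (A \<union> X)" if "finite X" for X
    using that
  proof (induction X)
    case (insert e X)
    then show ?case
      using step[of "A \<union> X" e] assms(1) by (cases "e \<in> A \<union> X") (auto simp: insert_absorb)
  qed (simp add: base)
  from this[OF finite_sub[OF assms(2)]] show ?thesis using assms(1) by (simp add: Un_absorb1)
qed

lemma k_antimono: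
  assumes "A \<subseteq> A'" "A' \<subseteq> E" shows "k A' \<le> k A"
  using assms
proof (induction rule: grow_induct)
  case (step B e)
  then have "B \<subseteq> E" "e \<in> E - B" using assms(2) by auto
  then show ?case using k_step[of B e] step(4) by auto
qed simp

lemma k_card: "A \<subseteq> E \<Longrightarrow> k {} \<le> card A + k A"
proof (induction "card A" arbitrary: A)
  case 0 then show ?case using finite_sub by auto
next
  case (Suc n)
  then obtain e where e: "e \<in> A" by fastforce
  have A: "A - {e} \<subseteq> E" "insert e (A - {e}) = A" "e \<in> E - (A - {e})" using e Suc by auto
  have "card (A - {e}) = n" using Suc(2) e by simp
  then have "k {} \<le> n + k (A - {e})" using Suc(1)[of "A - {e}"] A by simp
  moreover have "k (A - {e}) \<le> Suc (k A)" using k_step[OF A(1,3)] A(2) by auto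
  ultimately show ?case using Suc(2) by simp
qed

lemma indep_subset:
  assumes "indep I" "J \<subseteq> I" shows "indep J"
proof -
  have I: "I \<subseteq> E" "finite I" using assms finite_sub by (auto simp: indep_def)
  have "k J \<le> k I + card (I - J)"
    using assms(2) I(1)
  proof (induction rule: grow_induct)
    case (step B e)
    then have B: "B \<subseteq> E" "e \<in> E - B" "insert e B - J = insert e (B - J)" using I(1) by auto
    then show ?case using k_step[OF B(1,2)] step finite_sub[OF B(1)] by auto
  qed simp
  moreover have "card (I - J) + card J = card I"
    using assms(2) I(2) by (metis card_Diff_subset card_mono finite_subset le_add_diff_inverse2)
  moreover have "J \<subseteq> E" using assms by (auto simp: indep_def)
  ultimately show ?thesis using assms(1) k_card[of J] by (simp add: indep_def)
qed

text \<open>In a forest every edge is a bridge, so that f and k drop together as it is built up.\<close>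

lemma f_indep:
  assumes "indep I" shows "f I = k I"
proof -
  have "finite I" using assms finite_sub by (simp add: indep_def)
  then show ?thesis using assms
  proof (induction I)
    case empty then show ?case using f_empty by simp
  next
    case (insert e I)
    have I: "indep I" using indep_subset[OF insert.prems] by blast
    then have "Suc (k (insert e I)) = k I"
      using insert.prems insert.hyps by (simp add: indep_def)
    moreover from this have "Suc (f (insert e I)) = f I"
      using bridge[of I e] I insert by (auto simp: indep_def)
    ultimately show ?case using insert.IH[OF I] by simp
  qed
qed

text \<open>A maximal forest J in A between I and A has no edge of A joining two of its components, and
by \<open>k_mono\<close> adding all of A joins none either.\<close>

lemma indep_extend:
  assumes "indep I" "I \<subseteq> A" "A \<subseteq> E"
  obtains J where "indep J" "I \<subseteq> J" "J \<subseteq> A" "k J = k A"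
proof -
  define S where "S = {J. indep J \<and> I \<subseteq> J \<and> J \<subseteq> A}"
  have "S \<subseteq> Pow A" by (auto simp: S_def)
  then have "finite S" using finite_sub[OF assms(3)] by (simp add: finite_subset)
  moreover have "I \<in> S" using assms by (simp add: S_def)
  ultimately obtain J where J': "J \<in> S" "\<forall>J'\<in>S. J \<subseteq> J' \<longrightarrow> J = J'"
    using finite_has_maximal2[of S I] by metis
  then have J: "indep J" "I \<subseteq> J" "J \<subseteq> A" by (simp_all add: S_def)
  have max: "J' = J" if "indep J'" "I \<subseteq> J'" "J' \<subseteq> A" "J \<subseteq> J'" for J'
    using J'(2) that by (auto simp: S_def)
  have JE: "J \<subseteq> E" using J assms by blast
  have stuck: "k (insert e J) = k J" if e: "e \<in> A - J" for e
  proof (rule ccontr)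
    assume "k (insert e J) \<noteq> k J"
    then have "Suc (k (insert e J)) = k J" using k_step[OF JE, of e] e assms(3) by blast
    then have "indep (insert e J)" using J e assms(3) finite_sub[OF JE] by (auto simp: indep_def)
    then show False using max[of "insert e J"] J e by auto
  qed
  have "k A = k J"
    using J(3) assms(3)
  proof (induction rule: grow_induct)
    case (step B e)
    have "B \<subseteq> E" "e \<in> E - B" "e \<in> A - J" using step assms(3) by auto
    then show ?case using k_mono[OF step(1) _ _ stuck[of e]] step(4) by simp
  qed simp
  then show ?thesis using that[OF J] by simp
qed

lemma indep_empty: "indep {}" by (simp add: indep_def)

text \<open>A feasible set F of A satisfies k(A) \<le> k(F) \<le> f(F) = k(A), so it has at least as many edges
as a maximal forest of A, with equality only for a forest; and maximal forests are feasible.\<close>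

lemma dm_min_bases:
  assumes A: "A \<subseteq> E"
  shows "min_bases (dm A) = {F. indep F \<and> F \<subseteq> A \<and> k F = k A}"
proof -
  obtain T where T: "indep T" "T \<subseteq> A" "k T = k A"
    using indep_extend[OF indep_empty _ A] by auto
  have feas: "k F = k A \<and> k {} \<le> card F + k A" if "F \<subseteq> A" "f F = k A" for F
  proof -
    have "F \<subseteq> E" using that A by blast
    then have "k F \<le> k A" "k A \<le> k F"
      using k_le_f[of F] that k_antimono[OF that(1) A] by simp_all
    then show ?thesis using k_card[OF \<open>F \<subseteq> E\<close>] by simp
  qed
  have cT: "card T + k A = k {}" using T by (simp add: indep_def)
  have "F \<in> min_bases (dm A) \<longleftrightarrow> indep F \<and> F \<subseteq> A \<and> k F = k A" for F
  proof
    assume "F \<in> min_bases (dm A)"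
    then have F: "F \<subseteq> A" "f F = k A" "card F \<le> card T"
      using T f_indep[OF T(1)] by (auto simp: min_bases_def dm_def)
    then show "indep F \<and> F \<subseteq> A \<and> k F = k A"
      using feas[OF F(1,2)] cT A by (auto simp: indep_def)
  next
    assume F: "indep F \<and> F \<subseteq> A \<and> k F = k A"
    then have "card F + k A = k {}" by (simp add: indep_def)
    then have "card F \<le> card F'" if "F' \<subseteq> A" "f F' = k A" for F'
      using feas[OF that] by linarith
    then show "F \<in> min_bases (dm A)" using F f_indep[of F] by (auto simp: min_bases_def dm_def)
  qed
  then show ?thesis by blast
qed

lemma matroid_rank_min:
  assumes A: "A \<subseteq> E" and X: "X \<subseteq> A"
  shows "int (matroid_rank (min_bases (dm A)) X) = int (k {}) - int (k X)"
proof -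
  have XE: "X \<subseteq> E" using A X by blast
  let ?S = "{card I |I. I \<subseteq> X \<and> (\<exists>B\<in>min_bases (dm A). I \<subseteq> B)}"
  obtain J where J: "indep J" "J \<subseteq> X" "k J = k X"
    using indep_extend[OF indep_empty _ XE] by auto
  obtain F where F: "indep F" "J \<subseteq> F" "F \<subseteq> A" "k F = k A"
    using indep_extend[OF J(1) _ A] J(2) X by blast
  have "Max ?S = card J"
  proof (rule Max_eqI)
    show "finite ?S" using finite_sub[OF XE] by (auto intro!: finite_image_set finite_subset[of _ "Pow X"])
    show "card J \<in> ?S" using J F dm_min_bases[OF A] by blast
    fix c assume "c \<in> ?S"
    then obtain I where I: "c = card I" "I \<subseteq> X" "indep I"
      using dm_min_bases[OF A] indep_subset by blast
    then show "c \<le> card J" using k_antimono[OF I(2) XE] J by (simp add: indep_def)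
  qed
  then show ?thesis using J by (simp add: matroid_rank_def indep_def)
qed

text \<open>This bounds the size of feasible sets from above; \<open>max_feasible\<close> shows that the bound is attained.\<close>

lemma f_lipschitz:
  assumes "B \<subseteq> A" "A \<subseteq> E" shows "f A \<le> f B + card (A - B)"
  using assms
proof (induction rule: grow_induct)
  case (step C e)
  then have C: "C \<subseteq> E" "e \<in> E - C" "insert e C - B = insert e (C - B)" using assms(2) by auto
  then show ?case using f_step[OF C(1,2)] step finite_sub[OF C(1)] by auto
qed simp

text \<open>As long as f(A) > k(A), an edge can be removed so that f drops. It is not a bridge, since removing
a bridge raises f, so k stays the same. After f(A) - k(A) steps a quasi-tree remains.\<close>

lemma max_feasible:
  assumes "A \<subseteq> E"
  shows "\<exists>B\<subseteq>A. f B = k A \<and> card B + f A = card A + k A"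
  using assms
proof (induction "f A" arbitrary: A)
  case 0
  then show ?case using k_le_f[of A] by force
next
  case (Suc n)
  show ?case
  proof (cases "f A = k A")
    case False
    then have "k A < f A" using k_le_f[OF Suc(3)] by simp
    then obtain e where e: "e \<in> A" "Suc (f (A - {e})) = f A" using merge[OF Suc(3)] by blast
    have A: "A - {e} \<subseteq> E" "insert e (A - {e}) = A" "e \<in> E - (A - {e})" using e Suc by auto
    have "k A = k (A - {e})"
      using k_step[OF A(1,3)] bridge[OF A(1,3)] e(2) A(2) by auto
    moreover have n: "n = f (A - {e})" using e(2) Suc(2) by simp
    obtain B where B: "B \<subseteq> A - {e}" "f B = k (A - {e})"
      "card B + f (A - {e}) = card (A - {e}) + k (A - {e})"
      using Suc(1)[OF n A(1)] by blast
    moreover have "card A = Suc (card (A - {e}))"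
      using card_Suc_Diff1[OF finite_sub[OF Suc(3)] e(1)] by simp
    ultimately have "B \<subseteq> A \<and> f B = k A \<and> card B + f A = card A + k A" using e(2) B by auto
    then show ?thesis by blast
  qed auto
qed

lemma max_bases_card:
  assumes A: "A \<subseteq> E" 
  shows "max_bases (dm A) \<noteq> {}" "F \<in> max_bases (dm A) \<Longrightarrow> card F + f A = card A + k A"
proof -
  obtain B where B: "B \<subseteq> A" "f B = k A" "card B + f A = card A + k A"
    using max_feasible[OF A] by blast
  have le: "card F + f A \<le> card A + k A" if "F \<subseteq> A" "f F = k A" for F
  proof -
    have "card (A - F) + card F = card A"
      using that(1) finite_sub[OF A] by (metis card_Diff_subset card_mono finite_subset le_add_diff_inverse2)
    then show ?thesis using f_lipschitz[OF that(1) A] that(2) by simp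
  qed
  have "card F \<le> card B" if "F \<subseteq> A" "f F = k A" for F using le[OF that] B by linarith
  then have "B \<in> max_bases (dm A)" using B by (simp add: max_bases_def dm_def)
  then show "max_bases (dm A) \<noteq> {}" by blast
  assume "F \<in> max_bases (dm A)"
  then have "F \<subseteq> A" "f F = k A" "card B \<le> card F" using B by (auto simp: max_bases_def dm_def)
  then show "card F + f A = card A + k A" using le[of F] B(3) by linarith
qed

text \<open>The right-hand side is the Euler genus of (V,A), because k({}) is the number of vertices.\<close>

lemma width_dm:
  assumes A: "A \<subseteq> E"
  shows "width (dm A) = 2 * int (k A) - int (k {}) + int (card A) - int (f A)"
proof -
  let ?S = "{card I |I. I \<subseteq> A \<and> (\<exists>B\<in>max_bases (dm A). I \<subseteq> B)}"
  obtain F where F: "F \<in> max_bases (dm A)" using max_bases_card(1)[OF A] by blast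
  have sub: "B \<subseteq> A" if "B \<in> max_bases (dm A)" for B using that by (simp add: max_bases_def dm_def)
  have "Max ?S = card F"
  proof (rule Max_eqI)
    show "finite ?S" using finite_sub[OF A] by (auto intro!: finite_image_set finite_subset[of _ "Pow A"])
    show "card F \<in> ?S" using F sub by blast
    fix c assume "c \<in> ?S"
    then obtain I B where I: "c = card I" "I \<subseteq> B" "B \<in> max_bases (dm A)" by blast
    have "card B + f A = card A + k A" "card F + f A = card A + k A"
      using max_bases_card(2)[OF A] I(3) F by blast+
    moreover have "card I \<le> card B"
      using I sub finite_sub[OF A] by (meson card_mono finite_subset)
    ultimately show "c \<le> card F" using I by simp
  qed
  then have "matroid_rank (max_bases (dm A)) A = card F" by (simp add: matroid_rank_def)
  moreover have "card F + f A = card A + k A" using max_bases_card(2)[OF A F] .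
  moreover have "fst (dm A) = A" by (simp add: dm_def)
  ultimately show ?thesis using matroid_rank_min[OF A order_refl] by (simp add: width_def)
qed

text \<open>The two cases in the definition of deletion are the two kinds of edges: an edge is contained in all
feasible sets exactly if it is a bridge.\<close>

lemma dm_delete_dm:
  assumes A: "A \<subseteq> E" and e: "e \<in> A"
  shows "dm_delete e (dm A) = dm (A - {e})"
proof -
  have A': "A - {e} \<subseteq> E" "insert e (A - {e}) = A" "e \<in> E - (A - {e})" using A e by auto
  consider "k A = k (A - {e})" | "Suc (k A) = k (A - {e})" using k_step[OF A'(1,3)] A'(2) by auto
  then show ?thesis
  proof cases
    case 1
    obtain T where T: "indep T" "T \<subseteq> A - {e}" "k T = k (A - {e})"
      using indep_extend[OF indep_empty _ A'(1)] by auto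
    then have "T \<subseteq> A" "f T = k A" "e \<notin> T" using f_indep 1 by auto
    then have "\<not> (\<forall>F\<in>snd (dm A). e \<in> F)" by (auto simp: dm_def)
    then show ?thesis using 1 by (auto simp: dm_delete_def dm_def)
  next
    case 2
    \<comment> \<open>a bridge of A lies in every feasible set, and it is a bridge of every subset of A containing it\<close>
    have br: "Suc (f (insert e B)) = f B" if "B \<subseteq> A - {e}" for B
    proof -
      have B: "B \<subseteq> E" "e \<in> E - B" using that A' by auto
      have "k (insert e B) \<noteq> k B"
        using k_mono[OF that A'(1,3)] 2 A'(2) by auto
      then show ?thesis using k_step[OF B] bridge[OF B] by blast
    qed
    have all: "e \<in> F" if "F \<subseteq> A" "f F = k A" for F
    proof (rule ccontr)
      assume "e \<notin> F"
      then have F: "F \<subseteq> A - {e}" using that by blast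
      then have "k (A - {e}) \<le> f F"
        using k_antimono[OF F A'(1)] k_le_f[of F] A'(1) by (meson order_trans)
      then show False using 2 that by simp
    qed
    have "{F - {e} |F. F \<subseteq> A \<and> f F = k A} = {B. B \<subseteq> A - {e} \<and> f B = k (A - {e})}"
    proof (intro set_eqI iffI)
      fix B assume "B \<in> {F - {e} |F. F \<subseteq> A \<and> f F = k A}"
      then obtain F where F: "F \<subseteq> A" "f F = k A" "B = F - {e}" by blast
      then have "insert e B = F" "B \<subseteq> A - {e}" using all by auto
      then show "B \<in> {B. B \<subseteq> A - {e} \<and> f B = k (A - {e})}" using br[of B] F 2 by simp
    next
      fix B assume "B \<in> {B. B \<subseteq> A - {e} \<and> f B = k (A - {e})}"
      then have B: "B \<subseteq> A - {e}" "f B = k (A - {e})" by auto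
      then have "insert e B \<subseteq> A" "f (insert e B) = k A" "B = insert e B - {e}"
        using br[of B] 2 e by auto
      then show "B \<in> {F - {e} |F. F \<subseteq> A \<and> f F = k A}" by blast
    qed
    moreover have "\<forall>F\<in>snd (dm A). e \<in> F" using all by (simp add: dm_def)
    ultimately show ?thesis by (simp add: dm_delete_def dm_def)
  qed
qed

lemma dm_restrict_dm:
  assumes A: "A \<subseteq> E"
  shows "dm_restrict (dm E) A = dm A"
proof -
  have fold: "fold dm_delete xs (dm X) = dm (X - set xs)"
    if "distinct xs" "set xs \<subseteq> X" "X \<subseteq> E" for xs X
    using that
  proof (induction xs arbitrary: X)
    case (Cons x xs)
    have "fold dm_delete (x # xs) (dm X) = fold dm_delete xs (dm (X - {x}))"
      using Cons.prems by (simp add: dm_delete_dm)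
    also have "\<dots> = dm (X - {x} - set xs)" using Cons by (intro Cons.IH) auto
    also have "X - {x} - set xs = X - set (x # xs)" by auto
    finally show ?case .
  qed simp
  let ?P = "\<lambda>xs. distinct xs \<and> set xs = E - A"
  have "\<exists>xs. ?P xs" using finite_distinct_list[of "E - A"] finite_E by auto
  then have xs: "?P (SOME xs. ?P xs)" by (rule someI_ex)
  have "fst (dm E) = E" by (simp add: dm_def)
  then show ?thesis
    unfolding dm_restrict_def dm_delete_set_def
    using fold[OF conjunct1[OF xs], of E] xs A by (simp add: double_diff)
qed

lemma width_on_dm:
  assumes "A \<subseteq> E"
  shows "width_on (dm E) A = 2 * int (k A) - int (k {}) + int (card A) - int (f A)"
  using assms by (simp add: width_on_def dm_restrict_dm width_dm)

end

section \<open>Closed embeddings\<close>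

text \<open>Embeddings with closed image. All arcs, circles and discs are given by such maps; then pieces can be
glued along closed sets in any topological space, in particular in the capped surface.\<close>

definition closed_embedding :: "'a topology \<Rightarrow> 'b topology \<Rightarrow> ('a \<Rightarrow> 'b) \<Rightarrow> bool" where
  "closed_embedding X Y g \<longleftrightarrow> continuous_map X Y g \<and> closed_map X Y g \<and> inj_on g (topspace X)"

abbreviation arc_map :: "'a topology \<Rightarrow> (real \<Rightarrow> 'a) \<Rightarrow> bool" where
  "arc_map \<equiv> closed_embedding (top_of_set {0..1})"

abbreviation circle_map :: "'a topology \<Rightarrow> (complex \<Rightarrow> 'a) \<Rightarrow> bool" where
  "circle_map \<equiv> closed_embedding (top_of_set (sphere 0 1))"

abbreviation disc_map :: "'a topology \<Rightarrow> (complex \<Rightarrow> 'a) \<Rightarrow> bool" where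
  "disc_map \<equiv> closed_embedding (top_of_set (cball 0 1))"

lemma closed_embedding_closedin:
  "closed_embedding X Y g \<Longrightarrow> closedin X K \<Longrightarrow> closedin Y (g ` K)"
  by (simp add: closed_embedding_def closed_map_def)

lemma closed_embedding_compose:
  assumes "closed_embedding X Y g" "closed_embedding W X h"
  shows "closed_embedding W Y (g \<circ> h)"
proof -
  have "h ` topspace W \<subseteq> topspace X"
    using assms(2) by (simp add: closed_embedding_def continuous_map_image_subset_topspace)
  then show ?thesis
    using assms unfolding closed_embedding_def
    by (meson closed_map_compose comp_inj_on continuous_map_compose inj_on_subset)
qed

lemma closed_embedding_compact:
  fixes h :: "'a::metric_space \<Rightarrow> 'b::metric_space"
  assumes "compact T" "continuous_on T h" "inj_on h T" "h ` T \<subseteq> S"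
  shows "closed_embedding (top_of_set T) (top_of_set S) h"
proof -
  have "closedin (top_of_set S) (h ` K)" if "closedin (top_of_set T) K" for K
  proof -
    have K: "K \<subseteq> T" "compact K"
      using that assms(1) closedin_compact closedin_imp_subset by blast+
    then have "compact (h ` K)"
      using assms(2) compact_continuous_image continuous_on_subset by blast
    then show ?thesis
      using K assms(4) by (intro closed_subset compact_imp_closed) auto
  qed
  then show ?thesis
    using assms by (auto simp: closed_embedding_def closed_map_def continuous_map_in_subtopology)
qed

lemma closed_embedding_precompose:
  fixes h :: "'a::metric_space \<Rightarrow> 'b::metric_space"
  assumes "closed_embedding (top_of_set S) Y g"
    and "compact T" "continuous_on T h" "inj_on h T" "h ` T \<subseteq> S"
  shows "closed_embedding (top_of_set T) Y (g \<circ> h)"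
  by (rule closed_embedding_compose[OF assms(1) closed_embedding_compact[OF assms(2-5)]])

lemma closed_embedding_homeomorphic_map:
  assumes "closed_embedding X Y g"
  shows "homeomorphic_map X (subtopology Y (g ` topspace X)) g"
  using assms injective_closed_imp_embedding_map
  unfolding closed_embedding_def embedding_map_def by blast

lemma closed_embedding_preimage:
  assumes "closed_embedding (top_of_set S) Y g" "closedin Y K"
  shows "closedin (top_of_set S) {x \<in> S. g x \<in> K}"
  using assms by (auto simp: closed_embedding_def continuous_map_closedin)

text \<open>Continuity and closedness of the glued map are checked on the two closed pieces separately.\<close>

lemma closed_embedding_glue:
  fixes S T :: "'a::topological_space set"
  assumes g: "closed_embedding (top_of_set S) Y g" and h: "closed_embedding (top_of_set T) Y h"
    and "closed S" "closed T"
    and agree: "\<forall>x\<in>S \<inter> T. g x = h x"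
    and meet: "\<forall>x\<in>S. \<forall>y\<in>T. g x = h y \<longrightarrow> x = y"
  defines "u \<equiv> \<lambda>x. if x \<in> S then g x else h x"
  shows "closed_embedding (top_of_set (S \<union> T)) Y u"
    and "u ` (S \<union> T) = g ` S \<union> h ` T"
proof -
  have uS: "u x = g x" if "x \<in> S" for x using that by (simp add: u_def)
  have uT: "u x = h x" if "x \<in> T" for x using that agree by (simp add: u_def)
  have up: "closedin (top_of_set (S \<union> T)) K" if "closedin (top_of_set S) K \<or> closedin (top_of_set T) K" for K
    using that assms(3,4) by (metis closed_subset closedin_closed_trans closedin_imp_subset le_supI1 le_supI2)
  have "closedin (top_of_set (S \<union> T)) {x \<in> S \<union> T. u x \<in> K}" if K: "closedin Y K" for K
  proof -
    have "{x \<in> S \<union> T. u x \<in> K} = {x \<in> S. g x \<in> K} \<union> {x \<in> T. h x \<in> K}"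
      using uS uT by auto
    moreover have "closedin (top_of_set (S \<union> T)) \<dots>"
      using closed_embedding_preimage[OF g K] closed_embedding_preimage[OF h K] up
      by (intro closedin_Un) blast+
    ultimately show ?thesis by simp
  qed
  moreover have "u \<in> S \<union> T \<rightarrow> topspace Y"
    using g h uS uT by (auto simp: closed_embedding_def continuous_map_def Pi_def)
  moreover have "closedin Y (u ` K)" if K: "closedin (top_of_set (S \<union> T)) K" for K
  proof -
    have "K \<subseteq> S \<union> T" using K closedin_imp_subset by blast
    then have "u ` K = g ` (K \<inter> S) \<union> h ` (K \<inter> T)"
      using uS uT by (auto simp: image_iff) (metis IntI UnE subsetD)+
    moreover have "closedin (top_of_set S) (K \<inter> S)" "closedin (top_of_set T) (K \<inter> T)"
      using K by (auto simp: closedin_closed)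
    ultimately show ?thesis
      using closed_embedding_closedin[OF g] closed_embedding_closedin[OF h] by (simp add: closedin_Un)
  qed
  moreover have "inj_on u (S \<union> T)"
  proof (rule inj_onI)
    fix x y assume xy: "x \<in> S \<union> T" "y \<in> S \<union> T" "u x = u y"
    have gi: "inj_on g S" "inj_on h T" using g h by (auto simp: closed_embedding_def)
    show "x = y"
      using xy(1,2)
    proof (elim UnE)
      assume "x \<in> S" "y \<in> S"
      then show ?thesis using xy(3) uS gi(1) by (simp add: inj_on_def)
    next
      assume "x \<in> T" "y \<in> T"
      then show ?thesis using xy(3) uT gi(2) by (simp add: inj_on_def)
    next
      assume "x \<in> S" "y \<in> T"
      then show ?thesis using xy(3) uS uT meet by simp
    next
      assume "x \<in> T" "y \<in> S"
      then show ?thesis using xy(3) uS uT meet by force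
    qed
  qed
  ultimately show "closed_embedding (top_of_set (S \<union> T)) Y u"
    unfolding closed_embedding_def continuous_map_closedin closed_map_def topspace_euclidean_subtopology
    by blast
  have "u ` S = g ` S" "u ` T = h ` T" using uS uT by (auto intro: image_cong)
  then show "u ` (S \<union> T) = g ` S \<union> h ` T" by (simp add: image_Un)
qed

section \<open>Arcs and circles\<close>

definition arc_in :: "'a topology \<Rightarrow> 'a set \<Rightarrow> 'a \<Rightarrow> 'a \<Rightarrow> bool" where
  "arc_in Z a p q \<longleftrightarrow>
     (\<exists>g. arc_map Z g \<and> a = g ` {0..1} \<and> g 0 = p \<and> g 1 = q)"

definition circle_in :: "'a topology \<Rightarrow> 'a set \<Rightarrow> bool" where
  "circle_in Z c \<longleftrightarrow>
     (\<exists>g. circle_map Z g \<and> c = g ` sphere 0 1)"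

lemma arc_inI:
  "arc_map Z g \<Longrightarrow> g ` {0..1} = a \<Longrightarrow> g 0 = p \<Longrightarrow> g 1 = q \<Longrightarrow> arc_in Z a p q"
  unfolding arc_in_def by blast

lemma arc_inE:
  assumes "arc_in Z a p q"
  obtains g where "arc_map Z g" "a = g ` {0..1}" "g 0 = p" "g 1 = q"
  using assms unfolding arc_in_def by blast

lemma arc_in_subpath:
  assumes g: "arc_map Z g" and uv: "u \<in> {0..1}" "v \<in> {0..1}" "u < v"
  shows "arc_in Z (g ` {u..v}) (g u) (g v)"
proof -
  let ?h = "\<lambda>t. u + (v - u) * t"
  have im: "?h ` {0..1} = {u..v}"
  proof
    have "0 \<le> (v - u) * t" "(v - u) * t \<le> v - u" if "0 \<le> t" "t \<le> 1" for t
      using that uv by (auto intro: mult_left_le)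
    then show "?h ` {0..1} \<subseteq> {u..v}" by force
    show "{u..v} \<subseteq> ?h ` {0..1}"
    proof
      fix x assume x: "x \<in> {u..v}"
      then have "?h ((x - u) / (v - u)) = x" using uv by simp
      moreover have "(x - u) / (v - u) \<in> {0..1}" using x uv by (auto simp: divide_simps)
      ultimately show "x \<in> ?h ` {0..1}" by (metis image_eqI)
    qed
  qed
  have "arc_map Z (g \<circ> ?h)"
  proof (rule closed_embedding_precompose[OF g])
    show "inj_on ?h {0..1}" using uv by (auto simp: inj_on_def)
    show "?h ` {0..1} \<subseteq> {0..1}" using im uv by auto
  qed (auto intro!: continuous_intros)
  moreover have "(g \<circ> ?h) ` {0..1} = g ` {u..v}" using im by (metis image_comp)
  ultimately show ?thesis by (rule arc_inI) simp_all
qed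

lemma arc_in_reverse: "arc_in Z a p q \<Longrightarrow> arc_in Z a q p"
proof -
  assume "arc_in Z a p q"
  then obtain g where g: "arc_map Z g" "a = g ` {0..1}" "g 0 = p" "g 1 = q"
    unfolding arc_in_def by blast
  let ?h = "\<lambda>t::real. 1 - t"
  have im: "?h ` {0..1} = {0..1}" by simp
  have "arc_map Z (g \<circ> ?h)"
    by (rule closed_embedding_precompose[OF g(1)]) (auto intro!: continuous_intros simp: inj_on_def)
  moreover have "(g \<circ> ?h) ` {0..1} = a" using g(2) im by (metis image_comp)
  ultimately show ?thesis by (rule arc_inI) (simp_all add: g)
qed

lemma arc_in_closedin: "arc_in Z a p q \<Longrightarrow> closedin Z a"
  unfolding arc_in_def using closed_embedding_closedin closedin_topspace by fastforce

lemma arc_in_ends: "arc_in Z a p q \<Longrightarrow> p \<in> a \<and> q \<in> a \<and> p \<noteq> q"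
  unfolding arc_in_def closed_embedding_def inj_on_def by force

lemma connectedin_image_closed_embedding:
  assumes "closed_embedding (top_of_set S) Z g" "connected T" "T \<subseteq> S"
  shows "connectedin Z (g ` T)"
  using assms by (metis closed_embedding_def connectedin_continuous_map_image connectedin_iff_connected
      connectedin_subtopology)

lemma arc_in_connected: "arc_in Z a p q \<Longrightarrow> connectedin Z a"
  unfolding arc_in_def using connectedin_image_closed_embedding[of "{0..1::real}"] by fastforce

lemma arc_in_inner_connected: 
  assumes "arc_in Z a p q" shows "connectedin Z (a - {p,q})"
proof -
  obtain g where g: "arc_map Z g" "a = g ` {0..1}" "g 0 = p" "g 1 = q"
    using assms unfolding arc_in_def by blast
  have "inj_on g {0..1}" using g by (simp add: closed_embedding_def)
  have "{0<..<1::real} = {0..1} - {0,1}" by auto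
  then have "g ` {0<..<1} = a - {p,q}"
    using g(2-4) \<open>inj_on g {0..1}\<close> by (simp add: inj_on_image_set_diff[where C="{0..1}"])
  then show ?thesis using connectedin_image_closed_embedding[OF g(1), of "{0<..<1}"] by force
qed

text \<open>The end points of an arc are limits of its inner points.\<close>

lemma arc_in_subset_closed:
  assumes "arc_in Z a p q" "closedin Z K" "a - {p,q} \<subseteq> K"
  shows "a \<subseteq> K"
proof -
  obtain g where g: "arc_map Z g" "a = g ` {0..1}" "g 0 = p" "g 1 = q"
    using assms unfolding arc_in_def by blast
  have inj: "inj_on g {0..1}" using g by (simp add: closed_embedding_def)
  have "closed {x \<in> {0..1}. g x \<in> K}"
    using closed_embedding_preimage[OF g(1) assms(2)] by (meson closed_atLeastAtMost closedin_closed_trans)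
  moreover have "{0<..<1} \<subseteq> {x \<in> {0..1}. g x \<in> K}"
  proof
    fix x :: real assume x: "x \<in> {0<..<1}"
    then have "g x \<noteq> g 0" "g x \<noteq> g 1"
      using inj_onD[OF inj, of x 0] inj_onD[OF inj, of x 1] by auto
    then show "x \<in> {x \<in> {0..1}. g x \<in> K}" using x g assms(3) by auto
  qed
  ultimately have "closure {0<..<1} \<subseteq> {x \<in> {0..1}. g x \<in> K}" by (rule closure_minimal[rotated])
  then show ?thesis using g by auto
qed

lemma arc_in_join:
  assumes "arc_in Z a p q" "arc_in Z b q r" "a \<inter> b = {q}"
  shows "arc_in Z (a \<union> b) p r"
proof -
  obtain g where g: "arc_map Z g" "a = g ` {0..1}" "g 0 = p" "g 1 = q"
    using assms unfolding arc_in_def by blast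
  obtain h where h: "arc_map Z h" "b = h ` {0..1}" "h 0 = q" "h 1 = r"
    using assms unfolding arc_in_def by blast
  let ?g = "g \<circ> (\<lambda>t. 2 * t)" and ?h = "h \<circ> (\<lambda>t. 2 * t - 1)"
  have im1: "(\<lambda>t::real. 2 * t) ` {0..1/2} = {0..1}" by (simp add: image_mult_atLeastAtMost)
  have im2: "(\<lambda>t::real. 2 * t - 1) ` {1/2..1} = {0..1}"
    by (simp add: image_affinity_atLeastAtMost_diff)
  have g': "closed_embedding (top_of_set {0..1/2}) Z ?g"
    by (rule closed_embedding_precompose[OF g(1)]) (auto intro!: continuous_intros simp: inj_on_def)
  have h': "closed_embedding (top_of_set {1/2..1}) Z ?h"
    by (rule closed_embedding_precompose[OF h(1)]) (auto intro!: continuous_intros simp: inj_on_def)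
  have meet: "x = y" if "x \<in> {0..1/2}" "y \<in> {1/2..1}" "?g x = ?h y" for x y
  proof -
    have "2 * x \<in> {0..1}" "2 * y - 1 \<in> {0..1}" using that by auto
    moreover have eq: "g (2*x) = h (2*y-1)" using that(3) by simp
    ultimately have "g (2*x) \<in> a \<inter> b" unfolding g(2) h(2) by (metis IntI imageI)
    then have "g (2*x) = g 1" "h (2*y-1) = h 0" using assms(3) g(4) h(3) eq by auto
    moreover have "inj_on g {0..1}" "inj_on h {0..1}"
      using g(1) h(1) by (auto simp: closed_embedding_def)
    ultimately have "2 * x = 1" "2*y-1 = 0"
      using \<open>2 * x \<in> {0..1}\<close> \<open>2 * y - 1 \<in> {0..1}\<close>
      by (auto dest: inj_onD[of g "{0..1}" "2*x" 1] inj_onD[of h "{0..1}" "2*y-1" 0])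
    then show ?thesis by simp
  qed
  have agree: "?g x = ?h x" if "x \<in> {0..1/2} \<inter> {1/2..1}" for x
  proof - 
    have x: "x = 1/2" using that by auto
    show ?thesis unfolding x using g(4) h(3) by simp
  qed
  have agree': "\<forall>x\<in>{0..1/2} \<inter> {1/2..1}. ?g x = ?h x" using agree by blast
  have meet': "\<forall>x\<in>{0..1/2}. \<forall>y\<in>{1/2..1}. ?g x = ?h y \<longrightarrow> x = y" using meet by blast
  have "{0..1/2} \<union> {1/2..1} = {0..1::real}" by auto
  moreover have "?g ` {0..1/2} = a" "?h ` {1/2..1} = b" using im1 im2 g h by (metis image_comp)+
  ultimately show ?thesis
    using closed_embedding_glue[OF g' h' _ _ agree' meet'] 
    by (intro arc_inI[of _ "\<lambda>x. if x \<in> {0..1/2} then ?g x else ?h x"]) (simp_all add: g(3,4) h(3,4))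
qed

text \<open>A closed semicircle is parametrised by its real part, so no angles are needed. The sign selects the
upper or the lower half.\<close>

lemma semicircle_arc:
  fixes sg :: real
  assumes g: "arc_map Z g" and sg: "sg = 1 \<or> sg = -1"
  defines "U \<equiv> {z \<in> sphere 0 1. 0 \<le> sg * Im z}" and "x \<equiv> \<lambda>z. (1 - Re z) / 2"
  shows "closed U" "closed_embedding (top_of_set U) Z (g \<circ> x)" "(g \<circ> x) ` U = g ` {0..1}"
proof -
  have "U = sphere 0 1 \<inter> {z. 0 \<le> sg * Im z}" by (auto simp: U_def)
  moreover have "closed {z. 0 \<le> sg * Im z}" by (intro closed_Collect_le continuous_intros)
  ultimately show cl: "closed U" by (simp add: closed_Int)
  have "U \<subseteq> cball 0 1" by (auto simp: U_def)
  then have cpt: "compact U" using cl by (meson bounded_cball bounded_subset compact_eq_bounded_closed)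
  have "inj_on x U"
  proof (rule inj_onI)
    fix z w assume zw: "z \<in> U" "w \<in> U" "x z = x w"
    have "(Re z)\<^sup>2 + (Im z)\<^sup>2 = 1" "(Re w)\<^sup>2 + (Im w)\<^sup>2 = 1" using zw(1,2) by (auto simp: U_def cmod_def)
    moreover have re: "Re z = Re w" using zw(3) by (simp add: x_def)
    ultimately have "(sg * Im z)\<^sup>2 = (sg * Im w)\<^sup>2" by (simp add: power_mult_distrib)
    then have "sg * Im z = sg * Im w"
      using zw(1,2) by (subst (asm) power2_eq_iff_nonneg) (auto simp: U_def)
    then show "z = w" using re sg by (auto simp: complex_eq_iff)
  qed
  moreover have im: "x ` U = {0..1}"
  proof
    have "x z \<in> {0..1}" if "z \<in> U" for z using that abs_Re_le_cmod[of z] by (auto simp: U_def x_def)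
    then show "x ` U \<subseteq> {0..1}" by blast
    show "{0..1} \<subseteq> x ` U"
    proof
      fix t :: real assume "t \<in> {0..1}"
      then have r: "(1 - 2 * t)\<^sup>2 \<le> 1" by (auto simp: abs_square_le_1 abs_le_iff)
      have "x (Complex (1 - 2 * t) (sg * sqrt (1 - (1 - 2 * t)\<^sup>2))) = t" by (simp add: x_def)
      moreover have "Complex (1 - 2 * t) (sg * sqrt (1 - (1 - 2 * t)\<^sup>2)) \<in> U"
        using r sg by (auto simp: U_def cmod_def)
      ultimately show "t \<in> x ` U" by (metis imageI)
    qed
  qed
  moreover have "continuous_on U x" unfolding x_def by (intro continuous_intros) auto
  ultimately show "closed_embedding (top_of_set U) Z (g \<circ> x)"
    using cpt by (intro closed_embedding_precompose[OF g]) auto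
  show "(g \<circ> x) ` U = g ` {0..1}" using im by (metis image_comp)
qed

lemma circle_in_join:
  assumes "arc_in Z a p q" "arc_in Z b p q" "a \<inter> b = {p,q}"
  shows "circle_in Z (a \<union> b)"
proof -
  obtain g where g: "arc_map Z g" "a = g ` {0..1}" "g 0 = p" "g 1 = q"
    using arc_inE[OF assms(1)] .
  obtain h where h: "arc_map Z h" "b = h ` {0..1}" "h 0 = p" "h 1 = q"
    using arc_inE[OF assms(2)] .
  let ?x = "\<lambda>z. (1 - Re z) / 2"
  define U where "U = {z \<in> sphere 0 1. 0 \<le> 1 * Im z}"
  define L where "L = {z \<in> sphere 0 1. 0 \<le> -1 * Im z}"
  have Up: "closed U" "closed_embedding (top_of_set U) Z (g \<circ> ?x)" "(g \<circ> ?x) ` U = g ` {0..1}"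
    unfolding U_def by (intro semicircle_arc[OF g(1)]; simp)+
  have Lo: "closed L" "closed_embedding (top_of_set L) Z (h \<circ> ?x)" "(h \<circ> ?x) ` L = h ` {0..1}"
    unfolding L_def by (intro semicircle_arc[OF h(1)]; simp)+
  have re: "?x z \<in> {0..1}" if "z \<in> U \<union> L" for z
    using that abs_Re_le_cmod[of z] by (auto simp: U_def L_def)
  have nrm: "(Re z)\<^sup>2 + (Im z)\<^sup>2 = 1" if "z \<in> U \<union> L" for z
    using that by (auto simp: U_def L_def cmod_def)
  have ends: "z = 1" if "z \<in> U \<union> L" "?x z = 0" for z
    using that nrm[OF that(1)] by (auto simp: complex_eq_iff)
  have ends': "z = -1" if "z \<in> U \<union> L" "?x z = 1" for z
  proof -
    have "Re z = -1" using that by (simp add: field_simps)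
    then show ?thesis using nrm[OF that(1)] by (auto simp: complex_eq_iff)
  qed
  have gi: "inj_on g {0..1}" "inj_on h {0..1}" using g h by (auto simp: closed_embedding_def)
  have meet: "z = w" if "z \<in> U" "w \<in> L" "(g \<circ> ?x) z = (h \<circ> ?x) w" for z w
  proof -
    have zw: "?x z \<in> {0..1}" "?x w \<in> {0..1}" using re that by blast+
    moreover have eq: "g (?x z) = h (?x w)" using that(3) by simp
    ultimately have "g (?x z) \<in> a \<inter> b" unfolding g(2) h(2) by (metis IntI imageI)
    then consider "g (?x z) = p" | "g (?x z) = q" using assms(3) by auto
    then show ?thesis
    proof cases
      case 1
      then have "g (?x z) = g 0" "h (?x w) = h 0" using eq g(3) h(3) by simp_all
      then have "?x z = 0" "?x w = 0"
        using inj_onD[OF gi(1) _ zw(1)] inj_onD[OF gi(2) _ zw(2)] by fastforce+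
      then show ?thesis using ends that by (metis UnI1 UnI2)
    next
      case 2
      then have "g (?x z) = g 1" "h (?x w) = h 1" using eq g(4) h(4) by simp_all
      then have "?x z = 1" "?x w = 1"
        using inj_onD[OF gi(1) _ zw(1)] inj_onD[OF gi(2) _ zw(2)] by fastforce+
      then show ?thesis using ends' that by (metis UnI1 UnI2)
    qed
  qed
  have agree: "(g \<circ> ?x) z = (h \<circ> ?x) z" if "z \<in> U \<inter> L" for z
  proof -
    have "Im z = 0" using that by (auto simp: U_def L_def)
    then have "(Re z)\<^sup>2 = 1" using nrm that by force
    then have "Re z = 1 \<or> Re z = -1" by (simp add: power2_eq_1_iff)
    then show ?thesis using g h by auto
  qed
  have UL: "U \<union> L = sphere 0 1" by (auto simp: U_def L_def)
  have "(g \<circ> ?x) ` U = a" "(h \<circ> ?x) ` L = b" using Up(3) Lo(3) g(2) h(2) by simp_all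
  moreover have agree': "\<forall>z\<in>U \<inter> L. (g \<circ> ?x) z = (h \<circ> ?x) z" using agree by blast
  have meet': "\<forall>z\<in>U. \<forall>w\<in>L. (g \<circ> ?x) z = (h \<circ> ?x) w \<longrightarrow> z = w" using meet by blast
  note closed_embedding_glue[OF Up(2) Lo(2) Up(1) Lo(1) agree' meet', unfolded UL]
  ultimately show ?thesis unfolding circle_in_def by metis
qed

lemma circle_in_closedin: "circle_in Z c \<Longrightarrow> closedin Z c"
  unfolding circle_in_def using closed_embedding_closedin closedin_topspace by fastforce

lemma circle_in_connected: "circle_in Z c \<Longrightarrow> connectedin Z c"
proof -
  assume "circle_in Z c"
  then obtain g where "circle_map Z g" "c = g ` sphere 0 1"
    unfolding circle_in_def by blast
  moreover have "connected (sphere (0::complex) 1)" by (simp add: connected_sphere)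
  ultimately show ?thesis using connectedin_image_closed_embedding by blast
qed

lemma circle_in_nonempty: "circle_in Z c \<Longrightarrow> c \<noteq> {}"
  unfolding circle_in_def by force

lemma closed_embedding_connected_preimage:
  assumes g: "closed_embedding (top_of_set S) Z g" and s: "connectedin Z s" "s \<subseteq> g ` S"
  shows "connected {x \<in> S. g x \<in> s}" (is "connected ?T")
proof -
  have hm: "homeomorphic_map (top_of_set S) (subtopology Z (g ` S)) g"
    using closed_embedding_homeomorphic_map[OF g] by simp
  have "g ` ?T = s" using s(2) by auto
  then have "connectedin (subtopology Z (g ` S)) (g ` ?T)"
    using s by (simp add: connectedin_subtopology)
  moreover have "?T \<subseteq> topspace (top_of_set S)" by auto
  ultimately have "connectedin (top_of_set S) ?T"
    using homeomorphic_map_connectedness[OF hm] by blast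
  then show ?thesis by (simp add: connectedin_subtopology)
qed

text \<open>An arc is irreducibly connected between its end points: in the parameter interval the preimage of s
is connected and contains 0 and 1.\<close>

lemma arc_in_full:
  assumes "arc_in Z a p q" "connectedin Z s" "s \<subseteq> a" "p \<in> s" "q \<in> s"
  shows "s = a"
proof -
  obtain g where g: "arc_map Z g" "a = g ` {0..1}" "g 0 = p" "g 1 = q"
    using arc_inE[OF assms(1)] .
  let ?T = "{x \<in> {0..1}. g x \<in> s}"
  have "connected ?T"
    using closed_embedding_connected_preimage[OF g(1) assms(2)] assms(3) g(2) by simp
  moreover have "0 \<in> ?T" "1 \<in> ?T" using assms(4,5) g by auto
  ultimately have "{0..1} \<subseteq> ?T" using connected_contains_Icc by blast
  then show ?thesis using g(2) assms(3) by auto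
qed

lemma unit_circle_two_arcs:
  fixes a b :: complex
  assumes "a \<in> sphere 0 1" "b \<in> sphere 0 1" "a \<noteq> b"
  obtains u d where "arc u" "arc d" "pathstart u = a" "pathfinish u = b"
    "pathstart d = b" "pathfinish d = a"
    "path_image u \<inter> path_image d = {a,b}" "path_image u \<union> path_image d = sphere 0 1"
proof -
  define g where "g = (\<lambda>t::real. cis (2 * pi * t))"
  have "continuous_on UNIV g"
    unfolding g_def cis_conv_exp by (intro continuous_intros)
  then have "path g" unfolding path_def by (rule continuous_on_subset) simp
  moreover have "loop_free g"
    unfolding loop_free_def
  proof (intro ballI impI)
    fix x y :: real assume x: "x \<in> {0..1}" and y: "y \<in> {0..1}" and eq: "g x = g y"
    have "cis (2*pi*x - 2*pi*y) = cis (2*pi*x) / cis (2*pi*y)" by (simp add: cis_divide)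
    also have "\<dots> = 1" using eq by (simp add: g_def)
    finally have "cos (2*pi*x - 2*pi*y) = 1" by (metis cis.sel(1) one_complex.sel(1))
    then obtain n :: int where "2*pi*x - 2*pi*y = of_int n * 2 * pi"
      using cos_one_2pi_int by blast
    then have "2 * pi * (x - y - of_int n) = 0" by (simp add: algebra_simps)
    then have n: "x - y = of_int n" by simp
    then have "of_int n \<le> (1::real)" "of_int n \<ge> (-1::real)" using x y by auto
    then have "n \<le> 1" "n \<ge> -1" by linarith+
    then consider "n = -1" | "n = 0" | "n = 1" by linarith
    then show "x = y \<or> x = 0 \<and> y = 1 \<or> x = 1 \<and> y = 0"
      using n x y by cases auto
  qed
  ultimately have "simple_path g" by (simp add: simple_path_def)
  moreover have "pathfinish g = pathstart g" by (simp add: pathfinish_def pathstart_def g_def)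
  moreover have img: "path_image g = sphere 0 1"
  proof -
    have "z \<in> g ` {0..1}" if "norm z = 1" for z
    proof -
      have "z = g (Arg2pi z / (2*pi))"
        using Arg2pi_eq[of z] that by (simp add: g_def cis_conv_exp)
      moreover have "Arg2pi z / (2*pi) \<in> {0..1}"
        using Arg2pi_ge_0[of z] Arg2pi_lt_2pi[of z] by simp
      ultimately show ?thesis by blast
    qed
    then show ?thesis by (auto simp: path_image_def g_def)
  qed
  ultimately show ?thesis
    using exists_double_arc[of g a b] assms that by metis
qed

text \<open>The points p and q cut the circle into two arcs U and D. The interior of s is connected and avoids p
and q, so s lies in one of them; by \<open>arc_in_full\<close> it is the whole of that arc, and the other one
remains.\<close>

lemma circle_diff_arc:
  assumes c: "circle_in Z c" and s: "arc_in Z s p q" and sub: "s \<subseteq> c"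
  shows "arc_in Z (c - (s - {p,q})) p q"
proof -
  obtain g where g: "circle_map Z g" "c = g ` sphere 0 1"
    using c unfolding circle_in_def by blast
  have pq: "p \<in> c" "q \<in> c" "p \<noteq> q" using arc_in_ends[OF s] sub by auto
  obtain a b where ab: "a \<in> sphere 0 1" "b \<in> sphere 0 1" "g a = p" "g b = q"
    using pq g(2) by blast
  have "a \<noteq> b" using ab pq by auto
  then obtain u d where ud: "arc u" "arc d" "pathstart u = a" "pathfinish u = b"
    "pathstart d = b" "pathfinish d = a"
    "path_image u \<inter> path_image d = {a,b}" "path_image u \<union> path_image d = sphere 0 1"
    using unit_circle_two_arcs ab by metis
  have gi: "inj_on g (sphere 0 1)" using g(1) by (simp add: closed_embedding_def)
  have arcI: "arc_in Z (g ` path_image w) (g (pathstart w)) (g (pathfinish w))"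
    if w: "arc w" "path_image w \<subseteq> sphere 0 1" for w
  proof (rule arc_inI)
    show "arc_map Z (g \<circ> w)"
      using w by (intro closed_embedding_precompose[OF g(1)]) (auto simp: arc_def path_def path_image_def)
  qed (auto simp: path_image_def pathstart_def pathfinish_def)
  define U where "U = g ` path_image u"
  define D where "D = g ` path_image d"
  have uds: "path_image u \<subseteq> sphere 0 1" "path_image d \<subseteq> sphere 0 1" using ud(8) by blast+
  have U: "arc_in Z U p q" using arcI[OF ud(1) uds(1)] unfolding ud ab U_def .
  have D: "arc_in Z D p q" using arc_in_reverse[OF arcI[OF ud(2) uds(2)]] unfolding ud ab D_def .
  have UD: "U \<union> D = c" unfolding U_def D_def g(2) ud(8)[symmetric] by (rule image_Un[symmetric])
  have "U \<inter> D = g ` (path_image u \<inter> path_image d)"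
    unfolding U_def D_def by (rule inj_on_image_Int[OF gi uds, symmetric])
  then have UDi: "U \<inter> D = {p,q}" using ud(7) ab by simp
  have key: "c - (s - {p,q}) = Y" if "arc_in Z X p q" "X \<union> Y = c" "X \<inter> Y = {p,q}" "s \<subseteq> X" for X Y
  proof -
    have "s = X" using arc_in_full[OF that(1) arc_in_connected[OF s] that(4)] arc_in_ends[OF s] by blast
    then show ?thesis using that by auto
  qed
  have "s - {p,q} \<subseteq> U \<or> s - {p,q} \<subseteq> D"
  proof (rule ccontr)
    assume "\<not> ?thesis"
    then have ne: "U \<inter> (s - {p,q}) \<noteq> {}" "D \<inter> (s - {p,q}) \<noteq> {}" using UD sub by blast+
    have "s - {p,q} \<subseteq> U \<union> D" "U \<inter> D \<inter> (s - {p,q}) = {}" using UD UDi sub by auto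
    then show False
      using arc_in_inner_connected[OF s] ne arc_in_closedin[OF U] arc_in_closedin[OF D]
      unfolding connectedin_closedin by blast
  qed
  then show ?thesis
  proof
    assume "s - {p,q} \<subseteq> U"
    then have "s \<subseteq> U" using UDi by auto
    then show ?thesis using key[OF U UD UDi] D by simp
  next
    assume "s - {p,q} \<subseteq> D"
    then have "s \<subseteq> D" using UDi by auto
    then show ?thesis using key[OF D _ _ \<open>s \<subseteq> D\<close>] UD UDi U by (simp add: Un_commute Int_commute)
  qed
qed

text \<open>In the parameter interval s is a closed subinterval, and the two remaining intervals are the required
arcs. The orientation of s is not determined by its position, hence the unordered pairs.\<close>

lemma arc_diff_arc:
  assumes a: "arc_in Z a p q" and s: "arc_in Z s u v" and sub: "s \<subseteq> a" "p \<notin> s" "q \<notin> s"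
  obtains u' v' a1 a2 where "{u',v'} = {u,v}" "arc_in Z a1 p u'" "arc_in Z a2 v' q"
    "a1 \<inter> a2 = {}" "a - s = (a1 - {u'}) \<union> (a2 - {v'})" "a1 \<inter> s = {u'}" "a2 \<inter> s = {v'}"
proof -
  obtain g where g: "arc_map Z g" "a = g ` {0..1}" "g 0 = p" "g 1 = q"
    using arc_inE[OF a] .
  have gi: "inj_on g {0..1}" using g(1) by (simp add: closed_embedding_def)
  define T where "T = {x \<in> {0..1}. g x \<in> s}"
  have sT: "s = g ` T" using sub g(2) by (auto simp: T_def)
  have conn: "connected T"
    using closed_embedding_connected_preimage[OF g(1) arc_in_connected[OF s]] sub g(2) by (simp add: T_def)
  have "closed T" using closed_embedding_preimage[OF g(1) arc_in_closedin[OF s]]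
    unfolding T_def by (meson closed_atLeastAtMost closedin_closed_trans)
  then have "compact ({0..1} \<inter> T)" by (intro compact_Int_closed) auto
  moreover have "{0..1} \<inter> T = T" by (auto simp: T_def)
  ultimately have "compact T" by simp
  then obtain l r where lr: "T = {l..r}" using conn connected_compact_interval_1 by blast
  have "T \<noteq> {}" using arc_in_ends[OF s] sT by auto
  then have "l \<le> r" using lr by auto
  then have lrT: "l \<in> T" "r \<in> T" using lr by auto
  have "0 \<notin> T" "1 \<notin> T" using g sub by (auto simp: T_def)
  then have lr01: "0 < l" "r < 1" using lrT by (auto simp: T_def order_less_le)
  have "l \<noteq> r"
  proof
    assume "l = r"
    then have "s = {g l}" using sT lr by simp
    then show False using arc_in_ends[OF s] by auto
  qed
  then have l_r: "l < r" using \<open>l \<le> r\<close> by simp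
  have sI: "s = g ` {l..r}" using sT lr by simp
  have slr: "arc_in Z s (g l) (g r)"
    unfolding sI by (rule arc_in_subpath[OF g(1)]) (use lr01 l_r in auto)
  \<comment> \<open>the ends of an arc are the points whose removal leaves it connected, so they do not depend
    on the parametrisation\<close>
  have ends: "{g l, g r} = {u,v}"
  proof -
    have main: "x \<in> {x', y'}" if xs: "arc_in Z s x y" and xs': "arc_in Z s x' y'" for x y x' y'
    proof (rule ccontr)
      assume nx: "x \<notin> {x',y'}"
      obtain h where h: "arc_map Z h" "s = h ` {0..1}" "h 0 = x" "h 1 = y"
        using arc_inE[OF xs] .
      have hi: "inj_on h {0..1}" using h(1) by (simp add: closed_embedding_def)
      have "{0<..1::real} = {0..1} - {0}" by auto
      then have "h ` {0<..1} = s - {x}"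
        using h(2,3) hi by (simp add: inj_on_image_set_diff[where C="{0..1}"])
      moreover have "connectedin Z (h ` {0<..1})"
        by (rule connectedin_image_closed_embedding[OF h(1)]) auto
      ultimately have "connectedin Z (s - {x})" by simp
      then have "s - {x} = s"
        using arc_in_full[OF xs'] nx arc_in_ends[OF xs'] by (metis Diff_iff Diff_subset insertCI singletonD)
      then show False using arc_in_ends[OF xs] by auto
    qed
    show ?thesis
      using main[OF slr s] main[OF s slr] main[OF arc_in_reverse[OF slr] s] main[OF arc_in_reverse[OF s] slr]
      by auto
  qed
  show ?thesis
  proof (rule that[of "g l" "g r" "g ` {0..l}" "g ` {r..1}"])
    show "{g l, g r} = {u,v}" by (rule ends)
    show "arc_in Z (g ` {0..l}) p (g l)"
      using arc_in_subpath[OF g(1), of 0 l] g(3) lr01 l_r by auto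
    show "arc_in Z (g ` {r..1}) (g r) q"
      using arc_in_subpath[OF g(1), of r 1] g(4) lr01 l_r by auto
    have int: "g ` A \<inter> g ` B = g ` (A \<inter> B)" "g ` A - g ` B = g ` (A - B)"
      if "A \<subseteq> {0..1}" "B \<subseteq> {0..1}" for A B
      using that by (simp_all add: inj_on_image_Int[OF gi] inj_on_image_set_diff[OF gi] Diff_subset subset_trans[of "A-B" A])
    have "{0..l} \<inter> {r..1} = {}" using l_r by auto
    then show "g ` {0..l} \<inter> g ` {r..1} = {}" using lr01 l_r by (subst int) auto
    have "{0..l} \<inter> {l..r} = {l}" "{r..1} \<inter> {l..r} = {r}" using lr01 l_r by auto
    then show "g ` {0..l} \<inter> s = {g l}" "g ` {r..1} \<inter> s = {g r}"
      unfolding sI using lr01 l_r by (subst int; auto)+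
    have "g ` {0..l} - {g l} = g ` ({0..l} - {l})" "g ` {r..1} - {g r} = g ` ({r..1} - {r})"
      using int(2)[of "{0..l}" "{l}"] int(2)[of "{r..1}" "{r}"] lr01 l_r by auto
    moreover have "a - s = g ` ({0..1} - {l..r})"
      unfolding g(2) sI using lr01 l_r by (intro int(2)) auto
    moreover have "{0..1} - {l..r} = ({0..l} - {l}) \<union> ({r..1} - {r})" using lr01 l_r by auto
    ultimately show "a - s = (g ` {0..l} - {g l}) \<union> (g ` {r..1} - {g r})" by (simp add: image_Un)
  qed
qed

section \<open>Counting connected components\<close>

abbreviation comps :: "'a topology \<Rightarrow> 'a set \<Rightarrow> 'a set set" where
  "comps Z W \<equiv> connected_components_of (subtopology Z W)"

definition ncomp :: "'a topology \<Rightarrow> 'a set \<Rightarrow> nat" where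
  "ncomp Z W = card (comps Z W)"

lemma connectedin_in_comps:
  assumes "connectedin Z T" "T \<subseteq> W" "T \<noteq> {}"
  obtains C where "C \<in> comps Z W" "T \<subseteq> C"
proof -
  have T: "connectedin (subtopology Z W) T" using assms by (simp add: connectedin_subtopology)
  then have "T \<subseteq> topspace (subtopology Z W)" by (rule connectedin_subset_topspace)
  then obtain C where "C \<in> comps Z W" "T \<inter> C \<noteq> {}"
    using assms(3) Union_connected_components_of[of "subtopology Z W"] by blast
  then show ?thesis
    using that connected_components_of_maximal[OF _ T] by (metis Int_commute disjnt_def)
qed

lemma comps_closed:
  assumes "closedin Z W" "C \<in> comps Z W"
  shows "closedin Z C" "connectedin Z C" "C \<noteq> {}" "C \<subseteq> W"
proof -
  show "closedin Z C"
    using closedin_connected_components_of[OF assms(2)] assms(1) closedin_trans_full by blast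
  show "connectedin Z C" "C \<subseteq> W"
    using connectedin_connected_components_of[OF assms(2)] by (simp_all add: connectedin_subtopology)
  show "C \<noteq> {}" using nonempty_connected_components_of[OF assms(2)] .
qed

lemma comps_Union: "closedin Z W \<Longrightarrow> \<Union>(comps Z W) = W"
  using closedin_subset[of Z W] by (simp add: Union_connected_components_of Int_absorb1)

lemma comps_disjoint: "C \<in> comps Z W \<Longrightarrow> D \<in> comps Z W \<Longrightarrow> C \<noteq> D \<Longrightarrow> C \<inter> D = {}"
  using pairwise_disjoint_connected_components_of by (metis disjnt_def pairwiseD)

lemma connectedin_closed_cover:
  assumes "connectedin Z D" "closedin Z A" "closedin Z A'" "D \<subseteq> A \<union> A'" "A \<inter> A' \<inter> D = {}" "A \<inter> D \<noteq> {}"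
  shows "A' \<inter> D = {}"
  using assms unfolding connectedin_closedin by metis

text \<open>A finite partition into closed connected sets is the partition into components.\<close>

lemma comps_eqI:
  assumes fin: "finite \<C>" and disj: "pairwise disjnt \<C>"
    and C: "\<And>C. C \<in> \<C> \<Longrightarrow> closedin Z C \<and> connectedin Z C \<and> C \<noteq> {}"
  shows "comps Z (\<Union>\<C>) = \<C>"
proof -
  have *: "C \<in> comps Z (\<Union>\<C>)" if CC: "C \<in> \<C>" for C
  proof -
    obtain D where D: "D \<in> comps Z (\<Union>\<C>)" "C \<subseteq> D"
      using connectedin_in_comps[of Z C "\<Union>\<C>"] C[OF CC] Union_upper[OF CC] by metis
    have cl: "closedin Z (\<Union>\<C>)" "closedin Z (\<Union>(\<C> - {C}))" using fin C by (auto intro: closedin_Union)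
    have "connectedin Z D" "D \<subseteq> \<Union>\<C>" using comps_closed[OF cl(1) D(1)] by auto
    moreover have "C \<inter> \<Union>(\<C> - {C}) = {}"
      using disj CC by (auto simp: pairwise_def disjnt_def)
    then have "C \<inter> \<Union>(\<C> - {C}) \<inter> D = {}" by blast
    moreover have DC: "D \<subseteq> C \<union> \<Union>(\<C> - {C})" using \<open>D \<subseteq> \<Union>\<C>\<close> by blast
    moreover have "closedin Z C" "C \<inter> D \<noteq> {}" using D C[OF CC] by blast+
    ultimately have "\<Union>(\<C> - {C}) \<inter> D = {}"
      using connectedin_closed_cover[OF _ _ cl(2)] by blast
    then have "D = C" using D DC by blast
    then show ?thesis using D by simp
  qed
  moreover have "D \<in> \<C>" if D: "D \<in> comps Z (\<Union>\<C>)" for D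
  proof -
    have "D \<noteq> {}" "D \<subseteq> \<Union>\<C>" using nonempty_connected_components_of[OF D]
        connected_components_of_subset[OF D] by auto
    then obtain C where "C \<in> \<C>" "C \<inter> D \<noteq> {}" by blast
    then have "C = D" using comps_disjoint[OF *[of C] D] by blast
    then show ?thesis using \<open>C \<in> \<C>\<close> by simp
  qed
  ultimately show ?thesis by blast
qed

text \<open>Attaching a connected closed set fuses exactly the components that it meets.\<close>

lemma comps_attach:
  assumes W: "closedin Z W" and fin: "finite (comps Z W)"
    and T: "closedin Z T" "connectedin Z T" "T \<noteq> {}"
  defines "K \<equiv> {C \<in> comps Z W. C \<inter> T \<noteq> {}}"
  shows "comps Z (W \<union> T) = insert (T \<union> \<Union>K) (comps Z W - K)"
    and "ncomp Z (W \<union> T) + card K = Suc (ncomp Z W)"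
proof -
  let ?N = "T \<union> \<Union>K"
  have KC: "K \<subseteq> comps Z W" by (auto simp: K_def)
  have Kf: "finite K" using fin KC finite_subset by blast
  have N: "closedin Z ?N" 
    using T(1) Kf KC comps_closed[OF W] by (auto intro!: closedin_Un closedin_Union)
  have "connectedin Z (\<Union>(insert T ((\<union>) T ` K)))"
  proof (rule connectedin_Union)
    show "connectedin Z S" if "S \<in> insert T ((\<union>) T ` K)" for S
      using that T(2) comps_closed[OF W] unfolding K_def by (auto intro!: connectedin_Un)
    show "\<Inter>(insert T ((\<union>) T ` K)) \<noteq> {}" using T(3) by auto
  qed
  moreover have "\<Union>(insert T ((\<union>) T ` K)) = ?N" by auto
  ultimately have Nc: "connectedin Z ?N" by simp
  have Nd: "?N \<inter> C = {}" if "C \<in> comps Z W - K" for C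
  proof -
    have "T \<inter> C = {}" using that unfolding K_def by blast
    moreover have "D \<inter> C = {}" if "D \<in> K" for D
      using comps_disjoint[of D Z W C] that \<open>C \<in> comps Z W - K\<close> KC by blast
    ultimately show ?thesis by blast
  qed
  define M where "M = comps Z W"
  have M: "\<Union>M = W" "K \<subseteq> M" using comps_Union[OF W] KC by (simp_all add: M_def)
  have un: "\<Union>(insert ?N (M - K)) = W \<union> T" unfolding M(1)[symmetric] using M(2) by blast
  have Md: "C \<inter> D = {}" if "C \<in> M" "D \<in> M" "C \<noteq> D" for C D
    using that comps_disjoint unfolding M_def by metis
  have "comps Z (\<Union>(insert ?N (M - K))) = insert ?N (M - K)"
  proof (rule comps_eqI)
    show "finite (insert ?N (M - K))" using fin by (simp add: M_def)
    have "disjnt ?N C" "disjnt C ?N" if "C \<in> M - K" for C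
      using Nd[of C] that unfolding M_def disjnt_def by (simp_all add: Int_commute)
    moreover have "pairwise disjnt (M - K)" using Md by (auto simp: pairwise_def disjnt_def)
    ultimately show "pairwise disjnt (insert ?N (M - K))" by (simp add: pairwise_insert)
    show "closedin Z C \<and> connectedin Z C \<and> C \<noteq> {}" if "C \<in> insert ?N (M - K)" for C
    proof (cases "C = ?N")
      case True
      show ?thesis unfolding True using N Nc T(3) by simp
    next
      case False
      then have "C \<in> comps Z W" using that by (simp add: M_def)
      then show ?thesis using comps_closed[OF W] by simp
    qed
  qed
  then show *: "comps Z (W \<union> T) = insert ?N (comps Z W - K)"
    unfolding un unfolding M_def .
  have "?N \<notin> comps Z W - K" using Nd T(3) by blast
  then show "ncomp Z (W \<union> T) + card K = Suc (ncomp Z W)"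
    unfolding ncomp_def * using fin Kf KC
    by (simp add: card_Diff_subset card_mono)
qed

lemma ncomp_attach_one:
  assumes "closedin Z W" "finite (comps Z W)" "closedin Z T" "connectedin Z T"
    and "C \<in> comps Z W" "T \<inter> W \<subseteq> C" "T \<inter> W \<noteq> {}"
  shows "ncomp Z (W \<union> T) = ncomp Z W"
proof -
  have "C \<inter> T \<noteq> {}" using assms(6,7) by blast
  moreover have "D = C" if D: "D \<in> comps Z W" "D \<inter> T \<noteq> {}" for D
  proof -
    have "D \<inter> C \<noteq> {}" using D assms(6) comps_closed(4)[OF assms(1) D(1)] by blast
    then show ?thesis using comps_disjoint[OF D(1) assms(5)] by blast
  qed
  ultimately have K: "{C \<in> comps Z W. C \<inter> T \<noteq> {}} = {C}" using assms(5) by blast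
  have "T \<noteq> {}" using assms(7) by blast
  from comps_attach(2)[OF assms(1-4) this] show ?thesis unfolding K by simp
qed

lemma ncomp_attach_two:
  assumes "closedin Z W" "finite (comps Z W)" "closedin Z T" "connectedin Z T"
    and "C \<in> comps Z W" "D \<in> comps Z W" "C \<noteq> D" "T \<inter> W \<subseteq> C \<union> D" "T \<inter> C \<noteq> {}" "T \<inter> D \<noteq> {}"
  shows "Suc (ncomp Z (W \<union> T)) = ncomp Z W"
proof -
  have "C' \<in> {C, D}" if C': "C' \<in> comps Z W" "C' \<inter> T \<noteq> {}" for C'
  proof -
    have "C' \<inter> C \<noteq> {} \<or> C' \<inter> D \<noteq> {}" using C' assms(8) comps_closed(4)[OF assms(1) C'(1)] by blast
    then show ?thesis using comps_disjoint[OF C'(1) assms(5)] comps_disjoint[OF C'(1) assms(6)] by blast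
  qed
  then have K: "{C \<in> comps Z W. C \<inter> T \<noteq> {}} = {C, D}" using assms(5,6,9,10) by blast
  have "T \<noteq> {}" using assms(9) by blast
  from comps_attach(2)[OF assms(1-4) this] show ?thesis unfolding K using assms(7) by simp
qed

lemma ncomp_image:
  assumes g: "closed_embedding Z Y g" and W: "W \<subseteq> topspace Z"
  shows "comps Y (g ` W) = (`) g ` comps Z W" "ncomp Y (g ` W) = ncomp Z W"
proof -
  have "homeomorphic_map Z (subtopology Y (g ` topspace Z)) g"
    using closed_embedding_homeomorphic_map[OF g] .
  moreover have "g ` (topspace Z \<inter> W) = topspace (subtopology Y (g ` topspace Z)) \<inter> g ` W"
  proof -
    have "g ` topspace Z \<subseteq> topspace Y"
      using g by (simp add: closed_embedding_def continuous_map_image_subset_topspace)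
    then show ?thesis using W by auto
  qed
  ultimately have "homeomorphic_map (subtopology Z W) (subtopology (subtopology Y (g ` topspace Z)) (g ` W)) g"
    by (intro homeomorphic_map_subtopologies)
  moreover have "subtopology (subtopology Y (g ` topspace Z)) (g ` W) = subtopology Y (g ` W)"
    using W by (simp add: subtopology_subtopology image_mono inf.absorb2)
  ultimately have hm: "homeomorphic_map (subtopology Z W) (subtopology Y (g ` W)) g" by simp
  show *: "comps Y (g ` W) = (`) g ` comps Z W"
    using homeomorphic_map_connected_components_of[OF hm] by simp
  have "inj_on ((`) g) (comps Z W)"
  proof (rule inj_on_subset)
    show "inj_on ((`) g) (Pow (topspace Z))"
      using g by (simp add: closed_embedding_def inj_on_image_Pow)
    show "comps Z W \<subseteq> Pow (topspace Z)"
      using connected_components_of_subset by fastforce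
  qed
  then show "ncomp Y (g ` W) = ncomp Z W"
    by (simp add: ncomp_def * card_image)
qed

section \<open>Surgery on disjoint unions of circles\<close>

definition circle_union :: "'a topology \<Rightarrow> 'a set \<Rightarrow> bool" where
  "circle_union Z B \<longleftrightarrow>
     (\<exists>\<C>. finite \<C> \<and> pairwise disjnt \<C> \<and> (\<forall>c\<in>\<C>. circle_in Z c) \<and> B = \<Union>\<C>)"

lemma comps_circles:
  assumes "finite \<C>" "pairwise disjnt \<C>" "\<And>c. c \<in> \<C> \<Longrightarrow> circle_in Z c"
  shows "comps Z (\<Union>\<C>) = \<C>"
  using assms(1,2)
  by (rule comps_eqI) (metis assms(3) circle_in_closedin circle_in_connected circle_in_nonempty)

lemma circle_union_comps:
  assumes "circle_union Z B"
  shows "finite (comps Z B)" "\<And>c. c \<in> comps Z B \<Longrightarrow> circle_in Z c" "\<Union>(comps Z B) = B" "closedin Z B"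
proof -
  obtain \<C> where C: "finite \<C>" "pairwise disjnt \<C>" "\<forall>c\<in>\<C>. circle_in Z c" "B = \<Union>\<C>"
    using assms unfolding circle_union_def by blast
  then have "comps Z B = \<C>" using comps_circles by blast
  then show "finite (comps Z B)" "\<And>c. c \<in> comps Z B \<Longrightarrow> circle_in Z c" "\<Union>(comps Z B) = B"
    using C by auto
  show "closedin Z B"
    unfolding C(4) using C(1,3) by (intro closedin_Union) (auto simp: circle_in_closedin)
qed

text \<open>Replacing some of the circles by other ones that are disjoint from the rest: the form in which a
surgery is carried out.\<close>

lemma circle_union_replace:
  assumes B: "circle_union Z B" and K: "K \<subseteq> comps Z B"
    and N: "finite N" "pairwise disjnt N" "\<And>c. c \<in> N \<Longrightarrow> circle_in Z c" "\<Union>N \<inter> (B - \<Union>K) = {}"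
  shows "circle_union Z ((B - \<Union>K) \<union> \<Union>N)"
    and "ncomp Z ((B - \<Union>K) \<union> \<Union>N) + card K = ncomp Z B + card N"
proof -
  define M where "M = comps Z B"
  have M: "finite M" "\<And>c. c \<in> M \<Longrightarrow> circle_in Z c" "\<Union>M = B"
    using circle_union_comps[OF B] by (simp_all add: M_def)
  have Md: "C \<inter> D = {}" if "C \<in> M" "D \<in> M" "C \<noteq> D" for C D
    using that comps_disjoint unfolding M_def by metis
  have KM: "K \<subseteq> M" using K by (simp add: M_def)
  have BK: "\<Union>(M - K) = B - \<Union>K"
    unfolding M(3)[symmetric] using KM Md by blast
  let ?C = "(M - K) \<union> N"
  have un: "\<Union>?C = (B - \<Union>K) \<union> \<Union>N" unfolding BK[symmetric] by blast
  have fin: "finite ?C" using M(1) N(1) by blast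
  have cross: "c \<inter> n = {}" "n \<inter> c = {}" if "c \<in> M - K" "n \<in> N" for c n
    using that N(4) unfolding BK[symmetric] by blast+
  have disj: "pairwise disjnt ?C"
  proof (rule pairwiseI)
    fix c n assume cn: "c \<in> ?C" "n \<in> ?C" "c \<noteq> n"
    show "disjnt c n"
    proof (cases "c \<in> N"; cases "n \<in> N")
      assume "c \<in> N" "n \<in> N"
      then show ?thesis using N(2) cn(3) by (simp add: pairwise_def)
    next
      assume "c \<in> N" "n \<notin> N"
      then show ?thesis using cross(2)[of n c] cn(2) by (simp add: disjnt_def)
    next
      assume "c \<notin> N" "n \<in> N"
      then show ?thesis using cross(1)[of c n] cn(1) by (simp add: disjnt_def)
    next
      assume "c \<notin> N" "n \<notin> N"
      then show ?thesis using Md[of c n] cn by (simp add: disjnt_def)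
    qed
  qed
  have circ: "circle_in Z c" if "c \<in> ?C" for c using that M(2) N(3) by blast
  show "circle_union Z ((B - \<Union>K) \<union> \<Union>N)"
    unfolding circle_union_def using fin disj circ un by metis
  have "c \<notin> N" if "c \<in> M - K" for c
    using cross(1)[OF that, of c] circle_in_nonempty[OF N(3)[of c]] by auto
  then have "(M - K) \<inter> N = {}" by blast
  moreover have "finite K" using KM M(1) finite_subset by blast
  ultimately have "card ?C + card K = card M + card N"
    using M(1) N(1) KM card_mono[OF M(1) KM] by (simp add: card_Un_disjoint card_Diff_subset)
  moreover have "comps Z ((B - \<Union>K) \<union> \<Union>N) = ?C"
    using comps_circles[OF fin disj circ] unfolding un .
  ultimately show "ncomp Z ((B - \<Union>K) \<union> \<Union>N) + card K = ncomp Z B + card N"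
    unfolding ncomp_def M_def by simp
qed

text \<open>A circle divided into four arcs: the segments s1 and s2, where an edge is attached to vertices, and
the free sides t1 and t2. The corners are labelled so that t1 joins the first ends of the segments.\<close>

definition square ::
    "'a topology \<Rightarrow> 'a set \<Rightarrow> 'a set \<Rightarrow> 'a set \<Rightarrow> 'a set \<Rightarrow> 'a \<Rightarrow> 'a \<Rightarrow> 'a \<Rightarrow> 'a \<Rightarrow> bool" where
  "square Z s1 s2 t1 t2 p1 q1 p2 q2 \<longleftrightarrow>
     arc_in Z s1 p1 q1 \<and> arc_in Z s2 p2 q2 \<and> arc_in Z t1 p1 p2 \<and> arc_in Z t2 q1 q2 \<and>
     s1 \<inter> s2 = {} \<and> t1 \<inter> t2 = {} \<and>
     s1 \<inter> t1 = {p1} \<and> s2 \<inter> t1 = {p2} \<and> s1 \<inter> t2 = {q1} \<and> s2 \<inter> t2 = {q2}"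

lemma square_swap:
  "square Z s1 s2 t1 t2 p1 q1 p2 q2 \<Longrightarrow> square Z t1 t2 s1 s2 p1 p2 q1 q2"
  unfolding square_def by (simp add: Int_commute)

text \<open>Replacing two opposite arcs of a square by the other two. If s1 and s2 lie on different circles, the
two opened circles and t1, t2 close up to a single circle. If they lie on the same circle, its two
remaining arcs a1 and a2 are closed up either separately, or together to one circle, depending on the
order of the corners along the circle. Note that t1 and t2 contain all corners, so that removing the
segments together with their end points does no harm.\<close>

lemma surgery:
  assumes B: "circle_union Z B" and sq: "square Z s1 s2 t1 t2 p1 q1 p2 q2"
    and sB: "s1 \<union> s2 \<subseteq> B" and tB: "(t1 \<union> t2) \<inter> B = {p1,q1,p2,q2}"
  defines "B' \<equiv> (B - (s1 \<union> s2)) \<union> (t1 \<union> t2)"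
  shows "circle_union Z B'"
    and "(\<exists>C\<in>comps Z B. s1 \<union> s2 \<subseteq> C) \<Longrightarrow> ncomp Z B' = ncomp Z B \<or> ncomp Z B' = Suc (ncomp Z B)"
    and "\<not> (\<exists>C\<in>comps Z B. s1 \<union> s2 \<subseteq> C) \<Longrightarrow> Suc (ncomp Z B') = ncomp Z B"
proof -
  note BC = circle_union_comps[OF B]
  have sq': "arc_in Z s1 p1 q1" "arc_in Z s2 p2 q2" "arc_in Z t1 p1 p2" "arc_in Z t2 q1 q2"
     "s1 \<inter> s2 = {}" "t1 \<inter> t2 = {}"
     "s1 \<inter> t1 = {p1}" "s2 \<inter> t1 = {p2}" "s1 \<inter> t2 = {q1}" "s2 \<inter> t2 = {q2}"
    using sq unfolding square_def by auto
  have mem: "p1 \<in> s1" "q1 \<in> s1" "p2 \<in> s2" "q2 \<in> s2" "p1 \<in> t1" "p2 \<in> t1" "q1 \<in> t2" "q2 \<in> t2"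
    using arc_in_ends[OF sq'(1)] arc_in_ends[OF sq'(2)] arc_in_ends[OF sq'(3)] arc_in_ends[OF sq'(4)] sq'(5)
    by auto
  have tB': "t1 \<inter> B = {p1,p2}" "t2 \<inter> B = {q1,q2}"
    using tB sq'(6) mem by auto
  have e: "x = p1 \<or> x = p2" if "x \<in> t1" "x \<in> B" for x using that tB'(1) by blast
  have e': "x = q1 \<or> x = q2" if "x \<in> t2" "x \<in> B" for x using that tB'(2) by blast
  obtain C1 where C1: "C1 \<in> comps Z B" "s1 \<subseteq> C1"
    using connectedin_in_comps[OF arc_in_connected[OF sq'(1)]] sB mem by blast
  obtain C2 where C2: "C2 \<in> comps Z B" "s2 \<subseteq> C2"
    using connectedin_in_comps[OF arc_in_connected[OF sq'(2)]] sB mem by blast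
  have CB: "C1 \<subseteq> B" "C2 \<subseteq> B" using C1 C2 BC(3) by auto
  have result: "circle_union Z B' \<and>
      ((\<exists>C\<in>comps Z B. s1 \<union> s2 \<subseteq> C) \<longrightarrow> ncomp Z B' = ncomp Z B \<or> ncomp Z B' = Suc (ncomp Z B)) \<and>
      (\<not> (\<exists>C\<in>comps Z B. s1 \<union> s2 \<subseteq> C) \<longrightarrow> Suc (ncomp Z B') = ncomp Z B)"
  proof (cases "C1 = C2")
    case False
    have CC: "C1 \<inter> C2 = {}" using comps_disjoint[OF C1(1) C2(1) False] .
    have no: "\<not> (\<exists>C\<in>comps Z B. s1 \<union> s2 \<subseteq> C)"
      using C1 C2 False mem comps_disjoint[of _ Z B] by blast
    define a1 where "a1 = C1 - (s1 - {p1,q1})"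
    define a2 where "a2 = C2 - (s2 - {p2,q2})"
    have a1: "arc_in Z a1 p1 q1" and a2: "arc_in Z a2 p2 q2"
      unfolding a1_def a2_def
      using circle_diff_arc[OF BC(2)[OF C1(1)] sq'(1) C1(2)] circle_diff_arc[OF BC(2)[OF C2(1)] sq'(2) C2(2)]
      by auto
    have mem': "p1 \<in> a1" "q1 \<in> a1" "p2 \<in> a2" "q2 \<in> a2" "a1 \<subseteq> C1" "a2 \<subseteq> C2"
      using C1 C2 mem by (auto simp: a1_def a2_def)
    have aB: "a1 \<subseteq> B" "a2 \<subseteq> B" "a1 \<inter> a2 = {}" using mem' CB CC by blast+
    then have nm: "p1 \<notin> a2" "q1 \<notin> a2" "p2 \<notin> a1" "q2 \<notin> a1" using mem' by blast+
    have x1: "t1 \<inter> a2 = {p2}" using e aB(2) mem mem' nm by blast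
    have x2: "(t1 \<union> a2) \<inter> t2 = {q2}" using e' aB(2) mem mem' nm sq'(6) by blast
    have x3: "(t1 \<union> a2 \<union> t2) \<inter> a1 = {p1,q1}" using e e' aB mem mem' nm by blast
    have "arc_in Z (t1 \<union> a2 \<union> t2) p1 q1"
      using arc_in_join[OF arc_in_join[OF sq'(3) a2 x1] arc_in_reverse[OF sq'(4)] x2] .
    then have N: "circle_in Z (t1 \<union> a2 \<union> t2 \<union> a1)" using circle_in_join[OF _ a1 x3] by blast
    let ?N = "t1 \<union> a2 \<union> t2 \<union> a1"
    have eq: "(B - \<Union>{C1,C2}) \<union> \<Union>{?N} = B'"
    proof (rule set_eqI)
      fix x
      have "x \<in> a1 \<longleftrightarrow> x \<in> C1 \<and> (x \<in> s1 \<longrightarrow> x = p1 \<or> x = q1)"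
        "x \<in> a2 \<longleftrightarrow> x \<in> C2 \<and> (x \<in> s2 \<longrightarrow> x = p2 \<or> x = q2)"
        by (auto simp: a1_def a2_def)
      moreover have "x \<in> s1 \<longrightarrow> x \<in> C1" "x \<in> s2 \<longrightarrow> x \<in> C2" "x \<in> C1 \<longrightarrow> x \<in> B" "x \<in> C2 \<longrightarrow> x \<in> B"
        "\<not> (x \<in> C1 \<and> x \<in> C2)"
        using CB C1(2) C2(2) CC by blast+
      moreover have "x = p1 \<or> x = q1 \<or> x = p2 \<or> x = q2 \<longrightarrow> x \<in> t1 \<or> x \<in> t2" using mem by blast
      ultimately show "x \<in> (B - \<Union>{C1,C2}) \<union> \<Union>{?N} \<longleftrightarrow> x \<in> B'"
        unfolding B'_def by simp metis
    qed
    have "\<Union>{?N} \<inter> (B - \<Union>{C1,C2}) = {}" using e e' mem' mem C1(2) C2(2) by auto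
    then have "circle_union Z B'" "ncomp Z B' + card {C1,C2} = ncomp Z B + card {?N}"
      using circle_union_replace[OF B, of "{C1,C2}" "{?N}"] C1 C2 N unfolding eq by auto
    then show ?thesis using no False by simp
  next
    case True
    let ?C = C1
    have yes: "\<exists>C\<in>comps Z B. s1 \<union> s2 \<subseteq> C" using C1 C2 True by blast
    define a where "a = ?C - (s1 - {p1,q1})"
    have a: "arc_in Z a p1 q1"
      unfolding a_def using circle_diff_arc[OF BC(2)[OF C1(1)] sq'(1) C1(2)] .
    have "s2 \<subseteq> a" "p1 \<notin> s2" "q1 \<notin> s2" using C2 True sq'(5) mem by (auto simp: a_def)
    then obtain u v a1 a2 where uv: "{u,v} = {p2,q2}" "arc_in Z a1 p1 u" "arc_in Z a2 v q1"
      "a1 \<inter> a2 = {}" "a - s2 = (a1 - {u}) \<union> (a2 - {v})" "a1 \<inter> s2 = {u}" "a2 \<inter> s2 = {v}"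
      using arc_diff_arc[OF a sq'(2)] by metis
    have am: "p1 \<in> a1" "u \<in> a1" "v \<in> a2" "q1 \<in> a2"
      using arc_in_ends[OF uv(2)] arc_in_ends[OF uv(3)] by auto
    have aC: "a1 \<subseteq> ?C" "a2 \<subseteq> ?C" using uv(5-7) C2(2) True unfolding a_def by blast+
    have un: "a1 \<union> a2 = (?C - (s1 \<union> s2)) \<union> {p1,q1,p2,q2}"
    proof -
      have "a1 \<union> a2 = (a - s2) \<union> {u,v}" using uv(5) am by blast
      also have "\<dots> = (?C - (s1 \<union> s2)) \<union> {p1,q1,p2,q2}"
      proof (rule set_eqI)
        fix x
        have "x \<in> s1 \<longrightarrow> x \<in> C1" "x \<in> s2 \<longrightarrow> x \<in> C1" "\<not> (x \<in> s1 \<and> x \<in> s2)"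
          using C1(2) C2(2) True sq'(5) by blast+
        moreover have "x = p1 \<or> x = q1 \<longrightarrow> x \<in> s1" using mem by blast
        ultimately show "x \<in> a - s2 \<union> {u,v} \<longleftrightarrow> x \<in> (C1 - (s1 \<union> s2)) \<union> {p1,q1,p2,q2}"
          unfolding uv(1) a_def by simp metis
      qed
      finally show ?thesis .
    qed
    have eqB: "(B - ?C) \<union> (a1 \<union> a2 \<union> (t1 \<union> t2)) = B'"
      unfolding un B'_def
    proof (rule set_eqI)
      fix x
      have "x \<in> s1 \<longrightarrow> x \<in> C1" "x \<in> s2 \<longrightarrow> x \<in> C1" "x \<in> C1 \<longrightarrow> x \<in> B"
        using CB C1(2) C2(2) True by blast+
      moreover have "x = p1 \<or> x = q1 \<or> x = p2 \<or> x = q2 \<longrightarrow> x \<in> t1 \<or> x \<in> t2" using mem by blast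
      ultimately show "x \<in> (B - C1) \<union> (C1 - (s1 \<union> s2) \<union> {p1,q1,p2,q2} \<union> (t1 \<union> t2)) \<longleftrightarrow>
          x \<in> B - (s1 \<union> s2) \<union> (t1 \<union> t2)"
        by simp metis
    qed
    have dB: "(a1 \<union> a2 \<union> (t1 \<union> t2)) \<inter> (B - ?C) = {}"
    proof -
      have "x \<in> ?C" if "x \<in> a1 \<union> a2 \<union> (t1 \<union> t2)" "x \<in> B" for x
        using that e[of x] e'[of x] aC C1(2) C2(2) True mem by blast
      then show ?thesis by blast
    qed
    have aB: "a1 \<subseteq> B" "a2 \<subseteq> B" using aC CB by blast+
    consider "u = p2" "v = q2" | "u = q2" "v = p2" using uv(1) by (metis doubleton_eq_iff)
    then show ?thesis
    proof cases
      case 1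
      have nm: "p1 \<in> a1" "p2 \<in> a1" "q1 \<in> a2" "q2 \<in> a2" "p1 \<notin> a2" "p2 \<notin> a2" "q1 \<notin> a1" "q2 \<notin> a1"
        using am uv(4) 1 by blast+
      have i1: "a1 \<inter> t1 = {p1,p2}" using e aB mem nm by blast
      have i2: "t2 \<inter> a2 = {q1,q2}" using e' aB mem nm by blast
      have i3: "a1 \<inter> t2 = {}" "a2 \<inter> t1 = {}" using e e' aB nm by blast+
      have c: "circle_in Z (a1 \<union> t1)" "circle_in Z (t2 \<union> a2)"
        using circle_in_join[OF uv(2)[unfolded 1] sq'(3) i1]
          circle_in_join[OF sq'(4) arc_in_reverse[OF uv(3)[unfolded 1]] i2] .
      let ?N = "{a1 \<union> t1, t2 \<union> a2}"
      have d: "(a1 \<union> t1) \<inter> (t2 \<union> a2) = {}" using i3 uv(4) sq'(6) by blast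
      then have "a1 \<union> t1 \<noteq> t2 \<union> a2" using am by blast
      then have cN: "card ?N = 2" by simp
      have uN: "\<Union>?N = a1 \<union> a2 \<union> (t1 \<union> t2)" by blast
      have "pairwise disjnt ?N" using d by (auto simp: pairwise_insert disjnt_def)
      then have "circle_union Z B'" "ncomp Z B' + card {?C} = ncomp Z B + card ?N"
        using circle_union_replace[OF B, of "{?C}" ?N] C1 c dB unfolding uN by (auto simp: eqB)
      then show ?thesis using yes cN by simp
    next
      case 2
      have nm: "p1 \<in> a1" "p2 \<in> a2" "q1 \<in> a2" "q2 \<in> a1" "p1 \<notin> a2" "p2 \<notin> a1" "q1 \<notin> a1" "q2 \<notin> a2"
        using am uv(4) 2 by blast+
      have i1: "a1 \<inter> t2 = {q2}" using e' aB mem nm by blast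
      have i2: "(a1 \<union> t2) \<inter> a2 = {q1}" using e' aB mem nm uv(4) by blast
      have i3: "(a1 \<union> t2 \<union> a2) \<inter> t1 = {p1,p2}" using e aB mem nm sq'(6) by blast
      have arc1: "arc_in Z (a1 \<union> t2) p1 q1"
        using arc_in_join[OF uv(2)[unfolded 2] arc_in_reverse[OF sq'(4)] i1] .
      have "arc_in Z (a1 \<union> t2 \<union> a2) p1 p2"
        using arc_in_join[OF arc1 arc_in_reverse[OF uv(3)[unfolded 2]] i2] .
      then have c: "circle_in Z (a1 \<union> t2 \<union> a2 \<union> t1)" using circle_in_join[OF _ sq'(3) i3] by blast
      let ?N = "{a1 \<union> t2 \<union> a2 \<union> t1}"
      have uN: "\<Union>?N = a1 \<union> a2 \<union> (t1 \<union> t2)" by blast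
      have "circle_union Z B'" "ncomp Z B' + card {?C} = ncomp Z B + card ?N"
        using circle_union_replace[OF B, of "{?C}" ?N] C1 c dB unfolding uN by (auto simp: eqB)
      then show ?thesis using yes by simp
    qed
  qed
  then show "circle_union Z B'"
    and "(\<exists>C\<in>comps Z B. s1 \<union> s2 \<subseteq> C) \<Longrightarrow> ncomp Z B' = ncomp Z B \<or> ncomp Z B' = Suc (ncomp Z B)"
    and "\<not> (\<exists>C\<in>comps Z B. s1 \<union> s2 \<subseteq> C) \<Longrightarrow> Suc (ncomp Z B') = ncomp Z B"
    by blast+
qed

section \<open>Circles with squares attached\<close>

text \<open>The boundary circles of the vertices, forming B0, and for every edge the square formed by its boundary
circle, attached to B0 along its segments. The axioms are symmetric enough for the segments and sides
to be exchanged, which is the passage to the geometric dual.\<close>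

locale square_system =
  fixes Z :: "'a topology" and B0 :: "'a set" and E :: "'e set"
    and s1 s2 t1 t2 :: "'e \<Rightarrow> 'a set" and p1 q1 p2 q2 :: "'e \<Rightarrow> 'a"
  assumes finite_E: "finite E"
    and circles: "circle_union Z B0"
    and square: "e \<in> E \<Longrightarrow> square Z (s1 e) (s2 e) (t1 e) (t2 e) (p1 e) (q1 e) (p2 e) (q2 e)"
    and segments_sub: "e \<in> E \<Longrightarrow> s1 e \<union> s2 e \<subseteq> B0"
    and sides_meet: "e \<in> E \<Longrightarrow> (t1 e \<union> t2 e) \<inter> B0 = {p1 e, q1 e, p2 e, q2 e}"
    and squares_disjoint: "\<lbrakk>e \<in> E; e' \<in> E; e \<noteq> e'\<rbrakk> \<Longrightarrow>
      (s1 e \<union> s2 e \<union> (t1 e \<union> t2 e)) \<inter> (s1 e' \<union> s2 e' \<union> (t1 e' \<union> t2 e')) = {}"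
begin

abbreviation segs :: "'e \<Rightarrow> 'a set" where "segs e \<equiv> s1 e \<union> s2 e"
abbreviation sides :: "'e \<Rightarrow> 'a set" where "sides e \<equiv> t1 e \<union> t2 e"
abbreviation corners :: "'e \<Rightarrow> 'a set" where "corners e \<equiv> {p1 e, q1 e, p2 e, q2 e}"

text \<open>What becomes the boundary of the spanning ribbon subgraph with edge set A.\<close>

definition bd :: "'e set \<Rightarrow> 'a set" where
  "bd A = (B0 - (\<Union>e\<in>A. segs e)) \<union> (\<Union>e\<in>A. sides e)"

text \<open>The union of the boundary circles of all vertices and of the edges in A; its components
correspond to those of the ribbon subgraph. The segments are already contained in B0.\<close>

definition skel :: "'e set \<Rightarrow> 'a set" where
  "skel A = B0 \<union> (\<Union>e\<in>A. sides e)"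

definition f :: "'e set \<Rightarrow> nat" where "f A = ncomp Z (bd A)"
definition k :: "'e set \<Rightarrow> nat" where "k A = ncomp Z (skel A)"

lemma arcs:
  assumes "e \<in> E"
  shows "arc_in Z (s1 e) (p1 e) (q1 e)" "arc_in Z (s2 e) (p2 e) (q2 e)"
    "arc_in Z (t1 e) (p1 e) (p2 e)" "arc_in Z (t2 e) (q1 e) (q2 e)"
    "s1 e \<inter> s2 e = {}" "t1 e \<inter> t2 e = {}"
    "s1 e \<inter> t1 e = {p1 e}" "s2 e \<inter> t1 e = {p2 e}" "s1 e \<inter> t2 e = {q1 e}" "s2 e \<inter> t2 e = {q2 e}"
  using square[OF assms] unfolding square_def by auto

lemma corners_in:
  assumes "e \<in> E"
  shows "p1 e \<in> s1 e" "q1 e \<in> s1 e" "p2 e \<in> s2 e" "q2 e \<in> s2 e"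
    "p1 e \<in> t1 e" "p2 e \<in> t1 e" "q1 e \<in> t2 e" "q2 e \<in> t2 e"
  using arcs[OF assms] by auto

lemma segs_sides:
  assumes "e \<in> E" shows "segs e \<inter> sides e = corners e"
  unfolding Int_Un_distrib Int_Un_distrib2 arcs[OF assms] by auto

lemma closed_segs: "e \<in> E \<Longrightarrow> closedin Z (segs e)" 
  and closed_sides: "e \<in> E \<Longrightarrow> closedin Z (sides e)"
  by (auto intro!: closedin_Un intro: arc_in_closedin[OF arcs(1)] arc_in_closedin[OF arcs(2)]
      arc_in_closedin[OF arcs(3)] arc_in_closedin[OF arcs(4)])

lemma connected_square: "e \<in> E \<Longrightarrow> connectedin Z (segs e \<union> sides e)"
proof -
  assume e: "e \<in> E"
  note c = arc_in_connected[OF arcs(1)[OF e]] arc_in_connected[OF arcs(2)[OF e]]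
    arc_in_connected[OF arcs(3)[OF e]] arc_in_connected[OF arcs(4)[OF e]]
  have "connectedin Z (s1 e \<union> t1 e)"
    by (rule connectedin_Un[OF c(1,3)]) (use arcs(7)[OF e] in blast)
  then have "connectedin Z (s1 e \<union> t1 e \<union> s2 e)"
    by (rule connectedin_Un[OF _ c(2)]) (use corners_in(3,6)[OF e] in blast)
  then have "connectedin Z (s1 e \<union> t1 e \<union> s2 e \<union> t2 e)"
    by (rule connectedin_Un[OF _ c(4)]) (use corners_in(4,8)[OF e] in blast)
  moreover have "s1 e \<union> t1 e \<union> s2 e \<union> t2 e = segs e \<union> sides e" by blast
  ultimately show ?thesis by simp
qed

lemma disjoint_pieces:
  assumes "e \<in> E" "A \<subseteq> E" "e \<notin> A"
  shows "segs e \<inter> (\<Union>e\<in>A. segs e) = {}" "segs e \<inter> (\<Union>e\<in>A. sides e) = {}"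
    "sides e \<inter> (\<Union>e\<in>A. segs e) = {}" "sides e \<inter> (\<Union>e\<in>A. sides e) = {}"
proof -
  have "(segs e \<union> sides e) \<inter> (segs a \<union> sides a) = {}" if "a \<in> A" for a
    using squares_disjoint[OF assms(1), of a] that assms by blast
  then show "segs e \<inter> (\<Union>e\<in>A. segs e) = {}" "segs e \<inter> (\<Union>e\<in>A. sides e) = {}"
    "sides e \<inter> (\<Union>e\<in>A. segs e) = {}" "sides e \<inter> (\<Union>e\<in>A. sides e) = {}"
    by blast+
qed

lemma bd_empty [simp]: "bd {} = B0" and skel_empty [simp]: "skel {} = B0"
  by (simp_all add: bd_def skel_def)

lemma skel_insert: "e \<in> E \<Longrightarrow> skel (insert e A) = skel A \<union> (segs e \<union> sides e)"
  using segments_sub by (auto simp: skel_def)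

lemma bd_sub_skel: "bd A \<subseteq> skel A" by (auto simp: bd_def skel_def)

context
  fixes A e assumes A: "A \<subseteq> E" and e: "e \<in> E" "e \<notin> A"
begin

lemma segs_in_bd: "segs e \<subseteq> bd A"
  using disjoint_pieces(1)[OF e(1) A e(2)] segments_sub[OF e(1)] unfolding bd_def by blast

lemma sides_bd: "sides e \<inter> bd A = corners e"
proof -
  have "sides e \<inter> bd A = sides e \<inter> B0"
    using disjoint_pieces(3,4)[OF e(1) A e(2)] unfolding bd_def by blast
  then show ?thesis using sides_meet[OF e(1)] by simp
qed

lemma bd_insert: "bd (insert e A) = (bd A - segs e) \<union> sides e"
  using disjoint_pieces(2)[OF e(1) A e(2)] unfolding bd_def by auto

lemma sides_in_bd_insert: "sides e \<subseteq> bd (insert e A)" 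
  unfolding bd_insert by blast

lemma segs_bd_insert: "segs e \<inter> bd (insert e A) = corners e"
  unfolding bd_insert using segs_sides[OF e(1)] by blast

lemma bd_remove: "bd A = (bd (insert e A) - sides e) \<union> segs e"
proof -
  have "corners e \<subseteq> segs e" using segs_sides[OF e(1)] by blast
  then show ?thesis unfolding bd_insert using segs_in_bd sides_bd by blast
qed

lemma skel_meet: "(segs e \<union> sides e) \<inter> skel A = segs e"
proof -
  have "sides e \<inter> skel A = corners e"
    using disjoint_pieces(4)[OF e(1) A e(2)] sides_meet[OF e(1)] unfolding skel_def by blast
  moreover have "corners e \<subseteq> segs e" using segs_sides[OF e(1)] by blast
  moreover have "segs e \<subseteq> skel A" using segments_sub[OF e(1)] unfolding skel_def by blast
  ultimately show ?thesis by blast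
qed

end

lemma circle_union_bd: "A \<subseteq> E \<Longrightarrow> circle_union Z (bd A)"
proof -
  assume A: "A \<subseteq> E"
  then have "finite A" using finite_E finite_subset by blast
  then show ?thesis using A
  proof (induction A)
    case (insert e A)
    then have "A \<subseteq> E" "e \<in> E" "e \<notin> A" by auto
    note h = this
    show ?case
      using surgery(1)[OF insert.IH[OF h(1)] square[OF h(2)] segs_in_bd[OF h] sides_bd[OF h]]
      unfolding bd_insert[OF h] .
  qed (simp add: circles)
qed

lemma closed_skel: "A \<subseteq> E \<Longrightarrow> closedin Z (skel A)"
  unfolding skel_def using circle_union_comps(4)[OF circles] closed_sides finite_E
  by (intro closedin_Un closedin_Union) (auto intro: finite_subset)

text \<open>The boundary of the whole ribbon graph consists of the circles along which the dual vertices are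
attached, and the sides of an edge are its segments in the dual.\<close>

lemma dual: "square_system Z (bd E) E t1 t2 s1 s2 p1 p2 q1 q2"
proof
  show "finite E" by (rule finite_E)
  show "circle_union Z (bd E)" by (rule circle_union_bd) simp
  fix e assume e: "e \<in> E"
  then have h: "E - {e} \<subseteq> E" "e \<in> E" "e \<notin> E - {e}" "insert e (E - {e}) = E" by auto
  show "square Z (t1 e) (t2 e) (s1 e) (s2 e) (p1 e) (p2 e) (q1 e) (q2 e)"
    by (rule square_swap[OF square[OF e]])
  show "sides e \<subseteq> bd E" using sides_in_bd_insert[OF h(1-3)] h(4) by simp
  have "segs e \<inter> bd E = corners e" using segs_bd_insert[OF h(1-3)] h(4) by simp
  then show "(s1 e \<union> s2 e) \<inter> bd E = {p1 e, p2 e, q1 e, q2 e}" by auto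
  fix e' assume "e' \<in> E" "e \<noteq> e'"
  then show "(sides e \<union> segs e) \<inter> (sides e' \<union> segs e') = {}"
    using squares_disjoint[OF e, of e'] by (simp add: Un_commute)
qed

interpretation dual: square_system Z "bd E" E t1 t2 s1 s2 p1 p2 q1 q2
  by (rule dual)

text \<open>Attaching an edge in the dual undoes the surgery that attached it in the original system.\<close>

lemma dual_bd:
  assumes A: "A \<subseteq> E" shows "dual.bd A = bd (E - A)"
proof -
  have split: "(\<Union>e\<in>E. F e) = (\<Union>e\<in>A. F e) \<union> (\<Union>e\<in>E-A. F e)" for F :: "'e \<Rightarrow> 'a set"
    using A by blast
  have d: "a \<in> E \<Longrightarrow> b \<in> E \<Longrightarrow> a \<noteq> b \<Longrightarrow> x \<in> segs a \<union> sides a \<Longrightarrow> x \<notin> segs b \<union> sides b" for a b x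
    using squares_disjoint by blast
  show ?thesis
  proof (rule set_eqI)
    fix x
    have s: "x \<in> segs e \<Longrightarrow> x \<in> B0" if "e \<in> A" for e using segments_sub that A by blast
    have c: "x \<in> sides e \<Longrightarrow> x \<in> B0 \<Longrightarrow> x \<in> segs e" if "e \<in> A" for e
      using sides_meet[of e] segs_sides[of e] that A by blast
    show "x \<in> dual.bd A \<longleftrightarrow> x \<in> bd (E - A)"
    proof (cases "\<exists>e\<in>A. x \<in> segs e \<union> sides e")
      case True
      then obtain e where e: "e \<in> A" "x \<in> segs e \<union> sides e" by blast
      have no: "x \<notin> segs b" "x \<notin> sides b" if "b \<in> E" "b \<noteq> e" for b
        using d[of e b x] that e A by blast+
      have "x \<in> dual.bd A \<longleftrightarrow> x \<in> segs e"
      proof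
        assume L: "x \<in> dual.bd A"
        show "x \<in> segs e"
        proof (rule ccontr)
          assume "x \<notin> segs e"
          then have "x \<in> sides e" "x \<notin> (\<Union>e\<in>A. segs e)" using e no(1) A by auto
          then show False using L e(1) unfolding dual.bd_def by blast
        qed
      qed (use e in \<open>auto simp: dual.bd_def\<close>)
      also have "\<dots> \<longleftrightarrow> x \<in> B0" using s[OF e(1)] c[OF e(1)] e(2) by blast
      also have "\<dots> \<longleftrightarrow> x \<in> bd (E - A)"
      proof -
        have "x \<notin> (\<Union>e\<in>E-A. segs e)" "x \<notin> (\<Union>e\<in>E-A. sides e)" using no e(1) by auto
        then show ?thesis unfolding bd_def by blast
      qed
      finally show ?thesis .
    next
      case False
      then have no: "x \<notin> (\<Union>e\<in>A. segs e)" "x \<notin> (\<Union>e\<in>A. sides e)" by auto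
      then have "x \<in> dual.bd A \<longleftrightarrow> x \<in> bd E" unfolding dual.bd_def by blast
      also have "\<dots> \<longleftrightarrow> x \<in> bd (E - A)"
        using no unfolding bd_def split[of segs] split[of sides] by blast
      finally show ?thesis .
    qed
  qed
qed

lemma dual_skel: "dual.skel E = skel E"
proof -
  have "(\<Union>e\<in>E. segs e) \<subseteq> B0" using segments_sub by blast
  then show ?thesis unfolding dual.skel_def unfolding skel_def bd_def[of E] by blast
qed

subsection \<open>How the counts change when an edge is added\<close>

context
  fixes A e assumes A: "A \<subseteq> E" and e: "e \<in> E" "e \<notin> A"
begin

lemma f_insert:
  shows "(\<exists>C\<in>comps Z (bd A). segs e \<subseteq> C) \<Longrightarrow> f (insert e A) = f A \<or> f (insert e A) = Suc (f A)"
    and "\<not> (\<exists>C\<in>comps Z (bd A). segs e \<subseteq> C) \<Longrightarrow> Suc (f (insert e A)) = f A"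
  using surgery(2,3)[OF circle_union_bd[OF A] square[OF e(1)] segs_in_bd[OF A e] sides_bd[OF A e]]
  unfolding f_def bd_insert[OF A e] by blast+

text \<open>Removing an edge is the surgery with the segments and the sides exchanged.\<close>

lemma f_remove:
  assumes "\<not> (\<exists>C\<in>comps Z (bd (insert e A)). sides e \<subseteq> C)"
  shows "Suc (f A) = f (insert e A)"
proof -
  have c: "segs e \<inter> bd (insert e A) = {p1 e, p2 e, q1 e, q2 e}"
    using segs_bd_insert[OF A e] by auto
  have cu: "circle_union Z (bd (insert e A))" using A e by (intro circle_union_bd) auto
  show ?thesis
    using surgery(3)[OF cu square_swap[OF square[OF e(1)]] sides_in_bd_insert[OF A e] c assms]
    unfolding f_def bd_remove[OF A e, symmetric] .
qed

end

lemma finite_comps_skel: "A \<subseteq> E \<Longrightarrow> finite (comps Z (skel A))"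
proof -
  assume A: "A \<subseteq> E"
  then have "finite A" using finite_E finite_subset by blast
  then show ?thesis using A
  proof (induction A)
    case (insert e A)
    then have e: "e \<in> E" and A: "A \<subseteq> E" by auto
    have ne: "segs e \<union> sides e \<noteq> {}" using corners_in(1)[OF e] by blast
    show ?case
      unfolding skel_insert[OF e]
      using comps_attach(1)[OF closed_skel[OF A] insert.IH[OF A]
          closedin_Un[OF closed_segs[OF e] closed_sides[OF e]] connected_square[OF e] ne]
        insert.IH[OF A] by simp
  qed (simp add: circle_union_comps(1)[OF circles])
qed

lemma k_insert:
  assumes A: "A \<subseteq> E" and e: "e \<in> E" "e \<notin> A"
  shows "(\<exists>C\<in>comps Z (skel A). segs e \<subseteq> C) \<Longrightarrow> k (insert e A) = k A"
    and "\<not> (\<exists>C\<in>comps Z (skel A). segs e \<subseteq> C) \<Longrightarrow> Suc (k (insert e A)) = k A"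
proof -
  note W = closed_skel[OF A] finite_comps_skel[OF A] 
    closedin_Un[OF closed_segs[OF e(1)] closed_sides[OF e(1)]] connected_square[OF e(1)]
  have meet: "(segs e \<union> sides e) \<inter> skel A = segs e" by (rule skel_meet[OF A e])
  then have sW: "segs e \<subseteq> skel A" by blast
  have ne: "segs e \<noteq> {}" using corners_in(1)[OF e(1)] by blast
  {
    assume "\<exists>C\<in>comps Z (skel A). segs e \<subseteq> C"
    then obtain C where C: "C \<in> comps Z (skel A)" "segs e \<subseteq> C" by blast
    show "k (insert e A) = k A"
      unfolding k_def skel_insert[OF e(1)]
      by (rule ncomp_attach_one[OF W C(1)]) (use C(2) ne in \<open>simp_all add: meet\<close>)
  next
    assume no: "\<not> (\<exists>C\<in>comps Z (skel A). segs e \<subseteq> C)"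
    obtain C where C: "C \<in> comps Z (skel A)" "s1 e \<subseteq> C"
      using connectedin_in_comps[OF arc_in_connected[OF arcs(1)[OF e(1)]], of "skel A"] sW
        corners_in(1)[OF e(1)] by blast
    obtain D where D: "D \<in> comps Z (skel A)" "s2 e \<subseteq> D"
      using connectedin_in_comps[OF arc_in_connected[OF arcs(2)[OF e(1)]], of "skel A"] sW
        corners_in(3)[OF e(1)] by blast
    have "C \<noteq> D" using no C D by blast
    show "Suc (k (insert e A)) = k A"
      unfolding k_def skel_insert[OF e(1)]
    proof (rule ncomp_attach_two[OF W C(1) D(1) \<open>C \<noteq> D\<close>])
      show "(segs e \<union> sides e) \<inter> skel A \<subseteq> C \<union> D" unfolding meet using C(2) D(2) by blast
      show "(segs e \<union> sides e) \<inter> C \<noteq> {}" using C(2) corners_in(1)[OF e(1)] by blast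
      show "(segs e \<union> sides e) \<inter> D \<noteq> {}" using D(2) corners_in(3)[OF e(1)] by blast
    qed
  }
qed

lemma joined_mono:
  assumes "\<exists>C\<in>comps Z W. T \<subseteq> C" "closedin Z W" "W \<subseteq> W'"
  shows "\<exists>C\<in>comps Z W'. T \<subseteq> C"
proof -
  obtain C where C: "C \<in> comps Z W" "T \<subseteq> C" using assms(1) by blast
  note h = comps_closed[OF assms(2) C(1)]
  obtain D where "D \<in> comps Z W'" "C \<subseteq> D"
    using connectedin_in_comps[OF h(2), of W'] h(3,4) assms(3) by blast
  then show ?thesis using C by blast
qed

lemma skel_mono: "A \<subseteq> A' \<Longrightarrow> skel A \<subseteq> skel A'" by (auto simp: skel_def)

text \<open>Every component of the skeleton contains a component of the boundary, for a point that was removed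
with a segment is connected by that segment to a corner.\<close>

lemma k_le_f:
  assumes A: "A \<subseteq> E" shows "k A \<le> f A"
proof -
  have meets: "\<exists>x. x \<in> C \<inter> bd A" if C: "C \<in> comps Z (skel A)" for C
  proof -
    note h = comps_closed[OF closed_skel[OF A] C]
    obtain x where x: "x \<in> C" using h(3) by blast
    have xs: "x \<in> skel A" using x h(4) by blast
    show ?thesis
    proof (cases "x \<in> bd A")
      case False
      then obtain e where e: "e \<in> A" "x \<in> segs e" using xs unfolding bd_def skel_def by blast
      then have eE: "e \<in> E" using A by blast
      have cor: "corners e \<subseteq> bd A" using e(1) corners_in[OF eE] unfolding bd_def by blast
      have sub: "segs e \<subseteq> skel A" using segments_sub[OF eE] unfolding skel_def by blast
      from e(2) obtain s p where s: "connectedin Z s" "x \<in> s" "p \<in> s" "p \<in> corners e" "s \<subseteq> segs e"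
        using arc_in_connected[OF arcs(1)[OF eE]] arc_in_connected[OF arcs(2)[OF eE]] corners_in[OF eE]
        by blast
      have "connectedin (subtopology Z (skel A)) s"
        using s(1,5) sub by (auto simp: connectedin_subtopology)
      then have "s \<subseteq> C"
        using connected_components_of_maximal[OF C] s(2) x by (auto simp: disjnt_def)
      then show ?thesis using s cor by blast
    qed (use x in blast)
  qed
  define g where "g D = (SOME C. C \<in> comps Z (skel A) \<and> D \<subseteq> C)" for D
  have gD: "g D \<in> comps Z (skel A) \<and> D \<subseteq> g D" if "D \<in> comps Z (bd A)" for D
  proof -
    note cl = circle_union_comps(4)[OF circle_union_bd[OF A]]
    have "\<exists>C\<in>comps Z (skel A). D \<subseteq> C"
      by (rule joined_mono[OF _ cl bd_sub_skel]) (use that in blast)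
    then have ex: "\<exists>C. C \<in> comps Z (skel A) \<and> D \<subseteq> C" by blast
    show ?thesis unfolding g_def using someI_ex[OF ex] .
  qed
  have "C \<in> g ` comps Z (bd A)" if C: "C \<in> comps Z (skel A)" for C
  proof -
    obtain x where x: "x \<in> C" "x \<in> bd A" using meets[OF C] by blast
    then obtain D where D: "D \<in> comps Z (bd A)" "x \<in> D"
      using circle_union_comps(3)[OF circle_union_bd[OF A]] by (metis UnionE)
    have "g D = C"
    proof (rule ccontr)
      assume "g D \<noteq> C"
      then have "g D \<inter> C = {}" by (rule comps_disjoint[OF conjunct1[OF gD[OF D(1)]] C])
      then show False using conjunct2[OF gD[OF D(1)]] D(2) x(1) by blast
    qed
    then show ?thesis using D by blast
  qed
  then have "comps Z (skel A) \<subseteq> g ` comps Z (bd A)" by blast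
  then have "card (comps Z (skel A)) \<le> card (comps Z (bd A))"
    using circle_union_comps(1)[OF circle_union_bd[OF A]] by (meson card_image_le card_mono finite_imageI order_trans)
  then show ?thesis by (simp add: k_def f_def ncomp_def)
qed

text \<open>The skeleton is the boundary together with the segments. Each segment runs from t1 to t2, so that if
the two sides of every edge lie on the same boundary circle, putting back the segments one by one
never fuses two circles.\<close>

lemma f_eq_k:
  assumes A: "A \<subseteq> E" and joined: "\<And>e. e \<in> A \<Longrightarrow> \<exists>C\<in>comps Z (bd A). sides e \<subseteq> C"
  shows "f A = k A"
proof -
  have finA: "finite A" using A finite_E finite_subset by blast
  define V where "V X = bd A \<union> (\<Union>e\<in>X. segs e)" for X
  have clV: "closedin Z (V X)" if "X \<subseteq> A" for X
    unfolding V_def using circle_union_comps(4)[OF circle_union_bd[OF A]] closed_segs that A finA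
    by (intro closedin_Un closedin_Union) (auto intro: finite_subset)
  have "finite (comps Z (V X)) \<and> ncomp Z (V X) = ncomp Z (bd A)" if "finite X" "X \<subseteq> A" for X
    using that
  proof (induction X)
    case empty
    show ?case using circle_union_comps(1)[OF circle_union_bd[OF A]] by (simp add: V_def)
  next
    case (insert e X)
    then have X: "X \<subseteq> A" "X \<subseteq> E" "e \<notin> X" and eA: "e \<in> A" and e: "e \<in> E" using A by auto
    have IH: "finite (comps Z (V X))" "ncomp Z (V X) = ncomp Z (bd A)" using insert.IH[OF X(1)] by auto
    have Ae: "A - {e} \<subseteq> E" "e \<notin> A - {e}" "insert e (A - {e}) = A" using A eA by auto
    have "\<exists>C\<in>comps Z (V X). sides e \<subseteq> C"
      by (rule joined_mono[OF joined[OF eA] circle_union_comps(4)[OF circle_union_bd[OF A]]]) (auto simp: V_def)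
    then obtain C where C: "C \<in> comps Z (V X)" "sides e \<subseteq> C" by blast
    have "segs e \<inter> V X = segs e \<inter> bd A"
      using disjoint_pieces(1)[OF e X(2,3)] unfolding V_def by blast
    also have "\<dots> = corners e" using segs_bd_insert[OF Ae(1) e Ae(2)] Ae(3) by simp
    finally have meet: "segs e \<inter> V X = corners e" .
    have corC: "p1 e \<in> C" "q1 e \<in> C" "p2 e \<in> C" "q2 e \<in> C" using C(2) corners_in[OF e] by blast+
    have cl: "closedin Z (s1 e)" "closedin Z (s2 e)" "connectedin Z (s1 e)" "connectedin Z (s2 e)"
      using arc_in_closedin[OF arcs(1)[OF e]] arc_in_closedin[OF arcs(2)[OF e]]
        arc_in_connected[OF arcs(1)[OF e]] arc_in_connected[OF arcs(2)[OF e]] .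
    have meetC: "segs e \<inter> V X \<subseteq> C" unfolding meet using corC by simp
    have "p1 e \<in> segs e \<inter> V X" "p2 e \<in> segs e \<inter> V X" unfolding meet by simp_all
    then have corV: "p1 e \<in> V X" "p2 e \<in> V X" by blast+
    have m1: "s1 e \<inter> V X \<subseteq> C" using meetC by blast
    have m1': "s1 e \<inter> V X \<noteq> {}" "s1 e \<noteq> {}" using corV corners_in(1)[OF e] by blast+
    note step1 = ncomp_attach_one[OF clV[OF X(1)] IH(1) cl(1,3) C(1) m1 m1'(1)]
    have fin1: "finite (comps Z (V X \<union> s1 e))"
      using comps_attach(1)[OF clV[OF X(1)] IH(1) cl(1,3) m1'(2)] IH(1) by simp
    have cl1: "closedin Z (V X \<union> s1 e)" using clV[OF X(1)] cl(1) by (rule closedin_Un)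
    have "\<exists>D\<in>comps Z (V X \<union> s1 e). C \<subseteq> D"
      by (rule joined_mono[OF _ clV[OF X(1)]]) (use C(1) in blast)+
    then obtain D where D: "D \<in> comps Z (V X \<union> s1 e)" "C \<subseteq> D" by blast
    have m2: "s2 e \<inter> (V X \<union> s1 e) \<subseteq> D" using meetC D(2) arcs(5)[OF e] by blast
    have m2': "s2 e \<inter> (V X \<union> s1 e) \<noteq> {}" "s2 e \<noteq> {}" using corV corners_in(3)[OF e] by blast+
    note step2 = ncomp_attach_one[OF cl1 fin1 cl(2,4) D(1) m2 m2'(1)]
    have fin2: "finite (comps Z (V X \<union> s1 e \<union> s2 e))"
      using comps_attach(1)[OF cl1 fin1 cl(2,4) m2'(2)] fin1 by simp
    have "V (insert e X) = V X \<union> s1 e \<union> s2 e" by (auto simp: V_def)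
    then show ?case using step1 step2 fin2 IH(2) by simp
  qed
  from this[OF finA order_refl] have "ncomp Z (V A) = f A" by (simp add: f_def)
  moreover have "V A = skel A"
    unfolding V_def bd_def skel_def using segments_sub A by blast
  ultimately show ?thesis by (simp add: k_def)
qed

lemma face_component_system: "face_component_system E f k"
proof
  show "finite E" by (rule finite_E)
  show "f {} = k {}" by (simp add: f_def k_def)
next
  fix A e assume "A \<subseteq> E" "e \<in> E - A"
  then have h: "A \<subseteq> E" "e \<in> E" "e \<notin> A" by auto
  show "k (insert e A) = k A \<or> Suc (k (insert e A)) = k A" using k_insert[OF h] by blast
  show "f (insert e A) \<le> Suc (f A) \<and> f A \<le> Suc (f (insert e A))" using f_insert[OF h] by fastforce
  assume b: "Suc (k (insert e A)) = k A"
  then have "\<not> (\<exists>C\<in>comps Z (skel A). segs e \<subseteq> C)" using k_insert(1)[OF h] by auto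
  then have "\<not> (\<exists>C\<in>comps Z (bd A). segs e \<subseteq> C)"
    using joined_mono[OF _ circle_union_comps(4)[OF circle_union_bd[OF h(1)]] bd_sub_skel] by blast
  then show "Suc (f (insert e A)) = f A" by (rule f_insert(2)[OF h])
next
  fix A A' e assume a: "A \<subseteq> A'" "A' \<subseteq> E" "e \<in> E - A'" "k (insert e A) = k A"
  then have h: "A \<subseteq> E" "e \<in> E" "e \<notin> A" "e \<notin> A'" by auto
  have "\<exists>C\<in>comps Z (skel A). segs e \<subseteq> C" using k_insert(2)[OF h(1-3)] a(4) by auto
  then have "\<exists>C\<in>comps Z (skel A'). segs e \<subseteq> C"
    by (rule joined_mono[OF _ closed_skel[OF h(1)] skel_mono[OF a(1)]])
  then show "k (insert e A') = k A'" by (rule k_insert(1)[OF a(2) h(2,4)])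
next
  fix A assume A: "A \<subseteq> E"
  show "k A \<le> f A" by (rule k_le_f[OF A])
  assume "k A < f A"
  then obtain e where e: "e \<in> A" "\<not> (\<exists>C\<in>comps Z (bd A). sides e \<subseteq> C)"
    using f_eq_k[OF A] by fastforce
  have h: "A - {e} \<subseteq> E" "e \<in> E" "e \<notin> A - {e}" "insert e (A - {e}) = A" using A e by auto
  show "\<exists>e\<in>A. Suc (f (A - {e})) = f A"
    using f_remove[OF h(1-3)] e h(4) by auto
qed

end

section \<open>The boundary of a surface made of discs\<close>

lemma homeomorphic_imp_homeomorphic_space:
  "S homeomorphic T \<Longrightarrow> top_of_set S homeomorphic_space top_of_set T"
proof -
  assume "S homeomorphic T"
  then obtain f g where "homeomorphism S T f g" unfolding homeomorphic_def by blast
  then have "homeomorphic_maps (top_of_set S) (top_of_set T) f g"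
    unfolding homeomorphism_def homeomorphic_maps_def continuous_map_in_subtopology by auto
  then show ?thesis unfolding homeomorphic_space_def by blast
qed

lemma closed_embedding_homeomorphic_space:
  assumes g: "closed_embedding (top_of_set S) Y g" and T: "T \<subseteq> S"
  shows "top_of_set T homeomorphic_space subtopology Y (g ` T)"
proof -
  have "homeomorphic_map (top_of_set S) (subtopology Y (g ` S)) g"
    using closed_embedding_homeomorphic_map[OF g] by simp
  moreover have "g ` S \<subseteq> topspace Y"
    using g by (auto simp: closed_embedding_def continuous_map_def)
  then have "g ` (topspace (top_of_set S) \<inter> T) = topspace (subtopology Y (g ` S)) \<inter> g ` T"
    using T by (auto simp: Int_absorb1)
  ultimately have "homeomorphic_map (subtopology (top_of_set S) T) (subtopology (subtopology Y (g ` S)) (g ` T)) g"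
    by (rule homeomorphic_map_subtopologies)
  moreover have "subtopology (subtopology Y (g ` S)) (g ` T) = subtopology Y (g ` T)"
    using T by (simp add: subtopology_subtopology Int_absorb1 image_mono)
  moreover have "subtopology (top_of_set S) T = top_of_set T"
    using T by (simp add: subtopology_subtopology Int_absorb1)
  ultimately show ?thesis using homeomorphic_map_imp_homeomorphic_space by metis
qed

lemma closed_embedding_complement:
  assumes g: "closed_embedding (top_of_set S) Y g" and T: "closedin (top_of_set S) (S - T)" "T \<subseteq> S"
  shows "closedin Y (g ` S - g ` T)"
proof -
  have "g ` S - g ` T = g ` (S - T)"
    using g T by (simp add: closed_embedding_def inj_on_image_set_diff[where C=S])
  then show ?thesis using closed_embedding_closedin[OF g T(1)] by simp
qed

text \<open>In this lemma and the next, Y is a closed disc together with a closed remainder R. Here R meets the disc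
only along the rim, so that the open disc is open in Y.\<close>

lemma inner_point_not_boundary:
  assumes h: "disc_map Y h"
    and R: "closedin Y R" "topspace Y = h ` cball 0 1 \<union> R" "R \<inter> h ` cball 0 1 \<subseteq> h ` sphere 0 1"
    and z: "norm z < 1"
  shows "h z \<notin> surface_boundary Y"
proof -
  let ?U = "h ` ball 0 1"
  have inj: "inj_on h (cball 0 1)" using h by (simp add: closed_embedding_def)
  have eq: "h ` cball 0 1 - h ` ball 0 1 = h ` sphere 0 1"
  proof -
    have "h ` cball 0 1 - h ` ball 0 1 = h ` (cball 0 1 - ball 0 1)"
      using inj by (intro inj_on_image_set_diff[symmetric, where C="cball 0 1"]) auto
    also have "cball 0 1 - ball 0 1 = sphere (0::complex) 1" by auto
    finally show ?thesis .
  qed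
  have "closedin Y (h ` sphere 0 1)"
    by (rule closed_embedding_closedin[OF h]) (auto intro: closed_subset)
  then have cl: "closedin Y (R \<union> h ` sphere 0 1)" using R(1) by (intro closedin_Un)
  have "?U = topspace Y - (R \<union> h ` sphere 0 1)"
  proof -
    have "?U \<inter> h ` sphere 0 1 = {}" "?U \<subseteq> h ` cball 0 1" using eq by auto
    moreover from this have "?U \<inter> R = {}" using R(3) by blast
    ultimately show ?thesis unfolding R(2) using eq by blast
  qed
  then have "openin Y ?U" using openin_diff[OF openin_topspace cl] by simp
  moreover have "subtopology Y ?U homeomorphic_space (euclidean :: complex topology)"
  proof -
    have "top_of_set (ball (0::complex) 1) homeomorphic_space subtopology Y ?U"
      by (rule closed_embedding_homeomorphic_space[OF h]) auto
    moreover have "top_of_set (ball (0::complex) 1) homeomorphic_space top_of_set (UNIV :: complex set)"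
      by (intro homeomorphic_imp_homeomorphic_space homeomorphic_ball_UNIV) simp
    ultimately show ?thesis
      by (metis homeomorphic_space_sym homeomorphic_space_trans subtopology_UNIV)
  qed
  moreover have "h z \<in> ?U" using z by simp
  ultimately show ?thesis unfolding surface_boundary_def by blast
qed

text \<open>If a rim point away from R had a plane neighbourhood, then, shrinking it to avoid R and pulling it back
to the closed unit disc, one would get an open subset of the plane inside the closed disc, by
invariance of domain, which contains a point of the unit circle.\<close>

lemma rim_point_in_boundary:
  assumes h: "disc_map Y h"
    and R: "closedin Y R" "topspace Y = h ` cball 0 1 \<union> R"
    and z: "z \<in> sphere 0 1" "h z \<notin> R"
  shows "h z \<in> surface_boundary Y"
proof -
  have False if U: "openin Y U" "h z \<in> U"
    and hom: "subtopology Y U homeomorphic_space (euclidean :: complex topology)" for U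
  proof -
    obtain \<phi> where "homeomorphic_map (euclidean :: complex topology) (subtopology Y U) \<phi>"
      using hom homeomorphic_space_sym homeomorphic_space by metis
    then have \<phi>: "continuous_map euclidean (subtopology Y U) \<phi>" "inj \<phi>" "range \<phi> = topspace (subtopology Y U)"
      by (simp_all add: homeomorphic_eq_everything_map)
    then have \<phi>Y: "continuous_map euclidean Y \<phi>" by (simp add: continuous_map_in_subtopology)
    define W where "W = {w. \<phi> w \<in> topspace Y - R}"
    have "openin Y (topspace Y - R)" using R(1) by (simp add: closedin_def)
    then have "openin euclidean {w \<in> topspace euclidean. \<phi> w \<in> topspace Y - R}"
      using \<phi>Y openin_continuous_map_preimage by blast
    then have W: "open W" by (simp add: W_def)
    have hom': "homeomorphic_map (top_of_set (cball 0 1)) (subtopology Y (h ` cball 0 1)) h"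
      using closed_embedding_homeomorphic_map[OF h] by simp
    then obtain g where g: "continuous_map (subtopology Y (h ` cball 0 1)) (top_of_set (cball 0 1)) g"
      "\<And>x. x \<in> cball 0 1 \<Longrightarrow> g (h x) = x"
      unfolding homeomorphic_map_maps homeomorphic_maps_def by auto
    have W_in: "\<phi> w \<in> h ` cball 0 1" if "w \<in> W" for w using that R(2) by (auto simp: W_def)
    have "continuous_map (top_of_set W) (subtopology Y (h ` cball 0 1)) \<phi>"
      using \<phi>Y W_in by (auto simp: continuous_map_in_subtopology intro: continuous_map_from_subtopology)
    then have "continuous_map (top_of_set W) (top_of_set (cball 0 1)) (g \<circ> \<phi>)"
      using g(1) continuous_map_compose by blast
    then have gc: "continuous_on W (g \<circ> \<phi>)" "(g \<circ> \<phi>) ` W \<subseteq> cball 0 1"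
      by (auto simp: continuous_map_in_subtopology)
    have "inj_on (g \<circ> \<phi>) W"
    proof (rule inj_onI)
      fix v w assume vw: "v \<in> W" "w \<in> W" "(g \<circ> \<phi>) v = (g \<circ> \<phi>) w"
      obtain x y where "\<phi> v = h x" "\<phi> w = h y" "x \<in> cball 0 1" "y \<in> cball 0 1"
        using W_in vw(1,2) by blast
      then have "\<phi> v = \<phi> w" using vw(3) g(2) by simp
      then show "v = w" using \<phi>(2) by (simp add: inj_eq)
    qed
    then have "open ((g \<circ> \<phi>) ` W)" using invariance_of_domain gc(1) W by blast
    then have "(g \<circ> \<phi>) ` W \<subseteq> interior (cball 0 1)" using gc(2) by (rule interior_maximal[rotated])
    then have sub: "(g \<circ> \<phi>) ` W \<subseteq> ball 0 1" by simp
    have "h z \<in> topspace Y" using U openin_subset by blast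
    then obtain w where w: "h z = \<phi> w" using U(2) \<phi>(3) by (metis IntI imageE topspace_subtopology)
    then have "w \<in> W" using \<open>h z \<in> topspace Y\<close> z(2) by (simp add: W_def)
    moreover have "g (\<phi> w) = z" using g(2)[of z] z(1) w by simp
    ultimately have "z \<in> ball 0 1" using sub by force
    then show False using z(1) by simp
  qed
  moreover have "h z \<in> topspace Y" using R(2) z(1) by auto
  ultimately show ?thesis unfolding surface_boundary_def by blast
qed

lemma rim_circle:
  assumes h: "disc_map Y h"
  shows "circle_in Y (h ` sphere 0 1)"
proof -
  have "circle_map Y (h \<circ> (\<lambda>z. z))"
    by (rule closed_embedding_precompose[OF h]) (auto intro: continuous_on_id)
  then show ?thesis unfolding circle_in_def by (auto simp: o_def)
qed

text \<open>An arc on the rim of a disc is an edge of a rectangle in the disc: the point with coordinates t and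
y is obtained by moving the point of the arc with parameter t towards the centre by the absolute value of y. The sign sg
selects on which side of the real axis the rectangle is put, so that the collars in two discs
sharing the arc fit together.\<close>

lemma collar:
  fixes sg :: real
  assumes h: "disc_map Y h"
    and \<sigma>: "arc_map Y \<sigma>" "\<sigma> ` {0..1} \<subseteq> h ` sphere 0 1"
    and sg: "sg = 1 \<or> sg = -1"
  defines "Q \<equiv> {w. 0 \<le> Re w \<and> Re w \<le> 1 \<and> 0 \<le> sg * Im w \<and> sg * Im w \<le> 1/2}"
    and "Q' \<equiv> {w. 0 < Re w \<and> Re w < 1 \<and> 0 \<le> sg * Im w \<and> sg * Im w < 1/2}"
  obtains H where "closed_embedding (top_of_set Q) Y H" "H ` Q \<subseteq> h ` cball 0 1"
    "\<And>w. w \<in> Q \<Longrightarrow> Im w = 0 \<Longrightarrow> H w = \<sigma> (Re w)"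
    "\<And>w. w \<in> Q \<Longrightarrow> H w \<in> h ` sphere 0 1 \<Longrightarrow> Im w = 0"
    "closedin Y (h ` cball 0 1 - H ` Q')"
    "\<And>w. w \<in> Q' \<Longrightarrow> H w \<in> h ` sphere 0 1 \<Longrightarrow> H w \<in> \<sigma> ` {0<..<1}"
    "\<sigma> ` {0<..<1} \<subseteq> H ` Q'"
proof -
  have hinj: "inj_on h (cball 0 1)" using h by (simp add: closed_embedding_def)
  have "homeomorphic_map (top_of_set (cball 0 1)) (subtopology Y (h ` cball 0 1)) h"
    using closed_embedding_homeomorphic_map[OF h] by simp
  then obtain g where g: "continuous_map (subtopology Y (h ` cball 0 1)) (top_of_set (cball 0 1)) g"
    "\<And>x. x \<in> cball 0 1 \<Longrightarrow> g (h x) = x"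
    unfolding homeomorphic_map_maps homeomorphic_maps_def by auto
  define a where "a = g \<circ> \<sigma>"
  have \<sigma>h: "\<exists>z\<in>sphere 0 1. \<sigma> t = h z" if "t \<in> {0..1}" for t
    using that \<sigma>(2) by blast
  have ha: "h (a t) = \<sigma> t" "a t \<in> sphere 0 1" if "t \<in> {0..1}" for t
    using \<sigma>h[OF that] g(2) unfolding a_def by force+
  have "continuous_map (top_of_set {0..1}) (subtopology Y (h ` cball 0 1)) \<sigma>"
    using \<sigma> by (auto simp: closed_embedding_def continuous_map_in_subtopology)
  then have "continuous_map (top_of_set {0..1}) (top_of_set (cball 0 1)) a"
    using g(1) continuous_map_compose unfolding a_def by blast
  then have ac: "continuous_on {0..1} a" by (simp add: continuous_map_in_subtopology)
  have ainj: "inj_on a {0..1}"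
  proof (rule inj_onI)
    fix s t :: real assume st: "s \<in> {0..1}" "t \<in> {0..1}" "a s = a t"
    then have "\<sigma> s = \<sigma> t" using ha by metis
    then show "s = t" using \<sigma>(1) st by (auto simp: closed_embedding_def dest: inj_onD)
  qed
  define \<alpha> where "\<alpha> w = (1 - sg * Im w) *\<^sub>R a (Re w)" for w
  have Qre: "Re w \<in> {0..1}" if "w \<in> Q" for w using that by (simp add: Q_def)
  have norm\<alpha>: "norm (\<alpha> w) = 1 - sg * Im w" if "w \<in> Q" for w
  proof -
    have "norm (a (Re w)) = 1" using ha(2)[OF Qre[OF that]] by simp
    then show ?thesis using that unfolding \<alpha>_def norm_scaleR by (simp add: Q_def)
  qed
  have \<alpha>c: "continuous_on Q \<alpha>"
    unfolding \<alpha>_def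
    by (intro continuous_intros continuous_on_compose2[OF ac]) (auto simp: Qre[simplified])
  have \<alpha>i: "inj_on \<alpha> Q"
  proof (rule inj_onI)
    fix v w assume vw: "v \<in> Q" "w \<in> Q" "\<alpha> v = \<alpha> w"
    have im: "sg * Im v = sg * Im w" using norm\<alpha> vw by (metis diff_left_imp_eq)
    moreover have "1 - sg * Im w \<noteq> 0" using vw(2) by (simp add: Q_def)
    ultimately have "a (Re v) = a (Re w)" using vw(3) unfolding \<alpha>_def
      by (metis scaleR_cancel_left)
    then have "Re v = Re w" using ainj Qre vw(1,2) by (meson inj_onD)
    moreover have "Im v = Im w" using im sg by auto
    ultimately show "v = w" by (simp add: complex_eq_iff)
  qed
  have \<alpha>Q: "\<alpha> ` Q \<subseteq> cball 0 1"
    using norm\<alpha> by (auto simp: Q_def)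
  have Qcpt: "compact Q"
  proof -
    have "Q = cbox (Complex 0 (min 0 (sg/2))) (Complex 1 (max 0 (sg/2)))"
      unfolding Q_def using sg by (auto simp: in_cbox_complex_iff)
    then show ?thesis by (simp add: compact_cbox)
  qed
  define H where "H = h \<circ> \<alpha>"
  have HQ: "closed_embedding (top_of_set Q) Y H"
    unfolding H_def by (rule closed_embedding_precompose[OF h Qcpt \<alpha>c \<alpha>i \<alpha>Q])
  have Hsub: "H ` Q \<subseteq> h ` cball 0 1" using \<alpha>Q by (auto simp: H_def)
  have H0: "H w = \<sigma> (Re w)" if "w \<in> Q" "Im w = 0" for w
    using that ha(1)[OF Qre[OF that(1)]] by (simp add: H_def \<alpha>_def)
  have Hrim: "Im w = 0" if w: "w \<in> Q" "H w \<in> h ` sphere 0 1" for w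
  proof -
    obtain z where z: "z \<in> sphere 0 1" "h (\<alpha> w) = h z" using w(2) by (auto simp: H_def)
    moreover have "\<alpha> w \<in> cball 0 1" using \<alpha>Q w(1) by blast
    ultimately have "\<alpha> w = z" using hinj by (auto dest: inj_onD)
    then have "sg * Im w = 0" using norm\<alpha>[OF w(1)] z(1) by simp
    then show ?thesis using sg by auto
  qed
  \<comment> \<open>the collar is cut out of the disc by a condition on the modulus and one on the argument\<close>
  have arc: "arc_in (top_of_set (sphere 0 1)) (a ` {0..1}) (a 0) (a 1)"
    using ac ainj ha(2) by (intro arc_inI closed_embedding_compact) auto
  have circ: "circle_in (top_of_set (sphere 0 1)) (sphere 0 1 :: complex set)"
    unfolding circle_in_def
    by (intro exI[of _ "\<lambda>z. z"] conjI closed_embedding_compact) (auto intro: continuous_on_id)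
  define P where "P = a ` {0<..<1}"
  have Peq: "P = a ` {0..1} - {a 0, a 1}"
  proof -
    have "{0<..<1::real} = {0..1} - {0,1}" by auto
    then show ?thesis unfolding P_def using ainj by (simp add: inj_on_image_set_diff[where C="{0..1}"])
  qed
  have "closedin (top_of_set (sphere 0 1)) (sphere 0 1 - P)"
  proof -
    have "a ` {0..1} \<subseteq> sphere 0 1" using ha(2) by blast
    from arc_in_closedin[OF circle_diff_arc[OF circ arc this]] show ?thesis unfolding Peq .
  qed
  then have clP: "closed (sphere 0 1 - P)" by (meson closed_sphere closedin_closed_trans)
  have \<alpha>Q': "\<alpha> ` Q' = {z \<in> cball 0 1. 1/2 < norm z \<and> sgn z \<in> P}"
  proof (intro set_eqI iffI)
    fix z assume "z \<in> \<alpha> ` Q'"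
    then obtain w where w: "w \<in> Q'" "z = \<alpha> w" by blast
    then have wQ: "w \<in> Q" by (auto simp: Q_def Q'_def)
    have n: "norm z = 1 - sg * Im w" using norm\<alpha>[OF wQ] w(2) by simp
    then have "norm z \<le> 1" "1/2 < norm z" using w(1) by (auto simp: Q'_def)
    moreover have "sgn z = a (Re w)"
    proof -
      have "1 - sg * Im w > 0" using w(1) by (auto simp: Q'_def)
      then have "sgn z = sgn (a (Re w))" by (simp add: w(2) \<alpha>_def sgn_scaleR)
      also have "\<dots> = a (Re w)" using ha(2)[OF Qre[OF wQ]] by (simp add: sgn_div_norm)
      finally show ?thesis .
    qed
    ultimately show "z \<in> {z \<in> cball 0 1. 1/2 < norm z \<and> sgn z \<in> P}"
      using w(1) by (simp add: P_def Q'_def)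
  next
    fix z assume "z \<in> {z \<in> cball 0 1. 1/2 < norm z \<and> sgn z \<in> P}"
    then have z: "norm z \<le> 1" "1/2 < norm z" "sgn z \<in> P" by auto
    then obtain t where t: "t \<in> {0<..<1}" "sgn z = a t" by (auto simp: P_def)
    define w where "w = Complex t (sg * (1 - norm z))"
    have s2: "sg * (sg * x) = x" for x using sg by auto
    have "w \<in> Q'" using t(1) z by (simp add: Q'_def w_def s2)
    moreover have "\<alpha> w = z"
    proof -
      have "z \<noteq> 0" using z(2) by auto
      then have "norm z *\<^sub>R sgn z = z" by (simp add: sgn_div_norm)
      then show ?thesis using t(2) by (simp add: \<alpha>_def w_def s2)
    qed
    ultimately show "z \<in> \<alpha> ` Q'" by blast
  qed
  have comp: "cball 0 1 - \<alpha> ` Q' =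
      cball 0 (1/2) \<union> {z \<in> cball 0 1 - ball 0 (1/2). sgn z \<in> sphere 0 1 - P}"
  proof (intro set_eqI)
    fix z :: complex
    have "1/2 \<le> norm z \<Longrightarrow> norm (sgn z) = 1" by (auto simp: norm_sgn)
    then show "z \<in> cball 0 1 - \<alpha> ` Q' \<longleftrightarrow>
      z \<in> cball 0 (1/2) \<union> {z \<in> cball 0 1 - ball 0 (1/2). sgn z \<in> sphere 0 1 - P}"
      unfolding \<alpha>Q' by (auto simp: not_less)
  qed
  have "closed {z \<in> cball 0 1 - ball 0 (1/2). (sgn z :: complex) \<in> sphere 0 1 - P}"
  proof -
    have "continuous_on (cball 0 1 - ball 0 (1/2)) (sgn :: complex \<Rightarrow> complex)"
      by (intro continuous_on_sgn continuous_on_id) auto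
    from continuous_closed_preimage[OF this _ clP] show ?thesis
      by (simp add: closed_Diff vimage_def Int_def)
  qed
  then have "closed (cball 0 1 - \<alpha> ` Q')" unfolding comp by (intro closed_Un) auto
  then have "closedin (top_of_set (cball 0 1)) (cball 0 1 - \<alpha> ` Q')" by (auto intro: closed_subset)
  moreover have "\<alpha> ` Q' \<subseteq> cball 0 1" unfolding \<alpha>Q' by auto
  ultimately have "closedin Y (h ` cball 0 1 - h ` \<alpha> ` Q')" by (rule closed_embedding_complement[OF h])
  then have cl: "closedin Y (h ` cball 0 1 - H ` Q')" by (simp add: H_def image_comp)
  have mid: "H w \<in> \<sigma> ` {0<..<1}" if w: "w \<in> Q'" "H w \<in> h ` sphere 0 1" for w
  proof -
    have "w \<in> Q" "Re w \<in> {0<..<1}" using w(1) by (auto simp: Q_def Q'_def)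
    moreover from this have "H w = \<sigma> (Re w)" using H0 Hrim[OF _ w(2)] by blast
    ultimately show ?thesis by blast
  qed
  have all: "\<sigma> ` {0<..<1} \<subseteq> H ` Q'"
  proof
    fix y assume "y \<in> \<sigma> ` {0<..<1}"
    then obtain t where t: "t \<in> {0<..<1}" "y = \<sigma> t" by blast
    then have Q: "complex_of_real t \<in> Q" "complex_of_real t \<in> Q'" by (auto simp: Q_def Q'_def)
    have "H (of_real t) = y" using H0[OF Q(1)] t(2) by simp
    then show "y \<in> H ` Q'" using Q(2) by blast
  qed
  from HQ Hsub H0 Hrim cl mid all show ?thesis by (rule that)
qed

text \<open>The collars in the two discs are glued along the common arc to an open rectangle. The remainder R may
contain further points common to both discs, such as the other segment if both segments of an edge lie
on the same vertex.\<close>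

lemma shared_arc_not_boundary:
  assumes h: "disc_map Y h" 
    and h': "disc_map Y h'"
    and R: "closedin Y R" "topspace Y = h ` cball 0 1 \<union> h' ` cball 0 1 \<union> R"
      "R \<inter> h ` cball 0 1 \<subseteq> h ` sphere 0 1" "R \<inter> h' ` cball 0 1 \<subseteq> h' ` sphere 0 1"
    and s: "arc_in Y s p q" "s \<subseteq> h ` sphere 0 1" "s \<subseteq> h' ` sphere 0 1"
      "h ` cball 0 1 \<inter> h' ` cball 0 1 \<subseteq> s \<union> R" "(s - {p,q}) \<inter> R = {}"
    and x: "x \<in> s - {p,q}"
  shows "x \<notin> surface_boundary Y"
proof -
  let ?D = "h ` cball 0 1" and ?D' = "h' ` cball 0 1"
  obtain \<sigma> where \<sigma>: "arc_map Y \<sigma>" "s = \<sigma> ` {0..1}" "\<sigma> 0 = p" "\<sigma> 1 = q"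
    using arc_inE[OF s(1)] .
  have \<sigma>inj: "inj_on \<sigma> {0..1}" using \<sigma>(1) by (simp add: closed_embedding_def)
  define Q1 where "Q1 = {w. 0 \<le> Re w \<and> Re w \<le> 1 \<and> 0 \<le> 1 * Im w \<and> 1 * Im w \<le> 1/2}"
  define Q1' where "Q1' = {w. 0 < Re w \<and> Re w < 1 \<and> 0 \<le> 1 * Im w \<and> 1 * Im w < 1/2}"
  define Q2 where "Q2 = {w. 0 \<le> Re w \<and> Re w \<le> 1 \<and> 0 \<le> -1 * Im w \<and> -1 * Im w \<le> 1/2}"
  define Q2' where "Q2' = {w. 0 < Re w \<and> Re w < 1 \<and> 0 \<le> -1 * Im w \<and> -1 * Im w < 1/2}"
  obtain H where H: "closed_embedding (top_of_set Q1) Y H" "H ` Q1 \<subseteq> ?D"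
    "\<And>w. w \<in> Q1 \<Longrightarrow> Im w = 0 \<Longrightarrow> H w = \<sigma> (Re w)"
    "\<And>w. w \<in> Q1 \<Longrightarrow> H w \<in> h ` sphere 0 1 \<Longrightarrow> Im w = 0"
    "closedin Y (?D - H ` Q1')"
    "\<And>w. w \<in> Q1' \<Longrightarrow> H w \<in> h ` sphere 0 1 \<Longrightarrow> H w \<in> \<sigma> ` {0<..<1}" "\<sigma> ` {0<..<1} \<subseteq> H ` Q1'"
    using collar[OF h \<sigma>(1) s(2)[unfolded \<sigma>(2)], of 1, folded Q1_def Q1'_def] by blast
  obtain H' where H': "closed_embedding (top_of_set Q2) Y H'" "H' ` Q2 \<subseteq> ?D'"
    "\<And>w. w \<in> Q2 \<Longrightarrow> Im w = 0 \<Longrightarrow> H' w = \<sigma> (Re w)"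
    "\<And>w. w \<in> Q2 \<Longrightarrow> H' w \<in> h' ` sphere 0 1 \<Longrightarrow> Im w = 0"
    "closedin Y (?D' - H' ` Q2')"
    "\<And>w. w \<in> Q2' \<Longrightarrow> H' w \<in> h' ` sphere 0 1 \<Longrightarrow> H' w \<in> \<sigma> ` {0<..<1}" "\<sigma> ` {0<..<1} \<subseteq> H' ` Q2'"
    using collar[OF h' \<sigma>(1) s(3)[unfolded \<sigma>(2)], of "-1", folded Q2_def Q2'_def] by blast
  have sub: "Q1' \<subseteq> Q1" "Q2' \<subseteq> Q2" by (auto simp: Q1_def Q1'_def Q2_def Q2'_def)
  have cl: "closed Q1" "closed Q2"
  proof -
    have "Q1 = cbox 0 (Complex 1 (1/2))" "Q2 = cbox (Complex 0 (-1/2)) 1"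
      by (auto simp: Q1_def Q2_def in_cbox_complex_iff)
    then show "closed Q1" "closed Q2" by (simp_all add: closed_cbox)
  qed
  have meet0: "Im w = 0 \<and> Im v = 0" if "w \<in> Q1" "v \<in> Q2" "H w = H' v" for w v
  proof -
    have D: "H w \<in> ?D" "H' v \<in> ?D'" using H(2) H'(2) that by blast+
    then have "H w \<in> s \<union> R" using s(4) that(3) by auto
    then have "H w \<in> h ` sphere 0 1" "H' v \<in> h' ` sphere 0 1"
      using D s(2,3) R(3,4) that(3) by auto
    then show ?thesis using H(4) H'(4) that(1,2) by blast
  qed
  have meet: "\<forall>w\<in>Q1. \<forall>v\<in>Q2. H w = H' v \<longrightarrow> w = v"
  proof (intro ballI impI)
    fix w v assume wv: "w \<in> Q1" "v \<in> Q2" "H w = H' v"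
    note i = meet0[OF wv]
    then have "\<sigma> (Re w) = \<sigma> (Re v)" using H(3)[OF wv(1)] H'(3)[OF wv(2)] wv(3) by simp
    moreover have "Re w \<in> {0..1}" "Re v \<in> {0..1}" using wv by (auto simp: Q1_def Q2_def)
    ultimately have "Re w = Re v" using \<sigma>inj by (auto dest: inj_onD)
    then show "w = v" using i by (simp add: complex_eq_iff)
  qed
  have agree: "\<forall>w\<in>Q1 \<inter> Q2. H w = H' w"
    using H(3) H'(3) by (auto simp: Q1_def Q2_def)
  define \<Phi> where "\<Phi> = (\<lambda>w. if w \<in> Q1 then H w else H' w)"
  have \<Phi>: "closed_embedding (top_of_set (Q1 \<union> Q2)) Y \<Phi>"
    unfolding \<Phi>_def by (rule closed_embedding_glue(1)[OF H(1) H'(1) cl agree meet])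
  have \<Phi>2: "\<Phi> w = H' w" if "w \<in> Q2" for w using that agree by (auto simp: \<Phi>_def)
  define U where "U = \<Phi> ` (Q1' \<union> Q2')"
  have "\<Phi> ` Q1' = H ` Q1'" using sub(1) by (intro image_cong) (auto simp: \<Phi>_def)
  moreover have "\<Phi> ` Q2' = H' ` Q2'" using sub(2) \<Phi>2 by (intro image_cong) auto
  ultimately have UN: "U = H ` Q1' \<union> H' ` Q2'" by (simp add: U_def image_Un)
  have si: "\<sigma> ` {0<..<1} = s - {p,q}"
  proof -
    have "{0<..<1::real} = {0..1} - {0,1}" by auto
    then show ?thesis using \<sigma>(2-4) \<sigma>inj by (simp add: inj_on_image_set_diff[where C="{0..1}"])
  qed
  note inner = H(6)[unfolded si] and inner' = H'(6)[unfolded si]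
  have arcU: "y \<in> H ` Q1' \<and> y \<in> H' ` Q2'" if y: "y \<in> s - {p,q}" for y
    using y H(7) H'(7) unfolding si by blast
  \<comment> \<open>the two collars form an open set, because they meet the rest of the space nowhere\<close>
  define K where "K = R \<union> ((?D - H ` Q1') \<union> (?D' - H' ` Q2'))"
  have K: "closedin Y K" unfolding K_def using R(1) H(5) H'(5) by (intro closedin_Un)
  have UsD: "H ` Q1' \<subseteq> ?D" "H' ` Q2' \<subseteq> ?D'" using sub H(2) H'(2) by blast+
  have "U \<inter> K = {}"
  proof -
    have "H w \<notin> K" if w: "w \<in> Q1'" for w
    proof
      assume "H w \<in> K"
      then have "H w \<in> R \<or> H w \<in> ?D' - H' ` Q2'" using w by (auto simp: K_def)
      then have m: "H w \<in> s \<union> R" using s(4) UsD(1) w by blast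
      then have "H w \<in> h ` sphere 0 1" using s(2) R(3) UsD(1) w by blast
      then have "H w \<in> s - {p,q}" using inner[OF w] by blast
      then show False using arcU s(5) \<open>H w \<in> R \<or> H w \<in> ?D' - H' ` Q2'\<close> by blast
    qed
    moreover have "H' w \<notin> K" if w: "w \<in> Q2'" for w
    proof
      assume "H' w \<in> K"
      then have "H' w \<in> R \<or> H' w \<in> ?D - H ` Q1'" using w by (auto simp: K_def)
      then have m: "H' w \<in> s \<union> R" using s(4) UsD(2) w by blast
      then have "H' w \<in> h' ` sphere 0 1" using s(3) R(4) UsD(2) w by blast
      then have "H' w \<in> s - {p,q}" using inner'[OF w] by blast
      then show False using arcU s(5) \<open>H' w \<in> R \<or> H' w \<in> ?D - H ` Q1'\<close> by blast
    qed
    ultimately show ?thesis unfolding UN by blast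
  qed
  then have "U = topspace Y - K" unfolding R(2) using UsD unfolding UN K_def by blast
  then have "openin Y U" using openin_diff[OF openin_topspace K] by simp
  moreover have "subtopology Y U homeomorphic_space (euclidean :: complex topology)"
  proof -
    let ?B = "box (Complex 0 (-1/2)) (Complex 1 (1/2))"
    have eq: "Q1' \<union> Q2' = ?B" by (auto simp: Q1'_def Q2'_def in_box_complex_iff)
    have "top_of_set (Q1' \<union> Q2') homeomorphic_space subtopology Y U"
      unfolding U_def by (rule closed_embedding_homeomorphic_space[OF \<Phi>]) (use sub in blast)
    moreover have "Complex (1/2) 0 \<in> ?B" by (simp add: in_box_complex_iff)
    then have "?B homeomorphic (UNIV :: complex set)" by (intro homeomorphic_box_UNIV) blast
    then have "top_of_set (Q1' \<union> Q2') homeomorphic_space (euclidean :: complex topology)"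
      using homeomorphic_imp_homeomorphic_space eq by fastforce
    ultimately show ?thesis using homeomorphic_space_sym homeomorphic_space_trans by blast
  qed
  moreover have "x \<in> U" using arcU[OF x] UN by blast
  ultimately show ?thesis unfolding surface_boundary_def by blast
qed

section \<open>Surfaces assembled from vertex and edge discs\<close>

definition disc_with_rim :: "'a topology \<Rightarrow> 'a set \<Rightarrow> 'a set \<Rightarrow> bool" where
  "disc_with_rim Z D c \<longleftrightarrow>
     (\<exists>h. disc_map Z h \<and> D = h ` cball 0 1 \<and> c = h ` sphere 0 1)"

lemma disc_with_rimE:
  assumes "disc_with_rim Z D c"
  obtains h where "disc_map Z h" "D = h ` cball 0 1" "c = h ` sphere 0 1"
  using assms unfolding disc_with_rim_def by blast

lemma disc_with_rim_props:
  assumes "disc_with_rim Z D c"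
  shows "closedin Z D" "connectedin Z D" "circle_in Z c" "c \<subseteq> D"
proof -
  obtain h where h: "disc_map Z h" "D = h ` cball 0 1" "c = h ` sphere 0 1"
    using disc_with_rimE[OF assms] .
  show "closedin Z D" unfolding h(2) by (rule closed_embedding_closedin[OF h(1)]) (metis closedin_topspace topspace_euclidean_subtopology)
  show "connectedin Z D" unfolding h(2)
    by (rule connectedin_image_closed_embedding[OF h(1)]) (auto simp: convex_connected)
  show "circle_in Z c" unfolding h(3) by (rule rim_circle[OF h(1)])
  show "c \<subseteq> D" unfolding h(2,3) by auto
qed

lemma closed_embedding_into_subtopology:
  assumes "closed_embedding X Z h" "h ` topspace X \<subseteq> S"
  shows "closed_embedding X (subtopology Z S) h"
  using assms unfolding closed_embedding_def
  by (auto simp: continuous_map_in_subtopology intro!: closed_map_into_subtopology)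

text \<open>This is used to see that the corners are boundary points without describing their neighbourhoods.\<close>

lemma closedin_surface_boundary: "closedin Y (surface_boundary Y)"
proof -
  have "openin Y (topspace Y - surface_boundary Y)"
  proof (subst openin_subopen, intro ballI)
    fix x assume "x \<in> topspace Y - surface_boundary Y"
    then obtain U where U: "openin Y U" "x \<in> U" "subtopology Y U homeomorphic_space (euclidean :: complex topology)"
      unfolding surface_boundary_def by blast
    moreover have "U \<subseteq> topspace Y - surface_boundary Y"
      using U openin_subset[OF U(1)] unfolding surface_boundary_def by blast
    ultimately show "\<exists>T. openin Y T \<and> x \<in> T \<and> T \<subseteq> topspace Y - surface_boundary Y" by blast
  qed
  moreover have "surface_boundary Y \<subseteq> topspace Y" by (auto simp: surface_boundary_def)
  ultimately show ?thesis by (simp add: closedin_def)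
qed

text \<open>A square system whose circles bound discs. Both the ribbon graph and the caps and edges of its capped
surface are of this form; the surrounding space may contain further points, such as the vertices of
G in the latter case.\<close>

locale disc_system = square_system Z B0 E s1 s2 t1 t2 p1 q1 p2 q2
  for Z :: "'a topology" and B0 :: "'a set" and E :: "'e set"
    and s1 s2 t1 t2 :: "'e \<Rightarrow> 'a set" and p1 q1 p2 q2 :: "'e \<Rightarrow> 'a" +
  fixes V :: "'v set" and vd vc :: "'v \<Rightarrow> 'a set" and ed :: "'e \<Rightarrow> 'a set"
  assumes finite_V: "finite V"
    and vertex_disc: "v \<in> V \<Longrightarrow> disc_with_rim Z (vd v) (vc v)"
    and edge_disc: "e \<in> E \<Longrightarrow> disc_with_rim Z (ed e) (s1 e \<union> s2 e \<union> (t1 e \<union> t2 e))"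
    and base: "B0 = (\<Union>v\<in>V. vc v)"
    and vertices_disjoint: "v \<in> V \<Longrightarrow> w \<in> V \<Longrightarrow> v \<noteq> w \<Longrightarrow> vd v \<inter> vd w = {}"
    and edges_disjoint: "e \<in> E \<Longrightarrow> e' \<in> E \<Longrightarrow> e \<noteq> e' \<Longrightarrow> ed e \<inter> ed e' = {}"
    and vertex_edge: "v \<in> V \<Longrightarrow> e \<in> E \<Longrightarrow> vd v \<inter> ed e \<subseteq> s1 e \<union> s2 e"
begin

definition surf :: "'e set \<Rightarrow> 'a set" where
  "surf A = (\<Union>v\<in>V. vd v) \<union> (\<Union>e\<in>A. ed e)"

lemma rims_in: "v \<in> V \<Longrightarrow> vc v \<subseteq> vd v" "e \<in> E \<Longrightarrow> segs e \<union> sides e \<subseteq> ed e"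
  using disc_with_rim_props(4) vertex_disc edge_disc by blast+

lemma skel_sub_surf: "A \<subseteq> E \<Longrightarrow> skel A \<subseteq> surf A"
proof -
  assume A: "A \<subseteq> E"
  have "sides e \<subseteq> ed e" if "e \<in> A" for e using rims_in(2)[of e] that A by auto
  then have "(\<Union>e\<in>A. sides e) \<subseteq> (\<Union>e\<in>A. ed e)" by (rule UN_mono[OF order_refl])
  moreover have "B0 \<subseteq> (\<Union>v\<in>V. vd v)" unfolding base using rims_in(1) by (rule UN_mono[OF order_refl])
  ultimately show ?thesis unfolding skel_def surf_def by (intro Un_mono)
qed

lemma closed_discs: "v \<in> V \<Longrightarrow> closedin Z (vd v)" "e \<in> E \<Longrightarrow> closedin Z (ed e)"
  using disc_with_rim_props(1) vertex_disc edge_disc by blast+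

lemma base_in_vertex: "v \<in> V \<Longrightarrow> x \<in> vd v \<Longrightarrow> x \<in> B0 \<Longrightarrow> x \<in> vc v"
  unfolding base using rims_in(1) vertices_disjoint by blast

lemma vertex_edge_rim:
  assumes "v \<in> V" "e \<in> E" "x \<in> vd v" "x \<in> ed e"
  shows "x \<in> segs e" "x \<in> vc v"
proof -
  show s: "x \<in> segs e" using vertex_edge[OF assms(1,2)] assms(3,4) by blast
  then have "x \<in> B0" using segments_sub[OF assms(2)] by blast
  then show "x \<in> vc v" by (rule base_in_vertex[OF assms(1,3)])
qed

lemma base_in_edge:
  assumes "e \<in> E" "x \<in> ed e" "x \<in> B0" shows "x \<in> segs e"
proof -
  obtain v where "v \<in> V" "x \<in> vd v" using assms(3) rims_in(1) unfolding base by blast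
  then show ?thesis using vertex_edge_rim(1) assms by blast
qed

lemma skel_vertex:
  assumes "A \<subseteq> E" "v \<in> V" "x \<in> vd v" "x \<in> skel A" shows "x \<in> vc v"
proof (cases "x \<in> B0")
  case True then show ?thesis using base_in_vertex assms by blast
next
  case False
  then obtain e where "e \<in> A" "x \<in> sides e" using assms(4) unfolding skel_def by blast
  then have "e \<in> E" "x \<in> ed e" using assms(1) rims_in(2)[of e] by auto
  then show ?thesis using vertex_edge_rim(2) assms by blast
qed

lemma skel_edge:
  assumes "A \<subseteq> E" "e \<in> E" "x \<in> ed e" "x \<in> skel A" shows "x \<in> segs e \<union> sides e"
proof (cases "x \<in> B0")
  case True then show ?thesis using base_in_edge assms by blast
next
  case False
  then obtain a where a: "a \<in> A" "x \<in> sides a" using assms(4) unfolding skel_def by blast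
  then have "a \<in> E" "x \<in> ed a" using assms(1) rims_in(2)[of a] by auto
  then have "a = e" using edges_disjoint[of a e] assms by blast
  then show ?thesis using a by blast
qed

lemma comps_base: "comps Z B0 = vc ` V" and card_V: "card V = k {}"
proof -
  have ne: "vc v \<noteq> {}" if "v \<in> V" for v
    using circle_in_nonempty[OF disc_with_rim_props(3)[OF vertex_disc[OF that]]] .
  have dj: "vc v \<inter> vc w = {}" if "v \<in> V" "w \<in> V" "v \<noteq> w" for v w
    using vertices_disjoint[OF that] rims_in(1)[OF that(1)] rims_in(1)[OF that(2)] by blast
  have inj: "inj_on vc V"
  proof (rule inj_onI)
    fix v w assume "v \<in> V" "w \<in> V" "vc v = vc w"
    then show "v = w" using dj[of v w] ne[of v] by auto
  qed
  have "comps Z (\<Union>(vc ` V)) = vc ` V"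
  proof (rule comps_circles)
    show "finite (vc ` V)" using finite_V by simp
    show "pairwise disjnt (vc ` V)" using dj by (auto simp: pairwise_def disjnt_def)
    show "circle_in Z c" if "c \<in> vc ` V" for c
      using that disc_with_rim_props(3)[OF vertex_disc] by blast
  qed
  then show *: "comps Z B0 = vc ` V" using base by simp
  show "card V = k {}" by (simp add: k_def ncomp_def * card_image[OF inj])
qed

subsection \<open>Components\<close>

text \<open>Filling a circle with a disc does not change the number of components, since the disc is attached
along a connected set.\<close>

lemma fill_disc:
  assumes W: "closedin Z W" "finite (comps Z W)" and D: "disc_with_rim Z D c" "c \<subseteq> W" "D \<inter> W \<subseteq> c"
  shows "closedin Z (W \<union> D)" "finite (comps Z (W \<union> D))" "ncomp Z (W \<union> D) = ncomp Z W"
proof -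
  note p = disc_with_rim_props[OF D(1)]
  note c = circle_in_connected[OF p(3)] circle_in_nonempty[OF p(3)]
  show "closedin Z (W \<union> D)" using W(1) p(1) by (rule closedin_Un)
  have ne: "D \<noteq> {}" "D \<inter> W \<noteq> {}" using p(4) c(2) D(2) by blast+
  show "finite (comps Z (W \<union> D))" using comps_attach(1)[OF W p(1,2) ne(1)] W(2) by simp
  obtain C where C: "C \<in> comps Z W" "c \<subseteq> C" using connectedin_in_comps[OF c(1) D(2) c(2)] .
  have "D \<inter> W \<subseteq> C" using D(3) C(2) by blast
  then show "ncomp Z (W \<union> D) = ncomp Z W" using ncomp_attach_one[OF W p(1,2) C(1) _ ne(2)] by blast
qed

text \<open>The skeleton has as many components as the surface: the discs are filled in one at a time.\<close>

lemma ncomp_surf: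
  assumes A: "A \<subseteq> E" shows "ncomp Z (surf A) = k A"
proof -
  let ?P = "\<lambda>W. closedin Z W \<and> finite (comps Z W) \<and> ncomp Z W = k A"
  have finA: "finite A" using A finite_E finite_subset by blast
  have vs: "?P (skel A \<union> (\<Union>v\<in>X. vd v))" if "finite X" "X \<subseteq> V" for X
    using that
  proof (induction X)
    case empty
    then show ?case using closed_skel[OF A] finite_comps_skel[OF A] by (simp add: k_def)
  next
    case (insert v X)
    then have v: "v \<in> V" "X \<subseteq> V" "v \<notin> X" by auto
    let ?W = "skel A \<union> (\<Union>v\<in>X. vd v)"
    have P: "?P ?W" using insert.IH v(2) by blast
    have "vc v \<subseteq> B0" using v(1) base by auto
    then have "vc v \<subseteq> ?W" by (auto simp: skel_def)
    moreover have "vd v \<inter> ?W \<subseteq> vc v"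
    proof
      fix x assume x: "x \<in> vd v \<inter> ?W"
      have "x \<notin> vd w" if "w \<in> X" for w
        using vertices_disjoint[of v w] that v x by (metis IntD1 disjoint_iff subsetD)
      then have "x \<in> skel A" using x by auto
      then show "x \<in> vc v" using skel_vertex[OF A v(1)] x by simp
    qed
    ultimately have "?P (?W \<union> vd v)" using fill_disc[OF _ _ vertex_disc[OF v(1)], of ?W] P by simp
    moreover have "?W \<union> vd v = skel A \<union> (\<Union>v\<in>insert v X. vd v)" by blast
    ultimately show ?case by simp
  qed
  have es: "?P (skel A \<union> (\<Union>v\<in>V. vd v) \<union> (\<Union>e\<in>X. ed e))" if "finite X" "X \<subseteq> A" for X
    using that
  proof (induction X)
    case empty
    then show ?case using vs[OF finite_V order_refl] by simp
  next
    case (insert e X)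
    then have e: "e \<in> A" "e \<in> E" "X \<subseteq> A" "X \<subseteq> E" "e \<notin> X" using A by auto
    let ?W = "skel A \<union> (\<Union>v\<in>V. vd v) \<union> (\<Union>e\<in>X. ed e)"
    have P: "?P ?W" using insert.IH e(3) by blast
    have "segs e \<union> sides e \<subseteq> ?W" using e(1) segments_sub[OF e(2)] unfolding skel_def by blast
    moreover have "ed e \<inter> ?W \<subseteq> segs e \<union> sides e"
    proof
      fix x assume x: "x \<in> ed e \<inter> ?W"
      have "x \<notin> ed a" if "a \<in> X" for a
        using edges_disjoint[of e a] that e x by (metis IntD1 disjoint_iff subsetD)
      then have "x \<in> skel A \<or> (\<exists>v\<in>V. x \<in> vd v)" using x by auto
      then show "x \<in> segs e \<union> sides e"
      proof
        assume "x \<in> skel A"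
        then show ?thesis using skel_edge[OF A e(2)] x by simp
      next
        assume "\<exists>v\<in>V. x \<in> vd v"
        then obtain v where "v \<in> V" "x \<in> vd v" by blast
        then show ?thesis using vertex_edge_rim(1)[OF _ e(2)] x by blast
      qed
    qed
    ultimately have "?P (?W \<union> ed e)" using fill_disc[OF _ _ edge_disc[OF e(2)], of ?W] P by simp
    moreover have "?W \<union> ed e = skel A \<union> (\<Union>v\<in>V. vd v) \<union> (\<Union>e\<in>insert e X. ed e)" by blast
    ultimately show ?case by simp
  qed
  have "skel A \<subseteq> surf A" by (rule skel_sub_surf[OF A])
  then have "skel A \<union> (\<Union>v\<in>V. vd v) \<union> (\<Union>e\<in>A. ed e) = surf A" unfolding surf_def by blast
  then show ?thesis using es[OF finA order_refl] by simp
qed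

subsection \<open>The boundary\<close>

context
  fixes A assumes A: "A \<subseteq> E"
begin

abbreviation "Y \<equiv> subtopology Z (surf A)"

lemma finite_A: "finite A" using A finite_E finite_subset by blast

lemma closed_surf: "closedin Z (surf A)"
  unfolding surf_def using closed_discs A finite_V finite_A
  by (intro closedin_Un closedin_Union) auto

lemma closedin_Y: "closedin Y K \<longleftrightarrow> K \<subseteq> surf A \<and> closedin Z K"
  using closedin_closed_subtopology[OF closed_surf] by blast

lemma topspace_Y: "topspace Y = surf A"
  using closedin_subset[OF closed_surf] by auto

lemma vd_surf: "v \<in> V \<Longrightarrow> vd v \<subseteq> surf A" and ed_surf: "e \<in> A \<Longrightarrow> ed e \<subseteq> surf A"
  by (auto simp: surf_def)

definition "rest_v v = (\<Union>w\<in>V-{v}. vd w) \<union> (\<Union>e\<in>A. ed e)"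
definition "rest_e e = (\<Union>w\<in>V. vd w) \<union> (\<Union>a\<in>A-{e}. ed a)"

lemma closed_rest: "closedin Y (rest_v v)" "closedin Y (rest_e e)"
proof -
  have "closedin Z (\<Union>w\<in>V-{v}. vd w)" "closedin Z (\<Union>w\<in>V. vd w)"
    "closedin Z (\<Union>e\<in>A. ed e)" "closedin Z (\<Union>a\<in>A-{e}. ed a)"
    using closed_discs A finite_V finite_A by (auto intro!: closedin_Union)
  then show "closedin Y (rest_v v)" "closedin Y (rest_e e)"
    unfolding closedin_Y rest_v_def rest_e_def by (auto simp: surf_def intro!: closedin_Un)
qed

lemma rest_v: 
  assumes v: "v \<in> V"
  shows "surf A = vd v \<union> rest_v v" "x \<in> rest_v v \<Longrightarrow> x \<in> vd v \<Longrightarrow> x \<in> vc v \<and> (\<exists>e\<in>A. x \<in> segs e)"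
proof -
  show "surf A = vd v \<union> rest_v v" unfolding surf_def rest_v_def using v by blast
  assume x: "x \<in> rest_v v" "x \<in> vd v"
  have "x \<notin> vd w" if "w \<in> V - {v}" for w using vertices_disjoint[OF v, of w] that x(2) by blast
  then obtain e where e: "e \<in> A" "x \<in> ed e" using x(1) unfolding rest_v_def by blast
  then have "e \<in> E" using A by blast
  then show "x \<in> vc v \<and> (\<exists>e\<in>A. x \<in> segs e)" using vertex_edge_rim[OF v _ x(2) e(2)] e(1) by blast
qed

lemma rest_e:
  assumes e: "e \<in> A"
  shows "surf A = ed e \<union> rest_e e" "x \<in> rest_e e \<Longrightarrow> x \<in> ed e \<Longrightarrow> x \<in> segs e"
proof -
  have eE: "e \<in> E" using e A by blast
  show "surf A = ed e \<union> rest_e e" unfolding surf_def rest_e_def using e by blast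
  assume x: "x \<in> rest_e e" "x \<in> ed e"
  have "x \<notin> ed a" if "a \<in> A - {e}" for a using edges_disjoint[OF eE, of a] that A x(2) by blast
  then obtain v where "v \<in> V" "x \<in> vd v" using x(1) unfolding rest_e_def by blast
  then show "x \<in> segs e" using vertex_edge_rim(1) eE x(2) by blast
qed

lemma disc_in_Y:
  assumes "disc_with_rim Z D c" "D \<subseteq> surf A"
  obtains h where "disc_map Y h" "D = h ` cball 0 1" "c = h ` sphere 0 1"
proof -
  obtain h where h: "disc_map Z h" "D = h ` cball 0 1" "c = h ` sphere 0 1"
    using disc_with_rimE[OF assms(1)] .
  have "disc_map Y h"
    by (rule closed_embedding_into_subtopology[OF h(1)]) (use assms(2) h(2) in simp)
  then show ?thesis using that h(2,3) by blast
qed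

lemma arc_in_Y: "arc_in Z a p q \<Longrightarrow> a \<subseteq> surf A \<Longrightarrow> arc_in Y a p q"
  unfolding arc_in_def using closed_embedding_into_subtopology[of "top_of_set {0..1}" Z _ "surf A"] by auto

lemma disc_boundary:
  assumes D: "disc_with_rim Z D c" "surf A = D \<union> R" and R: "closedin Y R" "R \<inter> D \<subseteq> c"
  shows "x \<in> D - c \<Longrightarrow> x \<notin> surface_boundary Y" "x \<in> c - R \<Longrightarrow> x \<in> surface_boundary Y"
proof -
  obtain h where h: "disc_map Y h" "D = h ` cball 0 1" "c = h ` sphere 0 1"
    using disc_in_Y[OF D(1)] D(2) by blast
  have top: "topspace Y = h ` cball 0 1 \<union> R" using topspace_Y D(2) h(2) by simp
  {
    assume x: "x \<in> D - c"
    then obtain z where z: "z \<in> cball 0 1" "x = h z" "z \<notin> sphere 0 1" using h(2,3) by blast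
    then have "norm z < 1" by simp
    then show "x \<notin> surface_boundary Y"
      unfolding z(2) using R(2) h(2,3) by (intro inner_point_not_boundary[OF h(1) R(1) top]) auto
  next
    assume x: "x \<in> c - R"
    then obtain z where z: "z \<in> sphere 0 1" "x = h z" using h(3) by blast
    then show "x \<in> surface_boundary Y"
      using rim_point_in_boundary[OF h(1) R(1) top z(1)] x by blast
  }
qed

text \<open>The vertex on which s lies and the edge e play the parts of the two discs sharing an arc; s' is the
other segment of e, and it goes to the remainder together with all other discs.\<close>

lemma segment_interior:
  assumes e: "e \<in> A" and s: "arc_in Z s p q" "s \<union> s' = segs e" "s \<inter> s' = {}" "closedin Z s'"
    and x: "x \<in> s - {p,q}"
  shows "x \<notin> surface_boundary Y"
proof -
  have eE: "e \<in> E" using e A by blast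
  have sB: "s \<subseteq> B0" "s \<subseteq> ed e" using s(2) segments_sub[OF eE] rims_in(2)[OF eE] by blast+
  have sne: "s \<noteq> {}" using arc_in_ends[OF s(1)] by blast
  obtain C where C: "C \<in> comps Z B0" "s \<subseteq> C"
    using connectedin_in_comps[OF arc_in_connected[OF s(1)] sB(1) sne] .
  from C(1) have "C \<in> vc ` V" unfolding comps_base .
  then obtain v where v: "v \<in> V" "s \<subseteq> vc v" using C(2) by auto
  obtain h where h: "disc_map Y h" "vd v = h ` cball 0 1" "vc v = h ` sphere 0 1"
    using disc_in_Y[OF vertex_disc[OF v(1)] vd_surf[OF v(1)]] .
  obtain h' where h': "disc_map Y h'" "ed e = h' ` cball 0 1"
    "segs e \<union> sides e = h' ` sphere 0 1"
    using disc_in_Y[OF edge_disc[OF eE] ed_surf[OF e]] .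
  define R where "R = (\<Union>w\<in>V-{v}. vd w) \<union> (\<Union>a\<in>A-{e}. ed a) \<union> s'"
  have s'e: "s' \<subseteq> ed e" "s' \<subseteq> segs e" using s(2) rims_in(2)[OF eE] by blast+
  have R1: "closedin Y R"
  proof -
    have "closedin Z (\<Union>w\<in>V-{v}. vd w)" "closedin Z (\<Union>a\<in>A-{e}. ed a)"
      using closed_discs A finite_V finite_A by (auto intro!: closedin_Union)
    then have "closedin Z R" unfolding R_def using s(4) by (intro closedin_Un)
    moreover have "R \<subseteq> surf A" using s'e(1) ed_surf[OF e] unfolding R_def surf_def by blast
    ultimately show ?thesis using closedin_Y by blast
  qed
  have R2: "topspace Y = h ` cball 0 1 \<union> h' ` cball 0 1 \<union> R"
    unfolding topspace_Y h(2)[symmetric] h'(2)[symmetric]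
  proof
    show "surf A \<subseteq> vd v \<union> ed e \<union> R" unfolding surf_def R_def by blast
    show "vd v \<union> ed e \<union> R \<subseteq> surf A"
      using vd_surf[OF v(1)] ed_surf[OF e] closedin_subset[OF R1] topspace_Y by auto
  qed
  have vw: "vd w \<inter> vd v = {}" if "w \<in> V - {v}" for w using vertices_disjoint[of w v] that v(1) by blast
  have ea: "ed a \<inter> ed e = {}" if "a \<in> A - {e}" for a using edges_disjoint[of a e] that A eE by blast
  have R3: "R \<inter> h ` cball 0 1 \<subseteq> h ` sphere 0 1"
    unfolding h(2)[symmetric] h(3)[symmetric]
  proof
    fix y assume y: "y \<in> R \<inter> vd v"
    then have "y \<in> (\<Union>a\<in>A-{e}. ed a) \<or> y \<in> s'" using vw unfolding R_def by blast
    then obtain a where "a \<in> A" "y \<in> ed a" using s'e e by blast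
    then show "y \<in> vc v" using vertex_edge_rim(2)[OF v(1)] A y by blast
  qed
  have R4: "R \<inter> h' ` cball 0 1 \<subseteq> h' ` sphere 0 1"
    unfolding h'(2)[symmetric] h'(3)[symmetric]
  proof
    fix y assume y: "y \<in> R \<inter> ed e"
    then consider w where "w \<in> V" "y \<in> vd w" | "y \<in> s'" using ea unfolding R_def by blast
    then show "y \<in> segs e \<union> sides e" 
      using vertex_edge_rim(1)[OF _ eE] y s'e(2) by cases blast+
  qed
  have s3: "h ` cball 0 1 \<inter> h' ` cball 0 1 \<subseteq> s \<union> R"
    unfolding h(2)[symmetric] h'(2)[symmetric] using vertex_edge[OF v(1) eE] s(2) unfolding R_def by blast
  have s4: "(s - {p,q}) \<inter> R = {}"
  proof -
    have "s \<inter> vd w = {}" if "w \<in> V - {v}" for w using vw[OF that] v rims_in(1) by blast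
    moreover have "s \<inter> ed a = {}" if "a \<in> A - {e}" for a using ea[OF that] sB(2) by blast
    ultimately show ?thesis using s(3) unfolding R_def by blast
  qed
  have "arc_in Y s p q" using arc_in_Y[OF s(1)] sB(2) ed_surf[OF e] by blast
  moreover have "s \<subseteq> h' ` sphere 0 1" unfolding h'(3)[symmetric] using s(2) by blast
  ultimately show ?thesis
    using shared_arc_not_boundary[OF h(1) h'(1) R1 R2 R3 R4 _ v(2)[unfolded h(3)] _ s3 s4 x] by blast
qed

text \<open>The interiors of the sides meet no other disc; the corners are their limits.\<close>

lemma side_in_boundary:
  assumes e: "e \<in> A" shows "sides e \<subseteq> surface_boundary Y"
proof -
  have eE: "e \<in> E" using e A by blast
  have R: "rest_e e \<inter> ed e \<subseteq> segs e \<union> sides e" using rest_e(2)[OF e] by blast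
  have inner: "x \<in> surface_boundary Y" if x: "x \<in> sides e - corners e" for x
  proof -
    have "x \<notin> segs e" using x segs_sides[OF eE] by blast
    moreover have "x \<in> ed e" using x rims_in(2)[OF eE] by blast
    ultimately have "x \<notin> rest_e e" using rest_e(2)[OF e] by blast
    then show ?thesis
      using disc_boundary(2)[OF edge_disc[OF eE] rest_e(1)[OF e] closed_rest(2) R, of x] x by blast
  qed
  have sub: "sides e \<subseteq> surf A" using rims_in(2)[OF eE] ed_surf[OF e] by blast
  have "t1 e - {p1 e, p2 e} \<subseteq> sides e - corners e"
    using arcs(6)[OF eE] corners_in(7,8)[OF eE] by blast
  then have 1: "t1 e - {p1 e, p2 e} \<subseteq> surface_boundary Y" using inner by blast
  have "t2 e - {q1 e, q2 e} \<subseteq> sides e - corners e"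
    using arcs(6)[OF eE] corners_in(5,6)[OF eE] by blast
  then have 2: "t2 e - {q1 e, q2 e} \<subseteq> surface_boundary Y" using inner by blast
  have "t1 e \<subseteq> surface_boundary Y"
    using arc_in_subset_closed[OF arc_in_Y[OF arcs(3)[OF eE]] closedin_surface_boundary 1] sub by blast
  moreover have "t2 e \<subseteq> surface_boundary Y"
    using arc_in_subset_closed[OF arc_in_Y[OF arcs(4)[OF eE]] closedin_surface_boundary 2] sub by blast
  ultimately show ?thesis by blast
qed

lemma segment_boundary:
  assumes e: "e \<in> A" and x: "x \<in> segs e"
  shows "x \<in> surface_boundary Y \<longleftrightarrow> x \<in> bd A"
proof -
  have eE: "e \<in> E" using e A by blast
  have sub: "sides e \<subseteq> bd A" using e unfolding bd_def by blast
  show ?thesis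
  proof (cases "x \<in> corners e")
    case True
    then have "x \<in> sides e" using segs_sides[OF eE] by blast
    then show ?thesis using side_in_boundary[OF e] sub by blast
  next
    case False
    note cl = arc_in_closedin[OF arcs(1)[OF eE]] arc_in_closedin[OF arcs(2)[OF eE]]
    have "x \<notin> surface_boundary Y"
    proof (cases "x \<in> s1 e")
      case True
      then show ?thesis
        using False by (intro segment_interior[OF e arcs(1)[OF eE] refl arcs(5)[OF eE] cl(2)]) blast
    next
      case n: False
      have "s2 e \<union> s1 e = segs e" "s2 e \<inter> s1 e = {}" using arcs(5)[OF eE] by blast+
      from segment_interior[OF e arcs(2)[OF eE] this cl(1)] show ?thesis using n x False by blast
    qed
    moreover have "x \<notin> bd A"
    proof
      assume "x \<in> bd A"
      then obtain a where a: "a \<in> A" "x \<in> sides a" using x e unfolding bd_def by blast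
      have "a = e"
      proof (rule ccontr)
        assume "a \<noteq> e"
        then have "(segs a \<union> sides a) \<inter> (segs e \<union> sides e) = {}" using squares_disjoint[of a e] a(1) A eE by blast
        then show False using a x by blast
      qed
      then show False using a x False segs_sides[OF eE] by blast
    qed
    ultimately show ?thesis by blast
  qed
qed

lemma surface_boundary_surf: "surface_boundary Y = bd A"
proof -
  have inY: "surface_boundary Y \<subseteq> surf A" using topspace_Y by (auto simp: surface_boundary_def)
  have bdY: "bd A \<subseteq> surf A" using bd_sub_skel skel_sub_surf[OF A] by (rule order_trans)
  have "x \<in> surface_boundary Y \<longleftrightarrow> x \<in> bd A" if x: "x \<in> surf A" for x
  proof (cases "\<exists>e\<in>A. x \<in> segs e")
    case True
    then show ?thesis using segment_boundary by blast
  next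
    case noseg: False
    show ?thesis
    proof (cases "\<exists>v\<in>V. x \<in> vd v")
      case True
      then obtain v where v: "v \<in> V" "x \<in> vd v" by blast
      have R: "rest_v v \<inter> vd v \<subseteq> vc v" using rest_v(2)[OF v(1)] by blast
      note db = disc_boundary[OF vertex_disc[OF v(1)] rest_v(1)[OF v(1)] closed_rest(1) R, of x]
      show ?thesis
      proof (cases "x \<in> vc v")
        case True
        have "x \<notin> rest_v v" using rest_v(2)[OF v(1) _ v(2)] noseg by blast
        moreover have "x \<in> B0" using True v(1) by (auto simp: base)
        then have "x \<in> bd A" using noseg unfolding bd_def by blast
        ultimately show ?thesis using db(2) True by blast
      next
        case False
        then have "x \<notin> bd A" using skel_vertex[OF A v] bd_sub_skel by blast
        then show ?thesis using db(1) v(2) False by blast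
      qed
    next
      case nov: False
      then obtain e where e: "e \<in> A" "x \<in> ed e" using x unfolding surf_def by blast
      have eE: "e \<in> E" using e A by blast
      have R: "rest_e e \<inter> ed e \<subseteq> segs e \<union> sides e" using rest_e(2)[OF e(1)] by blast
      note db = disc_boundary[OF edge_disc[OF eE] rest_e(1)[OF e(1)] closed_rest(2) R, of x]
      show ?thesis
      proof (cases "x \<in> segs e \<union> sides e")
        case True
        have "x \<notin> rest_e e" using rest_e(2)[OF e(1) _ e(2)] noseg e(1) by blast
        moreover have "x \<in> bd A" using True noseg e(1) unfolding bd_def by blast
        ultimately show ?thesis using db(2) True by blast
      next
        case False
        then have "x \<notin> bd A" using skel_edge[OF A eE e(2)] bd_sub_skel by blast
        then show ?thesis using db(1) e(2) False by blast
      qed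
    qed
  qed
  then show ?thesis using inY bdY by blast
qed

lemma boundary_components_surf: "boundary_components Y = comps Z (bd A)"
proof -
  have "bd A \<subseteq> surf A" using surface_boundary_surf topspace_Y by (auto simp: surface_boundary_def)
  then show ?thesis
    unfolding boundary_components_def surface_boundary_surf by (simp add: subtopology_subtopology Int_absorb1)
qed

end

end

section \<open>From ribbon graphs to disc systems\<close>

lemma arc_in_image: "closed_embedding Z Y g \<Longrightarrow> arc_in Z a p q \<Longrightarrow> arc_in Y (g ` a) (g p) (g q)"
proof -
  assume g: "closed_embedding Z Y g" and "arc_in Z a p q"
  then obtain h where h: "arc_map Z h" "a = h ` {0..1}" "h 0 = p" "h 1 = q"
    using arc_inE by metis
  show ?thesis
    by (rule arc_inI[OF closed_embedding_compose[OF g h(1)]]) (simp_all add: h(2-) image_comp)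
qed

lemma circle_in_image: "closed_embedding Z Y g \<Longrightarrow> circle_in Z c \<Longrightarrow> circle_in Y (g ` c)"
  unfolding circle_in_def using closed_embedding_compose image_comp by metis

lemma disc_with_rim_image: "closed_embedding Z Y g \<Longrightarrow> disc_with_rim Z D c \<Longrightarrow> disc_with_rim Y (g ` D) (g ` c)"
  unfolding disc_with_rim_def using closed_embedding_compose image_comp by metis

lemma circle_union_image:
  assumes g: "closed_embedding Z Y g" and B: "circle_union Z B"
  shows "circle_union Y (g ` B)"
proof -
  obtain \<C> where C: "finite \<C>" "pairwise disjnt \<C>" "\<forall>c\<in>\<C>. circle_in Z c" "B = \<Union>\<C>"
    using B unfolding circle_union_def by blast
  have sub: "c \<subseteq> topspace Z" if "c \<in> \<C>" for c using C(3) that circle_in_closedin closedin_subset by metis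
  have "pairwise disjnt ((`) g ` \<C>)"
  proof (rule pairwise_imageI)
    fix c d assume cd: "c \<in> \<C>" "d \<in> \<C>" "c \<noteq> d"
    have "c \<inter> d = {}" using C(2) cd by (auto simp: pairwise_def disjnt_def)
    moreover have "g ` c \<inter> g ` d = g ` (c \<inter> d)"
      using g sub cd by (intro inj_on_image_Int[symmetric, where C="topspace Z"]) (auto simp: closed_embedding_def)
    ultimately show "disjnt (g ` c) (g ` d)" by (simp add: disjnt_def)
  qed
  moreover have "\<forall>c\<in>(`) g ` \<C>. circle_in Y c" using C(3) circle_in_image[OF g] by auto
  moreover have "g ` B = \<Union>((`) g ` \<C>)" unfolding C(4) by auto
  ultimately show ?thesis unfolding circle_union_def using C(1) by blast
qed

context square_system
begin

lemma in_topspace: "B0 \<subseteq> topspace Z" "e \<in> E \<Longrightarrow> segs e \<subseteq> topspace Z" "e \<in> E \<Longrightarrow> sides e \<subseteq> topspace Z"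
  using circle_union_comps(4)[OF circles] closed_segs closed_sides closedin_subset by metis+

lemma bd_in_topspace: "A \<subseteq> E \<Longrightarrow> bd A \<subseteq> topspace Z"
  using circle_union_comps(4)[OF circle_union_bd] closedin_subset by metis

lemma skel_in_topspace: "A \<subseteq> E \<Longrightarrow> skel A \<subseteq> topspace Z"
  using closed_skel closedin_subset by metis

context
  fixes Y :: "'b topology" and g :: "'a \<Rightarrow> 'b"
  assumes g: "closed_embedding Z Y g"
begin

lemma g_Int: "S \<subseteq> topspace Z \<Longrightarrow> T \<subseteq> topspace Z \<Longrightarrow> g ` S \<inter> g ` T = g ` (S \<inter> T)"
  using g by (intro inj_on_image_Int[symmetric, where C="topspace Z"]) (auto simp: closed_embedding_def)

lemma square_system_image:
  "square_system Y (g ` B0) E (\<lambda>e. g ` s1 e) (\<lambda>e. g ` s2 e) (\<lambda>e. g ` t1 e) (\<lambda>e. g ` t2 e)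
     (\<lambda>e. g (p1 e)) (\<lambda>e. g (q1 e)) (\<lambda>e. g (p2 e)) (\<lambda>e. g (q2 e))"
proof
  show "finite E" by (rule finite_E)
  show "circle_union Y (g ` B0)" using circle_union_image[OF g circles] .
  fix e assume e: "e \<in> E"
  have sub: "s1 e \<subseteq> topspace Z" "s2 e \<subseteq> topspace Z" "t1 e \<subseteq> topspace Z" "t2 e \<subseteq> topspace Z"
    using in_topspace(2,3)[OF e] by auto
  show "square Y (g ` s1 e) (g ` s2 e) (g ` t1 e) (g ` t2 e) (g (p1 e)) (g (q1 e)) (g (p2 e)) (g (q2 e))"
    unfolding square_def g_Int[OF sub(1,2)] g_Int[OF sub(3,4)] g_Int[OF sub(1,3)] g_Int[OF sub(2,3)]
      g_Int[OF sub(1,4)] g_Int[OF sub(2,4)] arcs(5-)[OF e]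
    using arc_in_image[OF g arcs(1)[OF e]] arc_in_image[OF g arcs(2)[OF e]]
      arc_in_image[OF g arcs(3)[OF e]] arc_in_image[OF g arcs(4)[OF e]] by simp
  show "g ` s1 e \<union> g ` s2 e \<subseteq> g ` B0"
    using image_mono[OF segments_sub[OF e]] by (simp add: image_Un)
  show "(g ` t1 e \<union> g ` t2 e) \<inter> g ` B0 = {g (p1 e), g (q1 e), g (p2 e), g (q2 e)}"
    unfolding image_Un[symmetric] g_Int[OF in_topspace(3)[OF e] in_topspace(1)] sides_meet[OF e] by simp
  fix e' assume e': "e' \<in> E" "e \<noteq> e'"
  have "segs e \<union> sides e \<subseteq> topspace Z" "segs e' \<union> sides e' \<subseteq> topspace Z"
    using in_topspace(2,3) e e'(1) by auto
  from g_Int[OF this] show "(g ` s1 e \<union> g ` s2 e \<union> (g ` t1 e \<union> g ` t2 e)) \<inter>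
      (g ` s1 e' \<union> g ` s2 e' \<union> (g ` t1 e' \<union> g ` t2 e')) = {}"
    unfolding image_Un[symmetric] squares_disjoint[OF e e'] by simp
qed

interpretation img: square_system Y "g ` B0" E "\<lambda>e. g ` s1 e" "\<lambda>e. g ` s2 e" "\<lambda>e. g ` t1 e" "\<lambda>e. g ` t2 e"
     "\<lambda>e. g (p1 e)" "\<lambda>e. g (q1 e)" "\<lambda>e. g (p2 e)" "\<lambda>e. g (q2 e)"
  by (rule square_system_image)

lemma bd_image: 
  assumes A: "A \<subseteq> E" shows "img.bd A = g ` bd A"
proof -
  have inj: "inj_on g (topspace Z)" using g by (simp add: closed_embedding_def)
  have "(\<Union>e\<in>A. segs e) \<subseteq> topspace Z" using in_topspace(2) A by blast
  then have "g ` (B0 - (\<Union>e\<in>A. segs e)) = g ` B0 - g ` (\<Union>e\<in>A. segs e)"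
    using in_topspace(1) by (intro inj_on_image_set_diff[OF inj]) auto
  then show ?thesis unfolding img.bd_def bd_def by (simp add: image_Un image_UN)
qed

lemma skel_image: "img.skel A = g ` skel A"
  unfolding img.skel_def skel_def by (simp add: image_Un image_UN)

lemma f_image: "A \<subseteq> E \<Longrightarrow> img.f A = f A"
  unfolding img.f_def f_def by (simp add: bd_image ncomp_image(2)[OF g bd_in_topspace])

lemma k_image: "A \<subseteq> E \<Longrightarrow> img.k A = k A"
  unfolding img.k_def k_def by (simp add: skel_image ncomp_image(2)[OF g skel_in_topspace])

end

end

lemma homeomorphic_space_closed_embedding:
  fixes S :: "'b::metric_space set"
  assumes X: "Hausdorff_space X" and S: "compact S" and a: "a \<subseteq> topspace X"
    "subtopology X a homeomorphic_space top_of_set S"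
  obtains h where "closed_embedding (top_of_set S) X h" "h ` S = a"
proof -
  obtain h where "homeomorphic_map (top_of_set S) (subtopology X a) h"
    using a(2) homeomorphic_space_sym homeomorphic_space by metis
  then have h: "continuous_map (top_of_set S) (subtopology X a) h" "inj_on h S" "h ` S = topspace (subtopology X a)"
    by (simp_all add: homeomorphic_eq_everything_map)
  have hX: "continuous_map (top_of_set S) X h" using h(1) by (simp add: continuous_map_in_subtopology)
  have "closedin X (h ` K)" if "closedin (top_of_set S) K" for K
  proof -
    have "compactin (top_of_set S) K"
      using that S closedin_compact_space compact_space_subtopology by (metis compactin_euclidean_iff)
    then show ?thesis using image_compactin[OF _ hX] compactin_imp_closedin[OF X] by blast
  qed
  then have "closed_embedding (top_of_set S) X h" 
    using hX h(2) by (simp add: closed_embedding_def closed_map_def)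
  moreover have "h ` S = a" using h(3) a(1) by (simp add: Int_absorb1)
  ultimately show ?thesis by (rule that)
qed

lemma is_disc_with_rim:
  assumes X: "Hausdorff_space X" and D: "is_disc X D"
  shows "disc_with_rim X D (surface_boundary (subtopology X D))"
proof -
  let ?Y = "subtopology X D"
  obtain h where h: "disc_map X h" "h ` cball 0 1 = D"
    using homeomorphic_space_closed_embedding[OF X compact_cball] D unfolding is_disc_def by metis
  have hY: "disc_map ?Y h"
    by (rule closed_embedding_into_subtopology[OF h(1)]) (simp add: h(2))
  have top: "topspace ?Y = h ` cball 0 1 \<union> {}" using D h(2) by (auto simp: is_disc_def)
  have "x \<in> surface_boundary ?Y \<longleftrightarrow> x \<in> h ` sphere 0 1" for x
  proof
    assume x: "x \<in> surface_boundary ?Y"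
    then have "x \<in> topspace ?Y" by (simp add: surface_boundary_def)
    then obtain z where z: "z \<in> cball 0 1" "x = h z" using top by blast
    have "\<not> norm z < 1" using inner_point_not_boundary[OF hY closedin_empty top, of z] x z(2) by auto
    then show "x \<in> h ` sphere 0 1" using z by simp
  next
    assume "x \<in> h ` sphere 0 1"
    then obtain z where "z \<in> sphere 0 1" "x = h z" by blast
    then show "x \<in> surface_boundary ?Y" using rim_point_in_boundary[OF hY closedin_empty top] by blast
  qed
  then have "surface_boundary ?Y = h ` sphere 0 1" by blast
  then show ?thesis unfolding disc_with_rim_def using h by blast
qed

lemma is_segment_arc:
  assumes X: "Hausdorff_space X" and s: "is_segment X s"
  obtains p q where "arc_in X s p q"
proof -
  obtain h where h: "arc_map X h" "h ` {0..1} = s"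
    using homeomorphic_space_closed_embedding[OF X compact_Icc] s unfolding is_segment_def by metis
  then show ?thesis using that arc_inI[OF h refl refl] by blast
qed

text \<open>The end points of s2 are renamed according to the order in which they are met along the circle.\<close>

lemma circle_two_arcs_square:
  assumes c: "circle_in Z c" and s: "arc_in Z s1 p q" "arc_in Z s2 u v" "s1 \<inter> s2 = {}" "s1 \<subseteq> c" "s2 \<subseteq> c"
  shows "\<exists>t1 t2 p2 q2. square Z s1 s2 t1 t2 p q p2 q2 \<and> c = s1 \<union> s2 \<union> (t1 \<union> t2)"
proof -
  define a where "a = c - (s1 - {p,q})"
  have a: "arc_in Z a p q" unfolding a_def by (rule circle_diff_arc[OF c s(1,4)])
  have pq: "p \<in> s1" "q \<in> s1" using arc_in_ends[OF s(1)] by auto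
  have "s2 \<subseteq> a" "p \<notin> s2" "q \<notin> s2" using s(3,5) pq by (auto simp: a_def)
  then obtain u' v' a1 a2 where d: "{u',v'} = {u,v}" "arc_in Z a1 p u'" "arc_in Z a2 v' q"
      "a1 \<inter> a2 = {}" "a - s2 = (a1 - {u'}) \<union> (a2 - {v'})" "a1 \<inter> s2 = {u'}" "a2 \<inter> s2 = {v'}"
    using arc_diff_arc[OF a s(2)] by metis
  have m: "p \<in> a1" "u' \<in> a1" "v' \<in> a2" "q \<in> a2" using arc_in_ends[OF d(2)] arc_in_ends[OF d(3)] by auto
  have s2': "arc_in Z s2 u' v'"
  proof -
    consider "u' = u" "v' = v" | "u' = v" "v' = u" using d(1) by (metis doubleton_eq_iff)
    then show ?thesis using s(2) arc_in_reverse[OF s(2)] by cases simp_all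
  qed
  have m2: "u' \<in> s2" "v' \<in> s2" using arc_in_ends[OF s2'] by auto
  have as1: "x = p \<or> x = q" if "x \<in> a1 \<union> a2" "x \<in> s1" for x
  proof -
    have "x \<noteq> u'" "x \<noteq> v'" using that(2) m2 s(3) by blast+
    then have "x \<in> a" using that(1) d(5) by blast
    then show ?thesis using that(2) by (simp add: a_def)
  qed
  have nm: "p \<notin> a2" "q \<notin> a1" using m d(4) by blast+
  have i: "s1 \<inter> a1 = {p}" "s1 \<inter> a2 = {q}" using as1 nm pq m by blast+
  have "square Z s1 s2 a1 a2 p q u' v'"
    unfolding square_def
    using s(1) s2' d(2) arc_in_reverse[OF d(3)] s(3) d(4) i d(6,7) by (simp add: Int_commute)
  moreover have "c = s1 \<union> s2 \<union> (a1 \<union> a2)"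
  proof (rule set_eqI)
    fix x
    have "x \<in> a - s2 \<longleftrightarrow> x \<in> (a1 - {u'}) \<union> (a2 - {v'})" using d(5) by simp
    moreover have "x = u' \<or> x = v' \<longrightarrow> x \<in> s2" "x \<in> s1 \<longrightarrow> x \<in> c" "x \<in> s2 \<longrightarrow> x \<in> c" "x = p \<or> x = q \<longrightarrow> x \<in> s1"
      using m2 s(4,5) pq by blast+
    ultimately show "x \<in> c \<longleftrightarrow> x \<in> s1 \<union> s2 \<union> (a1 \<union> a2)" unfolding a_def by simp metis
  qed
  ultimately show ?thesis by blast
qed

text \<open>Collects what is known about the boundary circle of one edge, so that the arcs and corners of all
edges can be chosen simultaneously.\<close>

definition edge_square ::
  "('a, 'v, 'e, 'm) ribbon_graph_scheme \<Rightarrow> 'e \<Rightarrow> 'a set \<Rightarrow> 'a set \<Rightarrow> 'a set \<Rightarrow> 'a set \<Rightarrow> 'a \<Rightarrow> 'a \<Rightarrow> 'a \<Rightarrow> 'a \<Rightarrow> bool" where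
  "edge_square G e s1 s2 t1 t2 p1 q1 p2 q2 \<longleftrightarrow>
     square (surface G) s1 s2 t1 t2 p1 q1 p2 q2 \<and>
     surface_boundary (subtopology (surface G) (edisc G e)) = s1 \<union> s2 \<union> (t1 \<union> t2) \<and>
     (\<Union>v\<in>verts G. vdisc G v) \<inter> edisc G e = s1 \<union> s2 \<and>
     s1 \<union> s2 \<subseteq> (\<Union>v\<in>verts G. surface_boundary (subtopology (surface G) (vdisc G v)))"

lemma ribbon_graph_Hausdorff: "ribbon_graph G \<Longrightarrow> Hausdorff_space (surface G)"
  by (simp add: ribbon_graph_def surface_with_boundary_def)

text \<open>The two segments of e are components of the intersection of vertices and edges, and every component
that meets e lies on the rim of e because edges are disjoint. So the vertices meet e in exactly these
two segments.\<close>

lemma ribbon_graph_edge_square: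
  assumes G: "ribbon_graph G" and e: "e \<in> edges G"
  shows "\<exists>s1 s2 t1 t2 p1 q1 p2 q2. edge_square G e s1 s2 t1 t2 p1 q1 p2 q2"
proof -
  let ?X = "surface G"
  let ?M = "(\<Union>v\<in>verts G. vdisc G v) \<inter> (\<Union>e\<in>edges G. edisc G e)"
  have X: "Hausdorff_space ?X" by (rule ribbon_graph_Hausdorff[OF G])
  have ed: "is_disc ?X (edisc G a)" if "a \<in> edges G" for a using G that by (simp add: ribbon_graph_def)
  have dj: "edisc G a \<inter> edisc G b = {}" if "a \<in> edges G" "b \<in> edges G" "a \<noteq> b" for a b
    using G that by (auto simp: ribbon_graph_def disjoint_family_on_def)
  have seg: "is_segment ?X s"
     "\<exists>v\<in>verts G. s \<subseteq> surface_boundary (subtopology ?X (vdisc G v))"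
     "\<exists>e\<in>edges G. s \<subseteq> surface_boundary (subtopology ?X (edisc G e))" if "s \<in> segments G" for s
  proof -
    have "\<forall>s\<in>segments G. is_segment ?X s \<and>
        (\<exists>!v. v \<in> verts G \<and> s \<subseteq> surface_boundary (subtopology ?X (vdisc G v))) \<and>
        (\<exists>!e. e \<in> edges G \<and> s \<subseteq> surface_boundary (subtopology ?X (edisc G e)))"
      using G unfolding ribbon_graph_def by (elim conjE)
    note h = bspec[OF this that]
    show "is_segment ?X s" using h by (elim conjE)
    show "\<exists>v\<in>verts G. s \<subseteq> surface_boundary (subtopology ?X (vdisc G v))"
      using ex1_implies_ex[OF conjunct1[OF conjunct2[OF h]]] by blast
    show "\<exists>e\<in>edges G. s \<subseteq> surface_boundary (subtopology ?X (edisc G e))"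
      using ex1_implies_ex[OF conjunct2[OF conjunct2[OF h]]] by blast
  qed
  define rim where "rim a = surface_boundary (subtopology ?X (edisc G a))" for a
  have rim: "disc_with_rim ?X (edisc G a) (rim a)" if "a \<in> edges G" for a
    unfolding rim_def by (rule is_disc_with_rim[OF X ed[OF that]])
  have ne: "s \<noteq> {}" if "s \<in> segments G" for s
    using that nonempty_connected_components_of unfolding segments_def by metis
  have home: "s \<subseteq> rim e" if s: "s \<in> segments G" "s \<inter> edisc G e \<noteq> {}" for s
  proof -
    obtain a where a: "a \<in> edges G" "s \<subseteq> rim a" using seg(3)[OF s(1)] unfolding rim_def by blast
    then have "s \<subseteq> edisc G a" using disc_with_rim_props(4)[OF rim] by blast
    then have "a = e" using dj[OF a(1) e] s(2) by blast
    then show ?thesis using a(2) by simp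
  qed
  have "card {s \<in> segments G. s \<subseteq> edisc G e} = 2" using G e by (simp add: ribbon_graph_def)
  then obtain s1 s2 where S: "{s \<in> segments G. s \<subseteq> edisc G e} = {s1, s2}" "s1 \<noteq> s2"
    by (meson card_2_iff)
  have s: "s1 \<in> segments G" "s1 \<subseteq> edisc G e" "s2 \<in> segments G" "s2 \<subseteq> edisc G e"
    using S(1) by blast+
  have d: "s1 \<inter> s2 = {}"
    using comps_disjoint[of s1 ?X ?M s2] s(1,3) S(2) unfolding segments_def by blast
  obtain p q where a1: "arc_in ?X s1 p q" using is_segment_arc[OF X seg(1)[OF s(1)]] .
  obtain u v where a2: "arc_in ?X s2 u v" using is_segment_arc[OF X seg(1)[OF s(3)]] .
  have r: "s1 \<subseteq> rim e" "s2 \<subseteq> rim e" using home s ne by (metis Int_absorb2)+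
  obtain t1 t2 p2 q2 where sq: "square ?X s1 s2 t1 t2 p q p2 q2" "rim e = s1 \<union> s2 \<union> (t1 \<union> t2)"
    using circle_two_arcs_square[OF disc_with_rim_props(3)[OF rim[OF e]] a1 a2 d r] by blast
  have M: "?M \<subseteq> topspace ?X" using G by (auto simp: ribbon_graph_def)
  have U: "\<Union>(segments G) = ?M" 
    unfolding segments_def Union_connected_components_of using M by (simp add: Int_absorb1)
  have meet: "(\<Union>v\<in>verts G. vdisc G v) \<inter> edisc G e = s1 \<union> s2"
  proof
    show "s1 \<union> s2 \<subseteq> (\<Union>v\<in>verts G. vdisc G v) \<inter> edisc G e"
      using s Union_upper[OF s(1)] Union_upper[OF s(3)] unfolding U by blast
    show "(\<Union>v\<in>verts G. vdisc G v) \<inter> edisc G e \<subseteq> s1 \<union> s2"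
    proof
      fix x assume x: "x \<in> (\<Union>v\<in>verts G. vdisc G v) \<inter> edisc G e"
      then have "x \<in> \<Union>(segments G)" unfolding U using e by blast
      then obtain t where t: "t \<in> segments G" "x \<in> t" by blast
      then have "t \<subseteq> edisc G e" using home[OF t(1)] x disc_with_rim_props(4)[OF rim[OF e]] by blast
      then have "t \<in> {s1, s2}" using t(1) S(1) by blast
      then show "x \<in> s1 \<union> s2" using t(2) by blast
    qed
  qed
  have "s1 \<union> s2 \<subseteq> (\<Union>v\<in>verts G. surface_boundary (subtopology ?X (vdisc G v)))"
    using seg(2)[OF s(1)] seg(2)[OF s(3)] by blast
  then have "edge_square G e s1 s2 t1 t2 p q p2 q2"
    unfolding edge_square_def using sq meet unfolding rim_def by blast
  then show ?thesis by blast
qed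

lemma ribbon_graph_disc_system:
  assumes G: "ribbon_graph G"
  defines "vr \<equiv> \<lambda>v. surface_boundary (subtopology (surface G) (vdisc G v))"
  obtains s1 s2 t1 t2 p1 q1 p2 q2 where
    "disc_system (surface G) (\<Union>v\<in>verts G. vr v) (edges G) s1 s2 t1 t2 p1 q1 p2 q2
       (verts G) (vdisc G) vr (edisc G)"
proof -
  let ?X = "surface G"
  have X: "Hausdorff_space ?X" by (rule ribbon_graph_Hausdorff[OF G])
  have "\<forall>e\<in>edges G. \<exists>s1 s2 t1 t2 p1 q1 p2 q2. edge_square G e s1 s2 t1 t2 p1 q1 p2 q2"
    using ribbon_graph_edge_square[OF G] by blast
  then obtain s1 s2 t1 t2 p1 q1 p2 q2 where
    es: "\<And>e. e \<in> edges G \<Longrightarrow> edge_square G e (s1 e) (s2 e) (t1 e) (t2 e) (p1 e) (q1 e) (p2 e) (q2 e)"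
    by metis
  have vd: "disc_with_rim ?X (vdisc G v) (vr v)" if "v \<in> verts G" for v
    unfolding vr_def using G that is_disc_with_rim[OF X] by (simp add: ribbon_graph_def)
  have ed: "disc_with_rim ?X (edisc G e) (s1 e \<union> s2 e \<union> (t1 e \<union> t2 e))" if "e \<in> edges G" for e
  proof -
    have "is_disc ?X (edisc G e)" using G that by (simp add: ribbon_graph_def)
    from is_disc_with_rim[OF X this] show ?thesis using es[OF that] by (simp add: edge_square_def)
  qed
  have vdj: "vdisc G v \<inter> vdisc G w = {}" if "v \<in> verts G" "w \<in> verts G" "v \<noteq> w" for v w
    using G that by (auto simp: ribbon_graph_def disjoint_family_on_def)
  have edj: "edisc G a \<inter> edisc G b = {}" if "a \<in> edges G" "b \<in> edges G" "a \<noteq> b" for a b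
    using G that by (auto simp: ribbon_graph_def disjoint_family_on_def)
  have sq: "square ?X (s1 e) (s2 e) (t1 e) (t2 e) (p1 e) (q1 e) (p2 e) (q2 e)"
    and meet: "(\<Union>v\<in>verts G. vdisc G v) \<inter> edisc G e = s1 e \<union> s2 e"
    and sub: "s1 e \<union> s2 e \<subseteq> (\<Union>v\<in>verts G. vr v)" if "e \<in> edges G" for e
    using es[OF that] by (simp_all add: edge_square_def vr_def)
  have fin: "finite (verts G)" "finite (edges G)" using G by (simp_all add: ribbon_graph_def)
  have rv: "vr v \<subseteq> vdisc G v" if "v \<in> verts G" for v using disc_with_rim_props(4)[OF vd[OF that]] .
  have re: "s1 e \<union> s2 e \<union> (t1 e \<union> t2 e) \<subseteq> edisc G e" if "e \<in> edges G" for e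
    using disc_with_rim_props(4)[OF ed[OF that]] .
  have "disc_system ?X (\<Union>v\<in>verts G. vr v) (edges G) s1 s2 t1 t2 p1 q1 p2 q2 (verts G) (vdisc G) vr (edisc G)"
  proof
    show "finite (edges G)" "finite (verts G)" by (rule fin)+
    show "circle_union ?X (\<Union>v\<in>verts G. vr v)"
      unfolding circle_union_def
    proof (intro exI[of _ "vr ` verts G"] conjI ballI)
      show "pairwise disjnt (vr ` verts G)"
      proof (rule pairwise_imageI)
        fix v w assume "v \<in> verts G" "w \<in> verts G" "v \<noteq> w"
        then show "disjnt (vr v) (vr w)" using vdj[of v w] rv[of v] rv[of w] unfolding disjnt_def by blast
      qed
      show "circle_in ?X c" if "c \<in> vr ` verts G" for c using that disc_with_rim_props(3)[OF vd] by blast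
    qed (use fin in simp_all)
    fix e assume e: "e \<in> edges G"
    show "square ?X (s1 e) (s2 e) (t1 e) (t2 e) (p1 e) (q1 e) (p2 e) (q2 e)" by (rule sq[OF e])
    show "s1 e \<union> s2 e \<subseteq> (\<Union>v\<in>verts G. vr v)" by (rule sub[OF e])
    show "(t1 e \<union> t2 e) \<inter> (\<Union>v\<in>verts G. vr v) = {p1 e, q1 e, p2 e, q2 e}"
    proof -
      have "(\<Union>v\<in>verts G. vr v) \<subseteq> (\<Union>v\<in>verts G. vdisc G v)" using rv by (rule UN_mono[OF order_refl])
      then have "(t1 e \<union> t2 e) \<inter> (\<Union>v\<in>verts G. vr v) = (t1 e \<union> t2 e) \<inter> (s1 e \<union> s2 e)"
        using re[OF e] meet[OF e] sub[OF e] by blast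
      also have "\<dots> = {p1 e, q1 e, p2 e, q2 e}" using sq[OF e] unfolding square_def by blast
      finally show ?thesis .
    qed
    show "disc_with_rim ?X (edisc G e) (s1 e \<union> s2 e \<union> (t1 e \<union> t2 e))" by (rule ed[OF e])
    show "vdisc G v \<inter> edisc G e \<subseteq> s1 e \<union> s2 e" if "v \<in> verts G" for v using meet[OF e] that by blast
    fix e' assume e': "e' \<in> edges G" "e \<noteq> e'"
    show "edisc G e \<inter> edisc G e' = {}" by (rule edj[OF e e'])
    then show "(s1 e \<union> s2 e \<union> (t1 e \<union> t2 e)) \<inter> (s1 e' \<union> s2 e' \<union> (t1 e' \<union> t2 e')) = {}"
      using re[OF e] re[OF e'(1)] by blast
  qed (use vd vdj in auto)
  then show ?thesis by (rule that)
qed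

section \<open>The capped surface\<close>

text \<open>If the boundary components are circles, an attaching map exists for each, and the map chosen
in the definition of the capped surface is a homeomorphism onto the component.\<close>

locale cappable =
  fixes G :: "('a, 'v, 'e, 'm) ribbon_graph_scheme"
  assumes finite_caps: "finite (boundary_components (surface G))"
    and boundary_circles: "C \<in> boundary_components (surface G) \<Longrightarrow> circle_in (surface G) C"
begin

abbreviation "X \<equiv> surface G"
abbreviation "\<C> \<equiv> boundary_components X"

lemma boundary_disjoint: "C \<in> \<C> \<Longrightarrow> D \<in> \<C> \<Longrightarrow> C \<noteq> D \<Longrightarrow> C \<inter> D = {}"
  unfolding boundary_components_def by (rule comps_disjoint)

lemma attach_map:
  assumes C: "C \<in> \<C>"
  shows "circle_map X (attach_map G C)" "attach_map G C ` sphere 0 1 = C"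
proof -
  obtain g where g: "circle_map X g" "C = g ` sphere 0 1"
    using boundary_circles[OF C] unfolding circle_in_def by blast
  have "homeomorphic_map (top_of_set (sphere 0 1)) (subtopology X C) g"
    using closed_embedding_homeomorphic_map[OF g(1)] g(2) by simp
  from someI[of "homeomorphic_map (top_of_set (sphere 0 1)) (subtopology X C)", OF this]
  have hm: "homeomorphic_map (top_of_set (sphere 0 1)) (subtopology X C) (attach_map G C)"
    unfolding attach_map_def .
  have cl: "closedin X C" using circle_in_closedin[OF boundary_circles[OF C]] .
  have CX: "C \<subseteq> topspace X" using closedin_subset[OF cl] .
  show "attach_map G C ` sphere 0 1 = C"
    using homeomorphic_imp_surjective_map[OF hm] CX by (simp add: Int_absorb1)
  have "closed_map (top_of_set (sphere 0 1)) X (attach_map G C)"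
    using homeomorphic_imp_closed_map[OF hm] cl closed_map_from_closed_subtopology
    by (metis closed_map_def closedin_trans_full)
  moreover have "continuous_map (top_of_set (sphere 0 1)) X (attach_map G C)"
    using homeomorphic_imp_continuous_map[OF hm] by (simp add: continuous_map_in_subtopology)
  ultimately show "circle_map X (attach_map G C)"
    using homeomorphic_imp_injective_map[OF hm] by (simp add: closed_embedding_def)
qed

lemma attach_in: "C \<in> \<C> \<Longrightarrow> z \<in> sphere 0 1 \<Longrightarrow> attach_map G C z \<in> C"
  using attach_map(2) by blast

lemma boundary_in_surface: "C \<in> \<C> \<Longrightarrow> C \<subseteq> topspace X"
  using circle_in_closedin[OF boundary_circles] closedin_subset by blast

definition points :: "('a + 'a set \<times> complex) set" where
  "points = Inl ` topspace X \<union> (\<Union>C\<in>\<C>. cap G C)"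

lemma cap_map_points: "C \<in> \<C> \<Longrightarrow> z \<in> cball 0 1 \<Longrightarrow> cap_map G C z \<in> points"
  unfolding points_def cap_def by blast

lemma openin_capped: "openin (capped_surface G) = capped_open G"
  unfolding capped_surface_def by (rule topology_inverse'[OF istopology_capped_open])

lemma topspace_capped: "topspace (capped_surface G) = points"
proof
  show "topspace (capped_surface G) \<subseteq> points"
    unfolding topspace_def openin_capped
  proof (rule Union_least)
    show "U \<subseteq> points" if "U \<in> {U. capped_open G U}" for U
      using that unfolding capped_open_def points_def by blast
  qed
  have "capped_open G points"
    unfolding capped_open_def
  proof (intro conjI ballI)
    show "points \<subseteq> Inl ` topspace X \<union> (\<Union>C\<in>\<C>. cap G C)" by (simp add: points_def)
    have "{p \<in> topspace X. Inl p \<in> points} = topspace X" by (auto simp: points_def)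
    then show "openin X {p \<in> topspace X. Inl p \<in> points}" by simp
    fix C assume "C \<in> \<C>"
    then have "{z \<in> cball 0 1. cap_map G C z \<in> points} = cball 0 1" using cap_map_points by blast
    then show "openin (top_of_set (cball 0 1)) {z \<in> cball 0 1. cap_map G C z \<in> points}" by simp
  qed
  then show "points \<subseteq> topspace (capped_surface G)"
    using openin_subset unfolding openin_capped[symmetric] by blast
qed

lemma closedin_capped:
  "closedin (capped_surface G) T \<longleftrightarrow> T \<subseteq> points \<and> closedin X {p \<in> topspace X. Inl p \<in> T} \<and>
     (\<forall>C\<in>\<C>. closedin (top_of_set (cball 0 1)) {z \<in> cball 0 1. cap_map G C z \<in> T})"
proof (cases "T \<subseteq> points")
  case True
  have "{p \<in> topspace X. Inl p \<in> points - T} = topspace X - {p \<in> topspace X. Inl p \<in> T}"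
    by (auto simp: points_def)
  moreover have "{z \<in> cball 0 1. cap_map G C z \<in> points - T} =
      topspace (top_of_set (cball 0 1)) - {z \<in> cball 0 1. cap_map G C z \<in> T}" if "C \<in> \<C>" for C
    using cap_map_points[OF that] by auto
  moreover have "{p \<in> topspace X. Inl p \<in> T} \<subseteq> topspace X"
    "{z \<in> cball 0 1. cap_map G C z \<in> T} \<subseteq> topspace (top_of_set (cball 0 1))" for C by auto
  moreover have "points - T \<subseteq> Inl ` topspace X \<union> (\<Union>C\<in>\<C>. cap G C)" unfolding points_def by blast
  ultimately show ?thesis
    using True unfolding closedin_def topspace_capped openin_capped capped_open_def by simp
next
  case False
  then show ?thesis using closedin_subset[of "capped_surface G" T] topspace_capped by auto
qed

lemma closed_embedding_Inl: "closed_embedding X (capped_surface G) Inl"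
  unfolding closed_embedding_def continuous_map_closedin closed_map_def
proof (intro conjI allI impI)
  show "Inl \<in> topspace X \<rightarrow> topspace (capped_surface G)" by (auto simp: topspace_capped points_def)
  show "closedin X {x \<in> topspace X. Inl x \<in> K}" if "closedin (capped_surface G) K" for K
    using that unfolding closedin_capped by blast
  show "inj_on Inl (topspace X)" by simp
  fix K assume K: "closedin X K"
  have KX: "K \<subseteq> topspace X" using closedin_subset[OF K] .
  show "closedin (capped_surface G) (Inl ` K)"
    unfolding closedin_capped
  proof (intro conjI ballI)
    show "Inl ` K \<subseteq> points" using KX by (auto simp: points_def)
    have "{p \<in> topspace X. (Inl p :: 'a + 'a set \<times> complex) \<in> Inl ` K} = K" using KX by auto
    then show "closedin X {p \<in> topspace X. (Inl p :: 'a + 'a set \<times> complex) \<in> Inl ` K}" using K by simp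
    fix C assume C: "C \<in> \<C>"
    have "{z \<in> cball 0 1. cap_map G C z \<in> Inl ` K} = {z \<in> sphere 0 1. attach_map G C z \<in> K}"
      by (auto simp: cap_map_def)
    moreover have "closedin (top_of_set (sphere 0 1)) {z \<in> sphere 0 1. attach_map G C z \<in> K}"
      using closed_embedding_preimage[OF attach_map(1)[OF C] K] .
    then have "closed {z \<in> sphere 0 1. attach_map G C z \<in> K}" by (meson closed_sphere closedin_closed_trans)
    ultimately show "closedin (top_of_set (cball 0 1)) {z \<in> cball 0 1. cap_map G C z \<in> Inl ` K}"
      by (auto intro: closed_subset)
  qed
qed

lemma cap_map_eqD:
  assumes "C \<in> \<C>" "D \<in> \<C>" "z \<in> cball 0 1" "w \<in> cball 0 1" "cap_map G C z = cap_map G D w"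
  shows "C = D \<and> z = w"
proof (cases "norm z = 1")
  case True
  then have w: "norm w = 1" "attach_map G C z = attach_map G D w"
    using assms(5) by (auto simp: cap_map_def split: if_splits)
  then have "C = D" using boundary_disjoint[OF assms(1,2)] attach_in[OF assms(1), of z] attach_in[OF assms(2), of w] True by auto
  moreover have "inj_on (attach_map G C) (sphere 0 1)"
    using attach_map(1)[OF assms(1)] by (simp add: closed_embedding_def)
  ultimately show ?thesis using w True by (auto dest: inj_onD)
next
  case False
  then show ?thesis using assms(5) by (auto simp: cap_map_def split: if_splits)
qed

lemma closed_embedding_cap_map:
  assumes C: "C \<in> \<C>" shows "disc_map (capped_surface G) (cap_map G C)"
  unfolding closed_embedding_def continuous_map_closedin closed_map_def topspace_euclidean_subtopology
proof (intro conjI allI impI)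
  show "cap_map G C \<in> cball 0 1 \<rightarrow> topspace (capped_surface G)"
    using cap_map_points[OF C] unfolding topspace_capped by blast
  show "closedin (top_of_set (cball 0 1)) {x \<in> cball 0 1. cap_map G C x \<in> K}"
    if "closedin (capped_surface G) K" for K
    using that C unfolding closedin_capped by blast
  show "inj_on (cap_map G C) (cball 0 1)" using cap_map_eqD[OF C C] by (simp add: inj_on_def)
  fix K :: "complex set" assume K: "closedin (top_of_set (cball 0 1)) K"
  have KC: "K \<subseteq> cball 0 1" using closedin_imp_subset[OF K] .
  show "closedin (capped_surface G) (cap_map G C ` K)"
    unfolding closedin_capped
  proof (intro conjI ballI)
    show "cap_map G C ` K \<subseteq> points" using cap_map_points[OF C] KC by blast
    have "{p \<in> topspace X. Inl p \<in> cap_map G C ` K} = attach_map G C ` (K \<inter> sphere 0 1)"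
    proof (intro set_eqI iffI)
      fix p assume "p \<in> {p \<in> topspace X. Inl p \<in> cap_map G C ` K}"
      then obtain z where z: "z \<in> K" "Inl p = cap_map G C z" by blast
      then have "norm z = 1" "p = attach_map G C z" by (auto simp: cap_map_def split: if_splits)
      then show "p \<in> attach_map G C ` (K \<inter> sphere 0 1)" using z(1) by auto
    next
      fix p assume "p \<in> attach_map G C ` (K \<inter> sphere 0 1)"
      then obtain z where z: "z \<in> K" "z \<in> sphere 0 1" "p = attach_map G C z" by blast
      then have "Inl p = cap_map G C z" by (simp add: cap_map_def)
      then have "Inl p \<in> cap_map G C ` K" using z(1) by blast
      moreover have "p \<in> topspace X" using z attach_in[OF C] boundary_in_surface[OF C] by blast
      ultimately show "p \<in> {p \<in> topspace X. Inl p \<in> cap_map G C ` K}" by blast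
    qed
    moreover have "closedin (top_of_set (sphere 0 1)) (K \<inter> sphere 0 1)"
    proof -
      have "closed K" using K by (meson closed_cball closedin_closed_trans)
      then show ?thesis by (intro closed_subset closed_Int closed_sphere) auto
    qed
    ultimately show "closedin X {p \<in> topspace X. Inl p \<in> cap_map G C ` K}"
      using closed_embedding_closedin[OF attach_map(1)[OF C]] by simp
    fix D assume D: "D \<in> \<C>"
    show "closedin (top_of_set (cball 0 1)) {z \<in> cball 0 1. cap_map G D z \<in> cap_map G C ` K}"
    proof (cases "D = C")
      case True
      have "{z \<in> cball 0 1. cap_map G C z \<in> cap_map G C ` K} = K"
        using cap_map_eqD[OF C C] KC by blast
      then show ?thesis using K True by simp
    next
      case False
      have none: "{z \<in> cball 0 1. cap_map G D z \<in> cap_map G C ` K} = {}"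
        using cap_map_eqD[OF D C] KC False by blast
      show ?thesis unfolding none by simp
    qed
  qed
qed

lemma cap_disc: "C \<in> \<C> \<Longrightarrow> disc_with_rim (capped_surface G) (cap G C) (Inl ` C)"
proof -
  assume C: "C \<in> \<C>"
  have "cap_map G C ` sphere 0 1 = Inl ` attach_map G C ` sphere 0 1"
    by (force simp: cap_map_def image_iff)
  then have "Inl ` C = cap_map G C ` sphere 0 1" using attach_map(2)[OF C] by simp
  then show ?thesis unfolding disc_with_rim_def cap_def using closed_embedding_cap_map[OF C] by blast
qed

lemma caps_disjoint: "C \<in> \<C> \<Longrightarrow> D \<in> \<C> \<Longrightarrow> C \<noteq> D \<Longrightarrow> cap G C \<inter> cap G D = {}"
  unfolding cap_def using cap_map_eqD by blast

lemma cap_Inl: "C \<in> \<C> \<Longrightarrow> Inl x \<in> cap G C \<Longrightarrow> x \<in> C"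
  unfolding cap_def using attach_in by (auto simp: cap_map_def split: if_splits)

end

section \<open>The invariants of a ribbon graph and of its geometric dual\<close>

text \<open>The counts of a disc system describe a ribbon graph on subsets of the edge set only.\<close>

lemma face_component_system_cong:
  assumes "face_component_system E f k"
    and f: "\<And>A. A \<subseteq> E \<Longrightarrow> f' A = f A" and k: "\<And>A. A \<subseteq> E \<Longrightarrow> k' A = k A"
  shows "face_component_system E f' k'"
proof -
  interpret face_component_system E f k by fact
  show ?thesis
  proof
    show "finite E" by (rule finite_E)
    show "f' {} = k' {}" using f_empty by (simp add: f k)
  next
    fix A e assume h: "A \<subseteq> E" "e \<in> E - A"
    then have i: "insert e A \<subseteq> E" by blast
    note r = f[OF h(1)] f[OF i] k[OF h(1)] k[OF i]
    show "k' (insert e A) = k' A \<or> Suc (k' (insert e A)) = k' A" unfolding r by (rule k_step[OF h])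
    show "f' (insert e A) \<le> Suc (f' A) \<and> f' A \<le> Suc (f' (insert e A))" unfolding r by (rule f_step[OF h])
    show "Suc (f' (insert e A)) = f' A" if "Suc (k' (insert e A)) = k' A"
      using bridge[OF h] that unfolding r by blast
  next
    fix A A' e assume h: "A \<subseteq> A'" "A' \<subseteq> E" "e \<in> E - A'" "k' (insert e A) = k' A"
    then have i: "A \<subseteq> E" "insert e A \<subseteq> E" "insert e A' \<subseteq> E" by blast+
    show "k' (insert e A') = k' A'"
      using k_mono[OF h(1-3)] h(4) unfolding k[OF i(1)] k[OF i(2)] k[OF i(3)] k[OF h(2)] by blast
  next
    fix A assume A: "A \<subseteq> E"
    show "k' A \<le> f' A" unfolding f[OF A] k[OF A] by (rule k_le_f[OF A])
    assume "k' A < f' A"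
    then obtain e where e: "e \<in> A" "Suc (f (A - {e})) = f A"
      using merge[OF A] unfolding f[OF A] k[OF A] by blast
    have "A - {e} \<subseteq> E" using A by blast
    then have "Suc (f' (A - {e})) = f' A" using e(2) f A by simp
    then show "\<exists>e\<in>A. Suc (f' (A - {e})) = f' A" using e(1) by blast
  qed
qed

text \<open>The squares of G with segments and sides exchanged, transported into the capped surface, form a
disc system whose vertices are the caps. Its counts are those of the geometric dual, and the duality
of square systems relates them to the counts of G.\<close>

lemma ribbon_graph_systems:
  fixes G :: "('a, 'v, 'e) ribbon_graph"
  assumes G: "ribbon_graph G"
  shows "face_component_system (edges G) (rg_f G) (rg_k G)"
    and "face_component_system (edges G) (rg_f (geometric_dual G)) (rg_k (geometric_dual G))"
    and "card (verts G) = rg_k G {}" 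
    and "card (verts (geometric_dual G)) = rg_k (geometric_dual G) {}"
    and "\<And>A. A \<subseteq> edges G \<Longrightarrow> rg_f (geometric_dual G) A = rg_f G (edges G - A)"
    and "rg_k (geometric_dual G) (edges G) = rg_k G (edges G)"
proof -
  let ?E = "edges G" and ?X = "surface G"
  define vr where "vr v = surface_boundary (subtopology ?X (vdisc G v))" for v
  obtain s1 s2 t1 t2 p1 q1 p2 q2 where
    "disc_system ?X (\<Union>v\<in>verts G. vr v) ?E s1 s2 t1 t2 p1 q1 p2 q2 (verts G) (vdisc G) vr (edisc G)"
    using ribbon_graph_disc_system[OF G] unfolding vr_def by blast
  then interpret D: disc_system ?X "\<Union>v\<in>verts G. vr v" ?E s1 s2 t1 t2 p1 q1 p2 q2 "verts G" "vdisc G" vr "edisc G" .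
  have topX: "topspace ?X = D.surf ?E" using G by (simp add: ribbon_graph_def D.surf_def)
  have XE: "subtopology ?X (D.surf ?E) = ?X" using subtopology_topspace[of ?X] topX by simp
  have bc: "boundary_components ?X = comps ?X (D.bd ?E)"
    using D.boundary_components_surf[OF order_refl] unfolding XE .
  note cu = D.circle_union_bd[OF order_refl]
  interpret cappable G
    by unfold_locales (use circle_union_comps(1,2)[OF cu] bc in auto)
  let ?Y = "capped_surface G"
  interpret Du: square_system ?X "D.bd ?E" ?E t1 t2 s1 s2 p1 p2 q1 q2 by (rule D.dual)
  let ?I = "Inl :: 'a \<Rightarrow> 'a + 'a set \<times> complex"
  have un: "\<Union>\<C> = D.bd ?E" unfolding bc by (rule circle_union_comps(3)[OF cu])
  interpret Ds: square_system ?Y "?I ` D.bd ?E" ?E "\<lambda>e. ?I ` t1 e" "\<lambda>e. ?I ` t2 e" "\<lambda>e. ?I ` s1 e" "\<lambda>e. ?I ` s2 e"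
     "\<lambda>e. ?I (p1 e)" "\<lambda>e. ?I (p2 e)" "\<lambda>e. ?I (q1 e)" "\<lambda>e. ?I (q2 e)"
    by (rule Du.square_system_image[OF closed_embedding_Inl])
  interpret Dd: disc_system ?Y "?I ` D.bd ?E" ?E "\<lambda>e. ?I ` t1 e" "\<lambda>e. ?I ` t2 e" "\<lambda>e. ?I ` s1 e" "\<lambda>e. ?I ` s2 e"
     "\<lambda>e. ?I (p1 e)" "\<lambda>e. ?I (p2 e)" "\<lambda>e. ?I (q1 e)" "\<lambda>e. ?I (q2 e)"
     \<C> "cap G" "\<lambda>C. ?I ` C" "\<lambda>e. ?I ` edisc G e"
  proof
    show "finite \<C>" by (rule finite_caps)
    show "disc_with_rim ?Y (cap G C) (?I ` C)" if "C \<in> \<C>" for C using cap_disc[OF that] .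
    show "?I ` D.bd ?E = (\<Union>C\<in>\<C>. ?I ` C)" unfolding un[symmetric] by blast
    show "cap G C \<inter> cap G C' = {}" if "C \<in> \<C>" "C' \<in> \<C>" "C \<noteq> C'" for C C' using caps_disjoint[OF that] .
    fix e assume e: "e \<in> ?E"
    have "D.segs e \<union> D.sides e = t1 e \<union> t2 e \<union> (s1 e \<union> s2 e)" by blast
    then show "disc_with_rim ?Y (?I ` edisc G e) (?I ` t1 e \<union> ?I ` t2 e \<union> (?I ` s1 e \<union> ?I ` s2 e))"
      using disc_with_rim_image[OF closed_embedding_Inl D.edge_disc[OF e]] by (simp add: image_Un)
    show "?I ` edisc G e \<inter> ?I ` edisc G e' = {}" if "e' \<in> ?E" "e \<noteq> e'" for e'
      using D.edges_disjoint[OF e that] by blast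
    show "cap G C \<inter> ?I ` edisc G e \<subseteq> ?I ` t1 e \<union> ?I ` t2 e" if C: "C \<in> \<C>" for C
    proof
      fix y assume "y \<in> cap G C \<inter> ?I ` edisc G e"
      then obtain x where x: "y = ?I x" "x \<in> edisc G e" "x \<in> C" using cap_Inl[OF C] by blast
      \<comment> \<open>a boundary point on the edge lies on a side, as the segments keep only their corners\<close>
      have xb: "x \<in> D.bd ?E" using x(3) C un by blast
      then have "x \<in> D.skel ?E" using D.bd_sub_skel by blast
      then have "x \<in> D.segs e \<union> D.sides e" using D.skel_edge[OF order_refl e x(2)] by blast
      moreover have "D.segs e \<inter> D.bd ?E = D.corners e"
        using D.segs_bd_insert[of "?E - {e}" e] e by (simp add: insert_absorb)
      then have "x \<in> D.segs e \<Longrightarrow> x \<in> D.sides e" using xb D.segs_sides[OF e] by blast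
      ultimately have "x \<in> D.sides e" by blast
      then show "y \<in> ?I ` t1 e \<union> ?I ` t2 e" using x(1) by blast
    qed
  qed
  have sG: "surface (spanning_subgraph G A) = subtopology ?X (D.surf A)" for A
    by (simp add: spanning_subgraph_def D.surf_def)
  have sG': "surface (spanning_subgraph (geometric_dual G) A) = subtopology ?Y (Dd.surf A)" if "A \<subseteq> ?E" for A
  proof -
    have "(\<Union>e\<in>A. ?I ` edisc G e) \<subseteq> (\<Union>e\<in>?E. ?I ` edisc G e)" using that by (rule UN_mono) simp
    then have "(\<Union>C\<in>\<C>. cap G C) \<union> (\<Union>e\<in>A. ?I ` edisc G e)
        \<subseteq> (\<Union>C\<in>\<C>. cap G C) \<union> (\<Union>e\<in>?E. ?I ` edisc G e)" by blast
    then show ?thesis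
      by (simp add: spanning_subgraph_def geometric_dual_def Dd.surf_def subtopology_subtopology Int_absorb1)
  qed
  have f: "rg_f G A = D.f A" and k: "rg_k G A = D.k A" if A: "A \<subseteq> ?E" for A
    unfolding rg_f_def rg_k_def sG D.boundary_components_surf[OF A]
    using D.ncomp_surf[OF A] by (simp_all add: D.f_def ncomp_def)
  have f': "rg_f (geometric_dual G) A = Ds.f A" and k': "rg_k (geometric_dual G) A = Ds.k A"
    if A: "A \<subseteq> ?E" for A
    unfolding rg_f_def rg_k_def sG'[OF A] Dd.boundary_components_surf[OF A]
    using Dd.ncomp_surf[OF A] by (simp_all add: Ds.f_def ncomp_def)
  show "face_component_system ?E (rg_f G) (rg_k G)"
    by (rule face_component_system_cong[OF D.face_component_system f k])
  show "face_component_system ?E (rg_f (geometric_dual G)) (rg_k (geometric_dual G))"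
    by (rule face_component_system_cong[OF Ds.face_component_system f' k'])
  show "card (verts G) = rg_k G {}" using D.card_V k by simp
  show "card (verts (geometric_dual G)) = rg_k (geometric_dual G) {}"
    using Dd.card_V k' by (simp add: geometric_dual_def)
  show "rg_f (geometric_dual G) A = rg_f G (?E - A)" if A: "A \<subseteq> ?E" for A
  proof -
    have "Ds.f A = D.f (?E - A)"
      using Du.f_image[OF closed_embedding_Inl A] unfolding Du.f_def D.dual_bd[OF A] D.f_def .
    then show ?thesis using f'[OF A] f by simp
  qed
  have "Ds.k ?E = D.k ?E"
    using Du.k_image[OF closed_embedding_Inl order_refl] unfolding Du.k_def D.dual_skel D.k_def .
  then show "rg_k (geometric_dual G) ?E = rg_k G ?E" using k k' by simp
qed

theorem theorem6p8:
  fixes G :: "('a, 'v, 'e) ribbon_graph"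
    and x y a b :: "'r :: comm_ring_1"
  assumes "ribbon_graph G"
  shows "krushkal_ribbon G x y a b = krushkal_dm (ribbon_delta_matroid G) x y a b"
proof -
  let ?E = "edges G" and ?G' = "geometric_dual G"
  note sys = ribbon_graph_systems[OF assms]
  interpret P: face_component_system ?E "rg_f G" "rg_k G" by (rule sys(1))
  interpret Q: face_component_system ?E "rg_f ?G'" "rg_k ?G'" by (rule sys(2))
  let ?D = "ribbon_delta_matroid G"
  have D: "?D = P.dm ?E" by (simp add: ribbon_delta_matroid_def P.dm_def)
  have D': "dm_dual ?D = Q.dm ?E"
  proof -
    have "{?E - F |F. F \<subseteq> ?E \<and> rg_f G F = rg_k G ?E} = {B. B \<subseteq> ?E \<and> rg_f ?G' B = rg_k ?G' ?E}"
    proof (intro set_eqI iffI)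
      fix B assume "B \<in> {?E - F |F. F \<subseteq> ?E \<and> rg_f G F = rg_k G ?E}"
      then obtain F where F: "F \<subseteq> ?E" "rg_f G F = rg_k G ?E" "B = ?E - F" by blast
      then have "?E - B = F" "B \<subseteq> ?E" by blast+
      then show "B \<in> {B. B \<subseteq> ?E \<and> rg_f ?G' B = rg_k ?G' ?E}" using F(2) sys(5,6) by simp
    next
      fix B assume "B \<in> {B. B \<subseteq> ?E \<and> rg_f ?G' B = rg_k ?G' ?E}"
      then have B: "B \<subseteq> ?E" "rg_f G (?E - B) = rg_k G ?E" using sys(5,6) by auto
      then have "B = ?E - (?E - B)" by blast
      then show "B \<in> {?E - F |F. F \<subseteq> ?E \<and> rg_f G F = rg_k G ?E}" using B(2) by blast
    qed
    then show ?thesis unfolding D dm_dual_def P.dm_def Q.dm_def by simp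
  qed
  have fst: "fst ?D = ?E" by (simp add: ribbon_delta_matroid_def)
  have "(x - 1) ^ nat (rg_rank G ?E - rg_rank G A) *
        y ^ nat (rg_rank ?G' ?E - rg_rank ?G' (?E - A)) *
        a ^ nat (euler_genus G A) * b ^ nat (euler_genus ?G' (?E - A)) =
      (x - 1) ^ nat (int (matroid_rank (min_bases ?D) ?E) - int (matroid_rank (min_bases ?D) A)) *
        y ^ nat (int (matroid_rank (min_bases (dm_dual ?D)) ?E)
                 - int (matroid_rank (min_bases (dm_dual ?D)) (?E - A))) *
        a ^ nat (width_on ?D A) * b ^ nat (width_on (dm_dual ?D) (?E - A))"
    if A: "A \<in> Pow ?E" for A
  proof -
    have A: "A \<subseteq> ?E" and B: "?E - A \<subseteq> ?E" using A by auto
    have 1: "rg_rank G X = int (matroid_rank (min_bases ?D) X)" if "X \<subseteq> ?E" for X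
      unfolding D using P.matroid_rank_min[OF order_refl that] by (simp add: rg_rank_def sys(3,4))
    have 2: "rg_rank ?G' X = int (matroid_rank (min_bases (dm_dual ?D)) X)" if "X \<subseteq> ?E" for X
      unfolding D' using Q.matroid_rank_min[OF order_refl that] by (simp add: rg_rank_def sys(3,4))
    have 3: "euler_genus G X = width_on ?D X" if "X \<subseteq> ?E" for X
      unfolding D using P.width_on_dm[OF that] by (simp add: euler_genus_def sys(3,4))
    have 4: "euler_genus ?G' X = width_on (dm_dual ?D) X" if "X \<subseteq> ?E" for X
      unfolding D' using Q.width_on_dm[OF that] by (simp add: euler_genus_def sys(3,4))
    show ?thesis
      unfolding 1[OF order_refl] 1[OF A] 2[OF order_refl] 2[OF B] 3[OF A] 4[OF B] ..
  qed
  then show ?thesis unfolding krushkal_ribbon_def krushkal_dm_def fst by (intro sum.cong refl)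
qed

end
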